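(* Let $d, D \in \mathbb{N}$, $\beta, H > 0$, $\sigma \in (0,1)$, and let $g^* \in \mathcal{H}^\beta([0,1]^d, \mathbb{R}^D, H)$ satisfy $\|g^*\|_{L^\infty([0,1]^d)} \leq 1$. Let $\mathsf{p}^*$ be the density of $Y_0 = g^*(U) + \sigma \xi$, where $U \sim \mathrm{Un}([0,1]^d)$ and $\xi \sim \mathcal{N}(0, I_D)$ are independent. Let $\alpha \geq 2$ be an integer and let $h : \mathbb{R}^D \to \mathbb{R}^D$ satisfy $|h|_{W^{\alpha,2}(\mathsf{p}^* )} < \infty$. Then $$(i)\quad \|\mathrm{div}[h]\|_{L^2(\mathsf{p}^* )}^2 \leq \frac{\alpha D}{\sigma^2} \left( \|h\|_{L^2(\mathsf{p}^* )}^2 + \sigma^{2\alpha} |h|_{W^{\alpha,2}(\mathsf{p}^* )}^2 \right)^{1/\alpha} \|h\|_{L^2(\mathsf{p}^* )}^{2 - 2/\alpha},$$ $$(ii)\quad \big\| \|\nabla h\|_F \big\|_{L^2(\mathsf{p}^* )}^2 \leq \frac{\alpha D^{1 - 1/\alpha}}{\sigma^2} \left( D \|h\|_{L^2(\mathsf{p}^* )}^2 + \sigma^{2\alpha} |h|_{W^{\alpha,2}(\mathsf{p}^* )}^2 \right)^{1/\alpha} \|h\|_{L^2(\mathsf{p}^* )}^{2 - 2/\alpha}.$$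
   Context: Hölder ball: for $\beta > 0$, $\lfloor\beta\rfloor$ denotes the largest integer strictly less than $\beta$. For $\Omega \subseteq \mathbb{R}^r$ and $0 \leq \delta \leq 1$, $[f]_\delta = \sup_{x \neq y \in \Omega} |f(x)-f(y)| / (1 \wedge \|x-y\|_\infty^\delta)$. $\mathcal{H}^\beta(\Omega, \mathbb{R}^m, H)$ is the set of $f = (f_1,\dots,f_m): \Omega \to \mathbb{R}^m$ with bounded continuous derivatives up to order $\lfloor\beta\rfloor$ such that, for all $i$, $\|\partial^{\mathbf{k}} f_i\|_{L^\infty(\Omega)} \leq H$ for all multi-indices $|\mathbf{k}| \leq \lfloor\beta\rfloor$ and $[\partial^{\mathbf{k}} f_i]_{\beta - \lfloor\beta\rfloor} \leq H$ for all $|\mathbf{k}| = \lfloor\beta\rfloor$. For vector-valued $f$, $\|f\|_{L^\infty(\Omega)} = \sup_{x\in\Omega}\|f(x)\|$ with $\|\cdot\|$ Euclidean. Weighted norms: $\|f\|_{L^2(\mathsf{p})}^2 = \int_{\mathbb{R}^D} \|f(x)\|^2 \mathsf{p}(x)\,dx$. For $h = (h_1,\dots,h_D)$, the weighted Sobolev seminorm is $|h|_{W^{\alpha,2}(\mathsf{p})}^2 = \sum_{i=1}^D \sum_{\mathbf{k} \in \mathbb{Z}_+^D, |\mathbf{k}| = \alpha} \|\partial^{\mathbf{k}} h_i\|_{L^2(\mathsf{p})}^2$ (derivatives in the weak sense). $\mathrm{div}[h] = \sum_{i=1}^D \partial h_i / \partial x_i$, $\nabla h$ is the Jacobian matrix,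 and $\|\cdot\|_F$ is the Frobenius norm. *)

theory Defs
  imports "HOL-Analysis.Analysis" "HOL-Probability.Probability"
begin

text \<open>Multi-indices are functions \<open>k :: 'n \<Rightarrow> nat\<close> on the finite index type of \<open>real ^ 'n\<close>.\<close>

definition mi_order :: "('n::finite \<Rightarrow> nat) \<Rightarrow> nat" where
  "mi_order k = (\<Sum>i\<in>UNIV. k i)"

definition mi_unit :: "'n \<Rightarrow> 'n \<Rightarrow> nat" where
  "mi_unit j = (\<lambda>_. 0)(j := 1)"

text \<open>\<open>cont_partials \<Omega> n f F\<close>: \<open>f\<close> is \<open>n\<close> times continuously differentiable on \<open>\<Omega>\<close> and
  \<open>F k\<close> is the classical partial derivative of \<open>f\<close> with multi-index \<open>k\<close>, for every \<open>k\<close> of order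
  at most \<open>n\<close> (independent of the order of differentiation).  Difference quotients are taken inside
  \<open>\<Omega>\<close>, so derivatives are one-sided at the boundary of a closed cube and are the ordinary ones when
  \<open>\<Omega>\<close> is open.  On cubes and on open sets \<open>F\<close> is uniquely determined by \<open>f\<close>
  on \<open>\<Omega>\<close> up to order \<open>n\<close>.\<close>

definition cont_partials ::
  "(real ^ 'n::finite) set \<Rightarrow> nat \<Rightarrow> (real ^ 'n \<Rightarrow> real) \<Rightarrow> (('n \<Rightarrow> nat) \<Rightarrow> real ^ 'n \<Rightarrow> real) \<Rightarrow> bool" where
  "cont_partials \<Omega> n f F \<longleftrightarrow>
     (\<forall>x\<in>\<Omega>. F (\<lambda>_. 0) x = f x) \<and>
     (\<forall>k. mi_order k \<le> n \<longrightarrow> continuous_on \<Omega> (F k)) \<and>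
     (\<forall>k i. mi_order k < n \<longrightarrow>
        (\<forall>x\<in>\<Omega>. ((\<lambda>t. F k (x + t *\<^sub>R axis i 1)) has_real_derivative F (k(i := Suc (k i))) x)
                 (at 0 within {t. x + t *\<^sub>R axis i 1 \<in> \<Omega>})))"


text \<open>The floor in the Hoelder classes is the largest integer strictly less than \<open>\<beta>\<close>
  (so \<open>strict_floor 1 = 0\<close>); it is only used for \<open>\<beta> > 0\<close>.\<close>

definition strict_floor :: "real \<Rightarrow> nat" where
  "strict_floor \<beta> = (GREATEST n::nat. real n < \<beta>)"

definition sup_norm :: "'a set \<Rightarrow> ('a \<Rightarrow> 'b::real_normed_vector) \<Rightarrow> ennreal" where
  "sup_norm \<Omega> f = (SUP x\<in>\<Omega>. ennreal (norm (f x)))"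

definition holder_seminorm :: "real \<Rightarrow> (real ^ 'n::finite) set \<Rightarrow> (real ^ 'n \<Rightarrow> real) \<Rightarrow> ennreal" where
  "holder_seminorm \<delta> \<Omega> f =
     (SUP (x, y)\<in>{(x, y). x \<in> \<Omega> \<and> y \<in> \<Omega> \<and> x \<noteq> y}.
        ennreal (\<bar>f x - f y\<bar> / min 1 (infnorm (x - y) powr \<delta>)))"

definition holder_ball :: "real \<Rightarrow> (real ^ 'n::finite) set \<Rightarrow> real \<Rightarrow> (real ^ 'n \<Rightarrow> real ^ 'm::finite) set" where
  "holder_ball \<beta> \<Omega> H =
     {f. \<forall>i. \<exists>F. cont_partials \<Omega> (strict_floor \<beta>) (\<lambda>x. f x $ i) F \<and>
           (\<forall>k. mi_order k \<le> strict_floor \<beta> \<longrightarrow> sup_norm \<Omega> (F k) \<le> ennreal H) \<and>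
           (\<forall>k. mi_order k = strict_floor \<beta> \<longrightarrow>
                  holder_seminorm (\<beta> - real (strict_floor \<beta>)) \<Omega> (F k) \<le> ennreal H)}"


definition locally_integrable :: "(real ^ 'n::finite \<Rightarrow> real) \<Rightarrow> bool" where
  "locally_integrable f \<longleftrightarrow> (\<forall>K. compact K \<longrightarrow> set_integrable lebesgue K f)"

text \<open>\<open>test_function \<phi> \<Phi>\<close>: \<open>\<phi>\<close> is smooth with compact support and \<open>\<Phi> k\<close> is its partial
  derivative with multi-index \<open>k\<close>.\<close>

definition test_function ::
  "(real ^ 'n::finite \<Rightarrow> real) \<Rightarrow> (('n \<Rightarrow> nat) \<Rightarrow> real ^ 'n \<Rightarrow> real) \<Rightarrow> bool" where
  "test_function \<phi> \<Phi> \<longleftrightarrow>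
     compact (closure {x. \<phi> x \<noteq> 0}) \<and> (\<forall>n. cont_partials UNIV n \<phi> \<Phi>)"

definition has_weak_deriv ::
  "(real ^ 'n::finite \<Rightarrow> real) \<Rightarrow> ('n \<Rightarrow> nat) \<Rightarrow> (real ^ 'n \<Rightarrow> real) \<Rightarrow> bool" where
  "has_weak_deriv f k v \<longleftrightarrow>
     locally_integrable f \<and> locally_integrable v \<and>
     (\<forall>\<phi> \<Phi>. test_function \<phi> \<Phi> \<longrightarrow>
        (LINT x|lebesgue. f x * \<Phi> k x) = (- 1) ^ mi_order k * (LINT x|lebesgue. v x * \<phi> x))"

definition weakly_diff :: "(real ^ 'n::finite \<Rightarrow> real) \<Rightarrow> ('n \<Rightarrow> nat) \<Rightarrow> bool" where
  "weakly_diff f k \<longleftrightarrow> (\<exists>v. has_weak_deriv f k v)"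

text \<open>A representative of the weak derivative, which is unique only up to null sets; meaningful
  only if \<open>weakly_diff f k\<close>.\<close>

definition weak_deriv :: "('n::finite \<Rightarrow> nat) \<Rightarrow> (real ^ 'n \<Rightarrow> real) \<Rightarrow> real ^ 'n \<Rightarrow> real" where
  "weak_deriv k f = (SOME v. has_weak_deriv f k v)"

definition weak_div :: "(real ^ 'n::finite \<Rightarrow> real ^ 'n) \<Rightarrow> real ^ 'n \<Rightarrow> real" where
  "weak_div h x = (\<Sum>i\<in>UNIV. weak_deriv (mi_unit i) (\<lambda>y. h y $ i) x)"

definition weak_jacobian :: "(real ^ 'n::finite \<Rightarrow> real ^ 'n) \<Rightarrow> real ^ 'n \<Rightarrow> real ^ 'n ^ 'n" where
  "weak_jacobian h x = (\<chi> i j. weak_deriv (mi_unit j) (\<lambda>y. h y $ i) x)"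

definition frobenius_norm :: "real ^ 'n::finite ^ 'm::finite \<Rightarrow> real" where
  "frobenius_norm A = sqrt (\<Sum>i\<in>UNIV. \<Sum>j\<in>UNIV. (A $ i $ j)\<^sup>2)"


text \<open>Independence of two Borel random variables of different types; the library's
  \<open>indep_var\<close> requires equal types.\<close>

definition indep_rvs :: "'w measure \<Rightarrow> ('w \<Rightarrow> 'a::topological_space) \<Rightarrow> ('w \<Rightarrow> 'b::topological_space) \<Rightarrow> bool" where
  "indep_rvs M X Y \<longleftrightarrow>
     prob_space.indep_set M {X -` A \<inter> space M | A. A \<in> sets borel} {Y -` B \<inter> space M | B. B \<in> sets borel}"


text \<open>Real powers on \<open>[0, \<infinity>]\<close>, used for exponents \<open>a > 0\<close> only (where \<open>\<infinity>\<close> to the power \<open>a\<close> is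
  \<open>\<infinity>\<close>, and \<open>0\<close> to the power \<open>a\<close> is \<open>0\<close>).\<close>

definition epowr :: "ennreal \<Rightarrow> real \<Rightarrow> ennreal" where
  "epowr x a = (if x = \<infinity> then \<infinity> else ennreal (enn2real x powr a))"

text \<open>In the norms below the weight \<open>p\<close> is a density with values in \<open>[0, \<infinity>]\<close>, as in
  \<^const>\<open>distributed\<close>; all norms take values in \<open>[0, \<infinity>]\<close>.\<close>

definition L2_norm :: "(real ^ 'n::finite \<Rightarrow> ennreal) \<Rightarrow> (real ^ 'n \<Rightarrow> 'b::real_normed_vector) \<Rightarrow> ennreal" where
  "L2_norm p f = epowr (\<integral>\<^sup>+ x. ennreal ((norm (f x))\<^sup>2) * p x \<partial>lebesgue) (1 / 2)"

text \<open>The norm of a weak derivative that does not exist is \<open>\<infinity>\<close>.  Thus finiteness of any of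
  the following quantities includes the existence of the weak derivatives it involves.\<close>

definition weak_deriv_norm :: "(real ^ 'n::finite \<Rightarrow> ennreal) \<Rightarrow> ('n \<Rightarrow> nat) \<Rightarrow> (real ^ 'n \<Rightarrow> real) \<Rightarrow> ennreal" where
  "weak_deriv_norm p k f = (if weakly_diff f k then L2_norm p (weak_deriv k f) else \<infinity>)"

definition sobolev_seminorm :: "nat \<Rightarrow> (real ^ 'n::finite \<Rightarrow> ennreal) \<Rightarrow> (real ^ 'n \<Rightarrow> real ^ 'n) \<Rightarrow> ennreal" where
  "sobolev_seminorm \<alpha> p h =
     epowr (\<Sum>i\<in>UNIV. \<Sum>k\<in>{k. mi_order k = \<alpha>}. (weak_deriv_norm p k (\<lambda>x. h x $ i))\<^sup>2) (1 / 2)"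

definition div_norm :: "(real ^ 'n::finite \<Rightarrow> ennreal) \<Rightarrow> (real ^ 'n \<Rightarrow> real ^ 'n) \<Rightarrow> ennreal" where
  "div_norm p h =
     (if \<forall>i. weakly_diff (\<lambda>x. h x $ i) (mi_unit i) then L2_norm p (weak_div h) else \<infinity>)"

definition grad_norm :: "(real ^ 'n::finite \<Rightarrow> ennreal) \<Rightarrow> (real ^ 'n \<Rightarrow> real ^ 'n) \<Rightarrow> ennreal" where
  "grad_norm p h =
     (if \<forall>i j. weakly_diff (\<lambda>x. h x $ i) (mi_unit j)
      then L2_norm p (\<lambda>x. frobenius_norm (weak_jacobian h x)) else \<infinity>)"

text \<open>The sum over multi-indices in \<^const>\<open>sobolev_seminorm\<close> is over a finite set.\<close>

lemma finite_mi_order: "finite {k :: 'n::finite \<Rightarrow> nat. mi_order k = \<alpha>}"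
proof (rule finite_subset)
  have "k i \<le> \<alpha>" if "mi_order k = \<alpha>" for k :: "'n \<Rightarrow> nat" and i
    using that member_le_sum[of i UNIV k] by (auto simp: mi_order_def)
  then show "{k :: 'n \<Rightarrow> nat. mi_order k = \<alpha>} \<subseteq> (UNIV \<rightarrow>\<^sub>E {..\<alpha>})"
    by auto
qed (simp add: finite_PiE)

lemma L2_norm_power2: "(L2_norm p f)\<^sup>2 = (\<integral>\<^sup>+ x. ennreal ((norm (f x))\<^sup>2) * p x \<partial>lebesgue)"
proof (cases "(\<integral>\<^sup>+ x. ennreal ((norm (f x))\<^sup>2) * p x \<partial>lebesgue)")
  case (real r)
  then show ?thesis
    by (simp add: L2_norm_def epowr_def ennreal_power powr_half_sqrt)
qed (simp add: L2_norm_def epowr_def power2_eq_square)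

end

theory Submission
  imports Defs "HOL-Computational_Algebra.Polynomial"
begin

text \<open>
  The density \<open>p\<close> is a mixture of Gaussians with covariance \<open>\<sigma>\<^sup>2 I\<close> and mean in the unit ball, so it
  suffices to bound \<open>\<partial>\<^sub>j h\<^sub>i\<close> for one Gaussian by quantities linear in the squared norms and to integrate
  over the mean.  By Fubini this is a statement about functions on the line.  There, with
  \<open>b n = \<sigma> ^ (2 n) \<parallel>D ^ n f\<parallel>\<^sup>2\<close>, integration by parts against the Gaussian weight gives
  \<open>(b n)\<^sup>2 \<le> b (n - 1) (b n + b (n + 1))\<close>, whence
  \<open>b 1 \<le> \<kappa> ^ (\<alpha> - 1) (b 0 + b \<alpha>) + (\<alpha> - 1) / \<kappa> b 0\<close> for every \<open>\<kappa> > 0\<close>.  These linear bounds are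
  integrated over slices and means and summed over components and directions; only then is \<open>\<kappa>\<close>
  optimised, which replaces Hoelder's inequality.

  Only the weak derivatives of order \<open>\<alpha>\<close> are assumed to exist.  On almost every line parallel to
  the \<open>j\<close>-th axis, testing against a countable family of bump functions shows that \<open>h\<^sub>i\<close> agrees almost
  everywhere with an \<open>\<alpha>\<close>-fold antiderivative of \<open>\<partial>\<^sub>j\<^sup>\<alpha> h\<^sub>i\<close>.
\<close>

section \<open>Absolutely continuous functions on the line\<close>

text \<open>The quadratic inequality for \<open>b\<close> rests on the adjoint of differentiation in
  the Gaussian L2 space, which sends G to (t - m) G / \<sigma>^2 - G'. Its commutator with
  differentiation is 1 / \<sigma>^2, and this is the source of the summand \<open>b n\<close> next
  to \<open>b (n + 1)\<close>. The factor \<alpha> of the theorem is 1 + (\<alpha> - 1), the sum of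
  the two terms at the optimal \<kappa>. The factor D in (i) is Cauchy-Schwarz for the D summands of
  the divergence; the power of D in (ii) arises because every component is paired with D directions.
  Two obstacles shape the rest. A missing weak derivative has norm \<infinity>, so first-order
  derivatives have to be constructed; they are locally integrable because means in the unit ball
  keep the density bounded below on compact sets. And derivatives selected line by line need not be
  jointly measurable, so they are given by an explicit limit.\<close>

lemma integrable_mult_bounded_support:
  fixes f \<phi> :: "'a::euclidean_space \<Rightarrow> real"
  assumes f: "set_integrable lborel (cbox a b) f" and [measurable]: "\<phi> \<in> borel_measurable borel"
    and supp: "\<And>x. x \<notin> cbox a b \<Longrightarrow> \<phi> x = 0" and B: "\<And>x. x \<in> cbox a b \<Longrightarrow> \<bar>\<phi> x\<bar> \<le> B"
  shows "integrable lborel (\<lambda>x. f x * \<phi> x)"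
proof -
  have i: "integrable lborel (\<lambda>x. indicator (cbox a b) x * f x)"
    using f by (simp add: set_integrable_def)
  have eq: "f x * \<phi> x = (indicator (cbox a b) x * f x) * \<phi> x" for x
    using supp[of x] by (auto simp: indicator_def)
  show ?thesis
    unfolding eq
  proof (rule Bochner_Integration.integrable_bound[OF integrable_mult_right[OF i, of B]])
    show "(\<lambda>x. (indicator (cbox a b) x * f x) * \<phi> x) \<in> borel_measurable lborel"
      using borel_measurable_integrable[OF i] by measurable
    show "AE x in lborel. norm ((indicator (cbox a b) x * f x) * \<phi> x) \<le> norm (B * (indicator (cbox a b) x * f x))"
    proof (rule AE_I2)
      fix x
      show "norm ((indicator (cbox a b) x * f x) * \<phi> x) \<le> norm (B * (indicator (cbox a b) x * f x))"
      proof (cases "x \<in> cbox a b")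
        case True
        then have "\<bar>\<phi> x\<bar> \<le> \<bar>B\<bar>" using B[of x] by linarith
        then show ?thesis using True by (simp add: abs_mult mult.commute mult_right_mono)
      qed simp
    qed
  qed
qed

lemma integrable_mult_compact_support:
  fixes f \<phi> :: "'a::euclidean_space \<Rightarrow> real"
  assumes f: "set_integrable lborel (cbox a b) f" and \<phi>: "continuous_on UNIV \<phi>"
    and supp: "\<And>x. x \<notin> cbox a b \<Longrightarrow> \<phi> x = 0"
  shows "integrable lborel (\<lambda>x. f x * \<phi> x)"
proof -
  have "bounded (\<phi> ` cbox a b)"
    by (intro compact_imp_bounded compact_continuous_image continuous_on_subset[OF \<phi>]) auto
  then obtain B where B: "\<And>x. x \<in> cbox a b \<Longrightarrow> \<bar>\<phi> x\<bar> \<le> B"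
    unfolding bounded_iff by (metis image_eqI real_norm_def)
  show ?thesis
    by (rule integrable_mult_bounded_support[OF f borel_measurable_continuous_onI[OF \<phi>] supp B])
qed

text \<open>\<open>G\<close> is locally absolutely continuous with derivative \<open>g\<close>.  Unlike a pointwise derivative,
  \<open>g\<close> may be changed on null sets, so \<open>g\<close> can be a slice of a weak derivative.\<close>

definition abs_cont_deriv :: "(real \<Rightarrow> real) \<Rightarrow> (real \<Rightarrow> real) \<Rightarrow> bool" where
  "abs_cont_deriv G g \<longleftrightarrow> (\<forall>a b. set_integrable lborel {a..b} g) \<and>
     (\<forall>a b. a \<le> b \<longrightarrow> G b - G a = (LINT s:{a..b}|lborel. g s))"

lemma abs_cont_derivD:
  assumes "abs_cont_deriv G g"
  shows "set_integrable lborel {a..b} g" "a \<le> b \<Longrightarrow> G b - G a = (LINT s:{a..b}|lborel. g s)"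
  using assms by (auto simp: abs_cont_deriv_def)

lemma borel_measurable_if_set_integrable_Icc:
  fixes g :: "real \<Rightarrow> real"
  assumes "\<And>a b. set_integrable lborel {a..b} g"
  shows "g \<in> borel_measurable borel"
proof (rule borel_measurable_LIMSEQ_real)
  show "(\<lambda>x. indicator {- real n..real n} x * g x) \<in> borel_measurable borel" for n
    using assms[of "- real n" "real n"] by (auto simp: set_integrable_def dest: borel_measurable_integrable)
  show "(\<lambda>n. indicator {- real n..real n} x * g x) \<longlonglongrightarrow> g x" for x
  proof (rule tendsto_eventually)
    obtain N where "\<bar>x\<bar> \<le> real N" using real_arch_simple by blast
    then show "\<forall>\<^sub>F n in sequentially. indicator {- real n..real n} x * g x = g x"
      by (intro eventually_sequentiallyI[of N]) (auto simp: indicator_def)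
  qed
qed

lemma abs_cont_deriv_measurable:
  "abs_cont_deriv G g \<Longrightarrow> g \<in> borel_measurable borel"
  by (rule borel_measurable_if_set_integrable_Icc) (auto simp: abs_cont_deriv_def)

lemma abs_cont_deriv_integral_eq:
  assumes "abs_cont_deriv G g" "a \<le> b"
  shows "g integrable_on {a..b}" "G b - G a = integral {a..b} g"
  using assms set_borel_integral_eq_integral[of "{a..b}" g] by (auto simp: abs_cont_deriv_def)

lemma abs_cont_deriv_continuous:
  assumes "abs_cont_deriv G g"
  shows "continuous_on UNIV G"
proof -
  have "continuous_on {a<..<b} G" if "a < b" for a b
  proof -
    have "continuous_on {a..b} (\<lambda>x. G a + integral {a..x} g)"
      using abs_cont_deriv_integral_eq(1)[OF assms, of a b] that
      by (intro continuous_intros indefinite_integral_continuous_1) auto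
    moreover have "G a + integral {a..x} g = G x" if "x \<in> {a..b}" for x
      using abs_cont_deriv_integral_eq(2)[OF assms, of a x] that by auto
    ultimately have "continuous_on {a..b} G"
      by (metis (no_types, lifting) continuous_on_cong)
    then show ?thesis
      by (rule continuous_on_subset) auto
  qed
  then have "continuous_on (\<Union>n::nat. {- real n - 1<..<real n + 1}) G"
    by (intro continuous_on_open_UN) auto
  moreover have "(\<Union>n::nat. {- real n - 1<..<real n + 1}) = UNIV"
  proof -
    have "\<exists>n::nat. - real n - 1 < x \<and> x < real n + 1" for x
    proof -
      obtain n where "\<bar>x\<bar> \<le> real n" using real_arch_simple by blast
      then show ?thesis by (intro exI[of _ n]) auto
    qed
    then show ?thesis by auto
  qed
  ultimately show ?thesis by simp
qed

lemma abs_cont_deriv_has_derivative: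
  assumes "abs_cont_deriv G g" "continuous_on UNIV g"
  shows "(G has_real_derivative g x) (at x)"
proof -
  let ?a = "x - 1" and ?b = "x + 1"
  have "((\<lambda>u. integral {?a..u} g) has_real_derivative g x) (at x within {?a..?b})"
    by (rule integral_has_real_derivative) (auto intro: continuous_on_subset[OF assms(2)])
  then have "((\<lambda>u. G ?a + integral {?a..u} g) has_real_derivative g x) (at x within {?a..?b})"
    using DERIV_add[OF DERIV_const] by fastforce
  then have "(G has_real_derivative g x) (at x within {?a..?b})"
  proof (rule has_field_derivative_transform_within[of _ _ _ _ 1])
    show "G ?a + integral {?a..u} g = G u" if "u \<in> {?a..?b}" for u
      using abs_cont_deriv_integral_eq(2)[OF assms(1), of ?a u] that by simp
  qed auto
  then show ?thesis
    by (subst (asm) at_within_Icc_at) auto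
qed

lemma abs_cont_derivI_has_derivative:
  assumes "\<And>x. (G has_real_derivative g x) (at x)" "continuous_on UNIV g"
  shows "abs_cont_deriv G g"
  unfolding abs_cont_deriv_def
proof (intro conjI allI impI)
  show "set_integrable lborel {a..b} g" for a b
    by (rule borel_integrable_atLeastAtMost') (auto intro: continuous_on_subset[OF assms(2)])
  then show "G b - G a = (LINT s:{a..b}|lborel. g s)" if "a \<le> b" for a b
  proof -
    have "(g has_integral G b - G a) {a..b}"
      using assms(1) that
      by (intro fundamental_theorem_of_calculus)
        (simp_all add: has_field_derivative_at_within flip: has_real_derivative_iff_has_vector_derivative)
    then show ?thesis
      using \<open>set_integrable lborel {a..b} g\<close> set_borel_integral_eq_integral(2) by (metis integral_unique)
  qed
qed

lemma abs_cont_deriv_set_integrable_mult: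
  fixes g K :: "real \<Rightarrow> real"
  assumes g: "\<And>a b. set_integrable lborel {a..b} g" and K: "continuous_on UNIV K"
  shows "set_integrable lborel {a..b} (\<lambda>x. g x * K x)"
proof -
  have "bounded (K ` {a..b})"
    by (intro compact_imp_bounded compact_continuous_image continuous_on_subset[OF K] compact_Icc) auto
  then obtain B where B: "\<And>x. x \<in> {a..b} \<Longrightarrow> \<bar>K x\<bar> \<le> B"
    unfolding bounded_iff by (metis image_eqI real_norm_def)
  have [measurable]: "K \<in> borel_measurable borel" by (rule borel_measurable_continuous_onI[OF K])
  have "integrable lborel (\<lambda>x. g x * (indicator {a..b} x * K x))"
    by (rule integrable_mult_bounded_support[of a b _ _ B]) (use g B in auto)
  then show ?thesis by (simp add: set_integrable_def mult.left_commute)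
qed

text \<open>The derivatives are merely integrable functions, so the product rule is proved in
  integrated form. Expanding \<open>G\<close> from the left end \<open>a\<close> and
  \<open>K\<close> from the right end \<open>b\<close> brings both \<open>g * K\<close> and
  \<open>G * k\<close> down to the integral of \<open>g r * k s\<close> over the same triangle r
  \<le> s, taken in the two orders; by Fubini the two contributions cancel.\<close>

lemma abs_cont_deriv_mult:
  assumes G: "abs_cont_deriv G g" and K: "abs_cont_deriv K k"
  shows "abs_cont_deriv (\<lambda>x. G x * K x) (\<lambda>x. g x * K x + G x * k x)"
proof -
  note [measurable] = abs_cont_deriv_measurable[OF G] abs_cont_deriv_measurable[OF K]
  note cG = abs_cont_deriv_continuous[OF G] and cK = abs_cont_deriv_continuous[OF K]
  have si: "set_integrable lborel {a..b} (\<lambda>x. g x * K x)" "set_integrable lborel {a..b} (\<lambda>x. G x * k x)" for a b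
    using abs_cont_deriv_set_integrable_mult[OF abs_cont_derivD(1)[OF G] cK, of a b]
      abs_cont_deriv_set_integrable_mult[OF abs_cont_derivD(1)[OF K] cG, of a b]
    by (auto simp: mult.commute)
  have "G b * K b - G a * K a = (LINT s:{a..b}|lborel. g s * K s + G s * k s)" if "a \<le> b" for a b
  proof -
    define g1 where "g1 = (\<lambda>x. indicator {a..b} x * g x)"
    define k1 where "k1 = (\<lambda>x. indicator {a..b} x * k x)"
    let ?P = "\<lambda>r. \<integral>s. indicator {..s} r * (g1 r * k1 s) \<partial>lborel"
    let ?Q = "\<lambda>s. \<integral>r. indicator {..s} r * (g1 r * k1 s) \<partial>lborel"
    let ?PI = "\<integral>r. ?P r \<partial>lborel" and ?QI = "\<integral>s. ?Q s \<partial>lborel"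
    let ?g = "\<integral>r. g1 r \<partial>lborel" and ?k = "\<integral>r. k1 r \<partial>lborel"
    let ?gK = "LINT s:{a..b}|lborel. g s * K s" and ?Gk = "LINT s:{a..b}|lborel. G s * k s"
    have [measurable]: "g1 \<in> borel_measurable borel" "k1 \<in> borel_measurable borel"
      by (auto simp: g1_def k1_def)
    have ig: "integrable lborel g1" and ik: "integrable lborel k1"
      using abs_cont_derivD(1)[OF G, of a b] abs_cont_derivD(1)[OF K, of a b]
      by (auto simp: g1_def k1_def set_integrable_def)
    have Gs: "G s = G a + (\<integral>r. indicator {..s} r * g1 r \<partial>lborel)" if "s \<in> {a..b}" for s
    proof -
      have "(\<integral>r. indicator {..s} r * g1 r \<partial>lborel) = (LINT r:{a..s}|lborel. g r)"
        unfolding set_lebesgue_integral_def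
        by (rule Bochner_Integration.integral_cong) (use that in \<open>auto simp: g1_def indicator_def\<close>)
      then show ?thesis using abs_cont_derivD(2)[OF G, of a s] that by auto
    qed
    have Kr: "K r = K b - (\<integral>s. indicator {..s} r * k1 s \<partial>lborel)" if "r \<in> {a..b}" for r
    proof -
      have "(\<integral>s. indicator {..s} r * k1 s \<partial>lborel) = (LINT s:{r..b}|lborel. k s)"
        unfolding set_lebesgue_integral_def
        by (rule Bochner_Integration.integral_cong) (use that in \<open>auto simp: k1_def indicator_def\<close>)
      then show ?thesis using abs_cont_derivD(2)[OF K, of r b] that by auto
    qed
    have "integrable (lborel \<Otimes>\<^sub>M lborel) (\<lambda>(r, s). g1 r * k1 s)"
    proof (rule lborel_pair.Fubini_integrable)
      show "integrable lborel (\<lambda>x. \<integral>y. norm (case (x, y) of (r, s) \<Rightarrow> g1 r * k1 s) \<partial>lborel)"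
        using ig ik by (simp add: abs_mult)
      show "AE x in lborel. integrable lborel (\<lambda>y. case (x, y) of (r, s) \<Rightarrow> g1 r * k1 s)"
        using ik by simp
    qed measurable
    then have int2: "integrable (lborel \<Otimes>\<^sub>M lborel) (\<lambda>(r, s). indicator {..s} r * (g1 r * k1 s))"
    proof (rule Bochner_Integration.integrable_bound)
      have *: "(\<lambda>(r, s). indicator {..s} r * (g1 r * k1 s)) = (\<lambda>z. (if fst z \<le> snd z then g1 (fst z) * k1 (snd z) else 0))"
        by (auto simp: indicator_def)
      show "(\<lambda>(r, s). indicator {..s} r * (g1 r * k1 s)) \<in> borel_measurable (lborel \<Otimes>\<^sub>M lborel)"
        unfolding * by measurable
    qed (auto simp: indicator_def)
    note F = lborel_pair.Fubini_integral[OF int2]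
    have i2a: "integrable lborel ?P"
      using lborel_pair.integrable_fst[OF int2] by simp
    have i2b: "integrable lborel ?Q"
      using lborel_pair.integrable_snd[OF int2] by simp
    have "?gK = (\<integral>r. K b * g1 r - ?P r \<partial>lborel)"
      unfolding set_lebesgue_integral_def
    proof (rule Bochner_Integration.integral_cong)
      fix r
      have "?P r = g1 r * (\<integral>s. indicator {..s} r * k1 s \<partial>lborel)"
        by (subst integral_mult_right_zero[symmetric]) (simp add: mult.left_commute)
      then show "indicat_real {a..b} r *\<^sub>R (g r * K r) = K b * g1 r - ?P r"
        by (cases "r \<in> {a..b}") (simp_all only: Kr, simp_all add: g1_def right_diff_distrib mult.commute)
    qed simp
    also have "\<dots> = K b * ?g - ?PI"
      using ig i2a by (subst Bochner_Integration.integral_diff) auto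
    finally have e1: "?gK = K b * ?g - ?PI" .
    have "?Gk = (\<integral>s. G a * k1 s + ?Q s \<partial>lborel)"
      unfolding set_lebesgue_integral_def
    proof (rule Bochner_Integration.integral_cong)
      fix s
      have "?Q s = k1 s * (\<integral>r. indicator {..s} r * g1 r \<partial>lborel)"
        by (subst integral_mult_right_zero[symmetric]) (simp add: ac_simps)
      then show "indicat_real {a..b} s *\<^sub>R (G s * k s) = G a * k1 s + ?Q s"
        by (cases "s \<in> {a..b}") (simp_all only: Gs, simp_all add: k1_def distrib_left distrib_right mult.commute)
    qed simp
    also have "\<dots> = G a * ?k + ?QI"
      using ik i2b by (subst Bochner_Integration.integral_add) auto
    finally have e2: "?Gk = G a * ?k + ?QI" .
    have ints: "?g = G b - G a" "?k = K b - K a"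
      using abs_cont_derivD(2)[OF G that] abs_cont_derivD(2)[OF K that]
      by (auto simp: g1_def k1_def set_lebesgue_integral_def)
    have "(LINT s:{a..b}|lborel. g s * K s + G s * k s)
        = ?gK + ?Gk"
      by (rule set_integral_add(2)[OF si])
    also have "\<dots> = K b * (G b - G a) + G a * (K b - K a)"
      unfolding e1 e2 F ints by simp
    finally show ?thesis by (simp add: algebra_simps)
  qed
  then show ?thesis
    using si by (auto simp: abs_cont_deriv_def)
qed

lemma abs_cont_deriv_integral_zero:
  assumes G: "abs_cont_deriv G g" and iG: "integrable lborel G" and ig: "integrable lborel g"
  shows "(\<integral>x. g x \<partial>lborel) = 0"
proof -
  \<comment> \<open>Integrate \<open>G (x + 1) - G x\<close>: the integral is \<open>0\<close> by translation invariance and equals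
    \<open>\<integral> g\<close> by Fubini.\<close>
  note [measurable] = abs_cont_deriv_measurable[OF G]
  define F where "F = (\<lambda>x s. indicator {s - 1..s} x * g s :: real)"
  have [measurable]: "(\<lambda>(x, s). F x s) \<in> borel_measurable (lborel \<Otimes>\<^sub>M lborel)"
  proof -
    have "(\<lambda>(x, s). F x s) = (\<lambda>z. if snd z - 1 \<le> fst z \<and> fst z \<le> snd z then g (snd z) else 0)"
      by (auto simp: F_def indicator_def)
    then show ?thesis by simp
  qed
  have "integrable (lborel \<Otimes>\<^sub>M lborel) (\<lambda>(s, x). F x s)"
  proof (rule lborel_pair.Fubini_integrable)
    show "(\<lambda>(s, x). F x s) \<in> borel_measurable (lborel \<Otimes>\<^sub>M lborel)" by measurable
    show "integrable lborel (\<lambda>s. \<integral>x. norm (case (s, x) of (s, x) \<Rightarrow> F x s) \<partial>lborel)"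
      using ig by (simp add: F_def abs_mult)
    show "AE s in lborel. integrable lborel (\<lambda>x. case (s, x) of (s, x) \<Rightarrow> F x s)"
      by (auto simp: F_def intro!: integrable_real_indicator)
  qed
  then have int: "integrable (lborel \<Otimes>\<^sub>M lborel) (\<lambda>(x, s). F x s)"
    using lborel_pair.integrable_product_swap_iff[of "\<lambda>(s, x). F x s"] by simp
  have "(\<integral>s. g s \<partial>lborel) = (\<integral>s. (\<integral>x. F x s \<partial>lborel) \<partial>lborel)"
    by (simp add: F_def)
  also have "\<dots> = (\<integral>x. (\<integral>s. F x s \<partial>lborel) \<partial>lborel)"
    using lborel_pair.Fubini_integral[OF int] .
  also have "\<dots> = (\<integral>x. G (x + 1) - G x \<partial>lborel)"
  proof (rule Bochner_Integration.integral_cong)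
    fix x
    have "(\<integral>s. F x s \<partial>lborel) = (LINT s:{x..x+1}|lborel. g s)"
      unfolding set_lebesgue_integral_def
      by (rule Bochner_Integration.integral_cong) (auto simp: F_def indicator_def)
    then show "(\<integral>s. F x s \<partial>lborel) = G (x + 1) - G x"
      using abs_cont_derivD(2)[OF G, of x "x + 1"] by simp
  qed simp
  also have "\<dots> = 0"
  proof -
    have "integrable lborel (\<lambda>x. G (x + 1))" "(\<integral>x. G (x + 1) \<partial>lborel) = (\<integral>x. G x \<partial>lborel)"
      using lborel_integrable_real_affine[OF iG, of 1 1] lborel_integral_real_affine[of 1 G 1]
      by (auto simp only: add.commute[of 1] mult_1 scaleR_one abs_one)
    then show ?thesis using iG by simp
  qed
  finally show ?thesis .
qed

section \<open>Interpolation with a Gaussian weight on the line\<close>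

text \<open>Monotone convergence along intervals centred at \<open>m\<close>. The centring matters
  because the boundary terms to be discarded carry the factor \<open>t - m\<close> and therefore
  have opposite signs at the two ends.\<close>

lemma real_integrable_if_bounded_on_intervals:
  fixes f :: "real \<Rightarrow> real"
  assumes "\<And>x. 0 \<le> f x" and si: "\<And>n::nat. set_integrable lborel {m - real n..m + real n} f"
    and bd: "\<And>n::nat. (LINT x:{m - real n..m + real n}|lborel. f x) \<le> C"
    and meas: "f \<in> borel_measurable borel"
  shows "integrable lborel f"
proof -
  define J where "J n = {m - real n..m + real n}" for n
  have "incseq (\<lambda>n. LINT x:J n|lborel. f x)"
  proof (rule incseq_SucI)
    fix n show "(LINT x:J n|lborel. f x) \<le> (LINT x:J (Suc n)|lborel. f x)"
      using si[of n] si[of "Suc n"] assms(1) unfolding J_def set_integrable_def set_lebesgue_integral_def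
      by (intro integral_mono) (auto simp: indicator_def)
  qed
  then obtain L where L: "(\<lambda>n. LINT x:J n|lborel. f x) \<longlonglongrightarrow> L"
    using bd incseq_convergent[of "\<lambda>n. LINT x:J n|lborel. f x" C] unfolding J_def by blast
  have "integrable lborel f"
  proof (rule integrable_monotone_convergence[where f = "\<lambda>n x. indicator (J n) x *\<^sub>R f x"])
    show "\<And>n. integrable lborel (\<lambda>x. indicator (J n) x *\<^sub>R f x)"
      using si by (simp add: J_def set_integrable_def)
    show "AE x in lborel. mono (\<lambda>n. indicator (J n) x *\<^sub>R f x)"
    proof (rule AE_I2)
      fix x show "mono (\<lambda>n. indicator (J n) x *\<^sub>R f x)"
        using assms(1)[of x] by (intro incseq_SucI) (auto simp: J_def indicator_def)
    qed
    show "AE x in lborel. (\<lambda>n. indicator (J n) x *\<^sub>R f x) \<longlonglongrightarrow> f x"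
    proof (rule AE_I2, rule tendsto_eventually)
      fix x
      obtain N where N: "\<bar>x - m\<bar> \<le> real N" using real_arch_simple by blast
      show "\<forall>\<^sub>F n in sequentially. indicat_real (J n) x *\<^sub>R f x = f x"
      proof (rule eventually_sequentiallyI[of N])
        fix n assume "N \<le> n"
        then have "\<bar>x - m\<bar> \<le> real n" using N by linarith
        then show "indicat_real (J n) x *\<^sub>R f x = f x" by (auto simp: J_def abs_le_iff indicator_def)
      qed
    qed
    show "(\<lambda>n. LINT x|lborel. indicator (J n) x *\<^sub>R f x) \<longlonglongrightarrow> L"
      using L by (simp add: set_lebesgue_integral_def)
  qed (use meas in simp)
  then show ?thesis .
qed

lemma integrable_mult_if_squares:
  fixes a b \<gamma> :: "real \<Rightarrow> real"
  assumes [measurable]: "a \<in> borel_measurable borel" "b \<in> borel_measurable borel" "\<gamma> \<in> borel_measurable borel"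
    and "integrable lborel (\<lambda>x. (a x)\<^sup>2 * \<gamma> x)" "integrable lborel (\<lambda>x. (b x)\<^sup>2 * \<gamma> x)"
    and nonneg: "\<And>x. 0 \<le> \<gamma> x"
  shows "integrable lborel (\<lambda>x. a x * b x * \<gamma> x)"
proof (rule Bochner_Integration.integrable_bound)
  show "integrable lborel (\<lambda>x. (a x)\<^sup>2 * \<gamma> x + (b x)\<^sup>2 * \<gamma> x)"
    using assms by auto
  show "AE x in lborel. norm (a x * b x * \<gamma> x) \<le> norm ((a x)\<^sup>2 * \<gamma> x + (b x)\<^sup>2 * \<gamma> x)"
  proof (rule AE_I2)
    fix x
    have "2 * (\<bar>a x\<bar> * \<bar>b x\<bar>) \<le> (a x)\<^sup>2 + (b x)\<^sup>2"
      using sum_squares_bound[of "\<bar>a x\<bar>" "\<bar>b x\<bar>"] by (simp add: mult.assoc)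
    then have "\<bar>a x\<bar> * \<bar>b x\<bar> \<le> (a x)\<^sup>2 + (b x)\<^sup>2"
      using mult_nonneg_nonneg[of "\<bar>a x\<bar>" "\<bar>b x\<bar>"] by linarith
    then have "\<bar>a x\<bar> * \<bar>b x\<bar> * \<gamma> x \<le> ((a x)\<^sup>2 + (b x)\<^sup>2) * \<gamma> x"
      using nonneg by (intro mult_right_mono)
    moreover have "0 \<le> (a x)\<^sup>2 * \<gamma> x + (b x)\<^sup>2 * \<gamma> x" using nonneg by simp
    ultimately show "norm (a x * b x * \<gamma> x) \<le> norm ((a x)\<^sup>2 * \<gamma> x + (b x)\<^sup>2 * \<gamma> x)"
      using nonneg[of x] by (simp add: abs_mult distrib_right)
  qed
qed measurable

text \<open>The integral of (x a + b)^2 \<gamma> is a quadratic polynomial in x that is nowhere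
  negative, so its discriminant is not positive; the case of a vanishing leading coefficient needs
  its own argument.\<close>

lemma Cauchy_Schwarz_weighted_integral:
  fixes a b \<gamma> :: "real \<Rightarrow> real"
  assumes [measurable]: "a \<in> borel_measurable borel" "b \<in> borel_measurable borel" "\<gamma> \<in> borel_measurable borel"
    and ia: "integrable lborel (\<lambda>x. (a x)\<^sup>2 * \<gamma> x)" and ib: "integrable lborel (\<lambda>x. (b x)\<^sup>2 * \<gamma> x)"
    and nonneg: "\<And>x. 0 \<le> \<gamma> x"
  shows "(\<integral>x. a x * b x * \<gamma> x \<partial>lborel)\<^sup>2 \<le> (\<integral>x. (a x)\<^sup>2 * \<gamma> x \<partial>lborel) * (\<integral>x. (b x)\<^sup>2 * \<gamma> x \<partial>lborel)"
proof -
  define A where "A = (\<integral>x. (a x)\<^sup>2 * \<gamma> x \<partial>lborel)"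
  define B where "B = (\<integral>x. (b x)\<^sup>2 * \<gamma> x \<partial>lborel)"
  define P where "P = (\<integral>x. a x * b x * \<gamma> x \<partial>lborel)"
  have iab: "integrable lborel (\<lambda>x. a x * b x * \<gamma> x)"
    by (rule integrable_mult_if_squares) (use assms in auto)
  have quad: "0 \<le> x\<^sup>2 * A + 2 * x * P + B" for x
  proof -
    have "0 \<le> (\<integral>t. (x * a t + b t)\<^sup>2 * \<gamma> t \<partial>lborel)"
      using nonneg by (intro Bochner_Integration.integral_nonneg) simp
    also have "\<dots> = (\<integral>t. (x\<^sup>2 * ((a t)\<^sup>2 * \<gamma> t) + 2 * x * (a t * b t * \<gamma> t)) + (b t)\<^sup>2 * \<gamma> t \<partial>lborel)"
      by (rule Bochner_Integration.integral_cong) (auto simp: power2_eq_square algebra_simps)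
    also have "\<dots> = x\<^sup>2 * A + 2 * x * P + B"
      using ia ib iab by (simp add: A_def B_def P_def)
    finally show ?thesis .
  qed
  have "P\<^sup>2 \<le> A * B"
  proof (cases "A = 0")
    case True
    have "P = 0"
    proof (rule ccontr)
      assume "P \<noteq> 0"
      \<comment> \<open>At this x the remaining affine function \<open>2 * x * P + B\<close> has the
        value -1.\<close>
      then show False using quad[of "- (B + 1) / (2 * P)"] True by (simp add: field_simps)
    qed
    then show ?thesis using True by simp
  next
    case False
    moreover have "0 \<le> A" using nonneg by (simp add: A_def)
    ultimately have "A > 0" by simp
    then have "0 \<le> A * ((- P / A)\<^sup>2 * A + 2 * (- P / A) * P + B)"
      using quad[of "- P / A"] by (simp add: mult_nonneg_nonneg)
    also have "\<dots> = A * B - P\<^sup>2"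
      using \<open>A > 0\<close> by (simp add: field_simps power2_eq_square)
    finally show ?thesis by simp
  qed
  then show ?thesis by (simp add: A_def B_def P_def)
qed

context
  fixes m \<sigma> :: real
  assumes \<sigma>: "\<sigma> > 0"
begin

abbreviation (input) "\<gamma> \<equiv> normal_density m \<sigma>"

lemma normal_density_abs_cont_deriv:
  "abs_cont_deriv \<gamma> (\<lambda>t. - (t - m) / \<sigma>\<^sup>2 * \<gamma> t)"
proof (rule abs_cont_derivI_has_derivative)
  show "(\<gamma> has_real_derivative - (t - m) / \<sigma>\<^sup>2 * \<gamma> t) (at t)" for t
  proof -
    have "((\<lambda>t. - (t - m)\<^sup>2 / (2 * \<sigma>\<^sup>2)) has_real_derivative - (t - m) / \<sigma>\<^sup>2) (at t)"
      using \<sigma> by (auto intro!: derivative_eq_intros simp: field_simps power2_eq_square)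
    from DERIV_cmult[OF DERIV_fun_exp[OF this], of "1 / sqrt (2 * pi * \<sigma>\<^sup>2)"]
    show ?thesis
      unfolding normal_density_def[abs_def] by (simp add: mult_ac)
  qed
  show "continuous_on UNIV (\<lambda>t. - (t - m) / \<sigma>\<^sup>2 * \<gamma> t)"
    using \<sigma> unfolding normal_density_def[abs_def] by (intro continuous_intros) auto
qed

lemma id_abs_cont_deriv: "abs_cont_deriv (\<lambda>t. t - m) (\<lambda>_. 1)"
  by (rule abs_cont_derivI_has_derivative) (auto intro!: derivative_eq_intros)

lemma abs_cont_deriv_mult_normal:
  assumes E: "abs_cont_deriv E e" and G: "abs_cont_deriv G g"
  shows "abs_cont_deriv (\<lambda>t. E t * G t * \<gamma> t)
    (\<lambda>t. e t * G t * \<gamma> t + E t * g t * \<gamma> t - (t - m) / \<sigma>\<^sup>2 * E t * G t * \<gamma> t)"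
proof -
  have "abs_cont_deriv (\<lambda>t. E t * G t * \<gamma> t)
     (\<lambda>t. (e t * G t + E t * g t) * \<gamma> t + E t * G t * (- (t - m) / \<sigma>\<^sup>2 * \<gamma> t))"
    by (intro abs_cont_deriv_mult E G normal_density_abs_cont_deriv)
  also have "(\<lambda>t. (e t * G t + E t * g t) * \<gamma> t + E t * G t * (- (t - m) / \<sigma>\<^sup>2 * \<gamma> t))
     = (\<lambda>t. e t * G t * \<gamma> t + E t * g t * \<gamma> t - (t - m) / \<sigma>\<^sup>2 * E t * G t * \<gamma> t)"
    by (rule ext) (simp add: algebra_simps diff_divide_distrib)
  finally show ?thesis .
qed

text \<open>The boundary terms of the integration by parts have the favourable sign.\<close>

lemma normal_square_integrable_antiderivative:
  assumes G: "abs_cont_deriv G g" and ig: "integrable lborel (\<lambda>t. (g t)\<^sup>2 * \<gamma> t)"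
  shows "integrable lborel (\<lambda>t. ((t - m) * G t)\<^sup>2 * \<gamma> t)" "integrable lborel (\<lambda>t. (G t)\<^sup>2 * \<gamma> t)"
proof -
  note [measurable] = abs_cont_deriv_measurable[OF G]
  have cG: "continuous_on UNIV G" by (rule abs_cont_deriv_continuous[OF G])
  then have [measurable]: "G \<in> borel_measurable borel" by (rule borel_measurable_continuous_onI)
  have c\<gamma>: "continuous_on UNIV \<gamma>"
    by (rule abs_cont_deriv_continuous[OF normal_density_abs_cont_deriv])
  define X where "X t = ((t - m) * G t)\<^sup>2 * \<gamma> t" for t
  \<comment> \<open>With y = (t - m) / \<sigma>, the derivative \<open>h\<close> contains - y^2 G^2
    \<gamma>. Young's inequality spends half of this on the mixed term, at the price of 2 \<sigma>^2
    g^2. Outside \<open>K\<close> one has y^2 \<ge> 4, so another quarter absorbs G^2, and inside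
    \<open>K\<close> that term is bounded by compactness. The quarter that is left gives the factor
    1 / (4 \<sigma>^2) in front of \<open>X\<close>.\<close>
  define K where "K = {m - 2 * \<sigma>..m + 2 * \<sigma>}"
  define B where "B t = indicator K t * ((G t)\<^sup>2 * \<gamma> t) + 2 * \<sigma>\<^sup>2 * ((g t)\<^sup>2 * \<gamma> t)" for t
  define H where "H t = ((t - m) * G t) * G t * \<gamma> t" for t
  define h where "h t = (1 * G t + (t - m) * g t) * G t * \<gamma> t + ((t - m) * G t) * g t * \<gamma> t
      - (t - m) / \<sigma>\<^sup>2 * ((t - m) * G t) * G t * \<gamma> t" for t
  have acH: "abs_cont_deriv H h"
    unfolding H_def[abs_def] h_def[abs_def]
    by (intro abs_cont_deriv_mult_normal abs_cont_deriv_mult id_abs_cont_deriv G)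
  have cX: "continuous_on UNIV X"
    unfolding X_def[abs_def] by (intro continuous_intros cG c\<gamma>)
  have iK: "integrable lborel (\<lambda>t. indicator K t * ((G t)\<^sup>2 * \<gamma> t))"
    using borel_integrable_compact[of K "\<lambda>t. (G t)\<^sup>2 * \<gamma> t"]
      continuous_on_subset[OF continuous_on_mult[OF continuous_on_power[OF cG, of 2] c\<gamma>], of K]
    by (simp add: K_def)
  then have iB: "integrable lborel B"
    unfolding B_def[abs_def] using ig by auto
  have B0: "0 \<le> B t" for t unfolding B_def by (simp add: indicator_def)
  have pw: "X t / (4 * \<sigma>\<^sup>2) \<le> B t - h t" for t
  proof -
    define y where "y = (t - m) / \<sigma>"
    have ty: "t - m = \<sigma> * y" using \<sigma> by (simp add: y_def)
    have "y\<^sup>2 * (G t)\<^sup>2 / 4 \<le> indicator K t * (G t)\<^sup>2 + 2 * \<sigma>\<^sup>2 * (g t)\<^sup>2 - ((G t)\<^sup>2 + 2 * \<sigma> * y * G t * g t - y\<^sup>2 * (G t)\<^sup>2)"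
    proof -
      have "0 \<le> (y * G t - 2 * \<sigma> * g t)\<^sup>2" by simp
      then have sq: "2 * \<sigma> * y * G t * g t \<le> y\<^sup>2 * (G t)\<^sup>2 / 2 + 2 * \<sigma>\<^sup>2 * (g t)\<^sup>2"
        by (simp add: power2_eq_square algebra_simps)
      have "(G t)\<^sup>2 \<le> indicator K t * (G t)\<^sup>2 + y\<^sup>2 * (G t)\<^sup>2 / 4"
      proof (cases "t \<in> K")
        case False
        then have "\<bar>t - m\<bar> \<ge> 2 * \<sigma>" by (auto simp: K_def)
        then have "\<bar>y\<bar> \<ge> 2" using \<sigma> by (simp add: y_def field_simps)
        then have "y\<^sup>2 \<ge> 4" using abs_le_square_iff[of 2 y] by simp
        then have "4 * (G t)\<^sup>2 \<le> y\<^sup>2 * (G t)\<^sup>2" by (intro mult_right_mono) auto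
        then show ?thesis using False by simp
      qed simp
      then show ?thesis using sq by linarith
    qed
    then have "(y\<^sup>2 * (G t)\<^sup>2 / 4) * \<gamma> t \<le> (indicator K t * (G t)\<^sup>2 + 2 * \<sigma>\<^sup>2 * (g t)\<^sup>2 - ((G t)\<^sup>2 + 2 * \<sigma> * y * G t * g t - y\<^sup>2 * (G t)\<^sup>2)) * \<gamma> t"
      by (intro mult_right_mono) auto
    also have "\<dots> = B t - h t"
      unfolding B_def h_def ty using \<sigma> by (simp add: field_simps power2_eq_square)
    also have "(y\<^sup>2 * (G t)\<^sup>2 / 4) * \<gamma> t = X t / (4 * \<sigma>\<^sup>2)"
      unfolding X_def ty using \<sigma> by (simp add: field_simps power2_eq_square)
    finally show ?thesis .
  qed
  have "integrable lborel X"
  proof (rule real_integrable_if_bounded_on_intervals[of _ m "4 * \<sigma>\<^sup>2 * (\<integral>t. B t \<partial>lborel)"])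
    show "0 \<le> X t" for t by (simp add: X_def)
    show "X \<in> borel_measurable borel" using cX by (rule borel_measurable_continuous_onI)
    show siX: "set_integrable lborel {m - real n..m + real n} X" for n
      by (rule borel_integrable_atLeastAtMost') (use cX continuous_on_subset in blast)
    fix n
    let ?J = "{m - real n..m + real n}"
    have siB: "set_integrable lborel ?J B"
      using iB unfolding set_integrable_def by (rule integrable_mult_indicator[rotated]) simp
    have sih: "set_integrable lborel ?J h" by (rule abs_cont_derivD(1)[OF acH])
    have "(LINT t:?J|lborel. X t) / (4 * \<sigma>\<^sup>2) = (LINT t:?J|lborel. X t / (4 * \<sigma>\<^sup>2))" by simp
    also have "\<dots> \<le> (LINT t:?J|lborel. B t - h t)"
      using pw by (intro set_integral_mono set_integrable_divide siX set_integral_diff siB sih)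
    also have "\<dots> = (LINT t:?J|lborel. B t) - (LINT t:?J|lborel. h t)"
      by (rule set_integral_diff[OF siB sih])
    also have "(LINT t:?J|lborel. h t) = H (m + real n) - H (m - real n)"
      by (rule abs_cont_derivD(2)[OF acH, symmetric]) simp
    also have "(LINT t:?J|lborel. B t) - (H (m + real n) - H (m - real n)) \<le> (LINT t:?J|lborel. B t)"
    proof -
      have "H t = (t - m) * ((G t)\<^sup>2 * \<gamma> t)" for t by (simp add: H_def power2_eq_square)
      then have "0 \<le> H (m + real n)" "H (m - real n) \<le> 0" by simp_all
      then show ?thesis by linarith
    qed
    also have "\<dots> \<le> (\<integral>t. B t \<partial>lborel)"
      unfolding set_lebesgue_integral_def
      using B0 siB iB by (intro integral_mono) (auto simp: set_integrable_def indicator_def)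
    finally show "(LINT t:?J|lborel. X t) \<le> 4 * \<sigma>\<^sup>2 * (\<integral>t. B t \<partial>lborel)"
      using \<sigma> by (simp add: field_simps)
  qed
  then show iX: "integrable lborel (\<lambda>t. ((t - m) * G t)\<^sup>2 * \<gamma> t)" by (simp add: X_def[abs_def])
  show "integrable lborel (\<lambda>t. (G t)\<^sup>2 * \<gamma> t)"
  proof (rule Bochner_Integration.integrable_bound)
    show "integrable lborel (\<lambda>t. indicator K t * ((G t)\<^sup>2 * \<gamma> t) + ((t - m) * G t)\<^sup>2 * \<gamma> t / (4 * \<sigma>\<^sup>2))"
      using iK iX by auto
    show "AE t in lborel. norm ((G t)\<^sup>2 * \<gamma> t) \<le> norm (indicator K t * ((G t)\<^sup>2 * \<gamma> t) + ((t - m) * G t)\<^sup>2 * \<gamma> t / (4 * \<sigma>\<^sup>2))"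
    proof (rule AE_I2)
      fix t
      show "norm ((G t)\<^sup>2 * \<gamma> t) \<le> norm (indicator K t * ((G t)\<^sup>2 * \<gamma> t) + ((t - m) * G t)\<^sup>2 * \<gamma> t / (4 * \<sigma>\<^sup>2))"
      proof (cases "t \<in> K")
        case False
        then have "2 * \<sigma> \<le> \<bar>t - m\<bar>" by (auto simp: K_def)
        then have "(2 * \<sigma>)\<^sup>2 \<le> (t - m)\<^sup>2" using \<sigma> abs_le_square_iff[of "2 * \<sigma>" "t - m"] by simp
        then have "(2 * \<sigma>)\<^sup>2 * ((G t)\<^sup>2 * \<gamma> t) \<le> (t - m)\<^sup>2 * ((G t)\<^sup>2 * \<gamma> t)"
          by (rule mult_right_mono) simp
        also have "(t - m)\<^sup>2 * ((G t)\<^sup>2 * \<gamma> t) = ((t - m) * G t)\<^sup>2 * \<gamma> t"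
          by (simp only: power_mult_distrib mult.assoc)
        finally show ?thesis using False \<sigma> by (simp add: field_simps)
      qed simp
    qed
  qed measurable
qed

text \<open>\<open>R\<close> is the adjoint of differentiation in the weighted L2 space, applied to
  \<open>G\<close>. Moving the derivative off \<open>E\<close> gives \<integral> G^2 \<gamma> =
  \<integral> E R \<gamma>, to which Cauchy-Schwarz applies; the commutation relation gives
  \<integral> R^2 \<gamma> = \<integral> G^2 \<gamma> / \<sigma>^2 + \<integral> g^2 \<gamma>. All
  integrals converge because square integrability of \<open>g\<close> passes down to
  \<open>G\<close>, \<open>(t - m) * G\<close> and \<open>E\<close>.\<close>

lemma normal_log_convexity:
  assumes E: "abs_cont_deriv E G" and G: "abs_cont_deriv G g"
    and ig: "integrable lborel (\<lambda>t. (g t)\<^sup>2 * \<gamma> t)"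
  shows "(\<integral>t. (G t)\<^sup>2 * \<gamma> t \<partial>lborel)\<^sup>2
    \<le> (\<integral>t. (E t)\<^sup>2 * \<gamma> t \<partial>lborel) * ((\<integral>t. (G t)\<^sup>2 * \<gamma> t \<partial>lborel) / \<sigma>\<^sup>2 + (\<integral>t. (g t)\<^sup>2 * \<gamma> t \<partial>lborel))"
proof -
  note [measurable] = abs_cont_deriv_measurable[OF G] abs_cont_deriv_measurable[OF E]
  have [measurable]: "E \<in> borel_measurable borel"
    by (rule borel_measurable_continuous_onI[OF abs_cont_deriv_continuous[OF E]])
  note iG = normal_square_integrable_antiderivative[OF G ig]
  note iE = normal_square_integrable_antiderivative[OF E iG(2)]
  note prod = integrable_mult_if_squares[where \<gamma> = \<gamma>, OF _ _ _ _ _ normal_density_nonneg]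
  have i1: "integrable lborel (\<lambda>t. E t * g t * \<gamma> t)"
    by (rule prod) (use ig iE in auto)
  have i2: "integrable lborel (\<lambda>t. E t * ((t - m) * G t) * \<gamma> t)"
    by (rule prod) (use iG iE in auto)
  have i3: "integrable lborel (\<lambda>t. E t * G t * \<gamma> t)"
    by (rule prod) (use iG iE in auto)
  have i4: "integrable lborel (\<lambda>t. ((t - m) * G t) * g t * \<gamma> t)"
    by (rule prod) (use iG ig in auto)
  have i5: "integrable lborel (\<lambda>t. ((t - m) * G t) * G t * \<gamma> t)"
    by (rule prod) (use iG ig in auto)
  define R where "R t = (t - m) * G t / \<sigma>\<^sup>2 - g t" for t
  let ?G = "\<integral>t. (G t)\<^sup>2 * \<gamma> t \<partial>lborel" and ?g = "\<integral>t. (g t)\<^sup>2 * \<gamma> t \<partial>lborel"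
  let ?X = "\<integral>t. ((t - m) * G t)\<^sup>2 * \<gamma> t \<partial>lborel" and ?Y = "\<integral>t. (t - m) * G t * g t * \<gamma> t \<partial>lborel"
  let ?R = "\<integral>t. (R t)\<^sup>2 * \<gamma> t \<partial>lborel" and ?ER = "\<integral>t. E t * R t * \<gamma> t \<partial>lborel"
  have [measurable]: "R \<in> borel_measurable borel" unfolding R_def[abs_def] by measurable
  have acEG: "abs_cont_deriv (\<lambda>t. E t * G t * \<gamma> t) (\<lambda>t. (G t)\<^sup>2 * \<gamma> t - E t * R t * \<gamma> t)"
  proof -
    have "(\<lambda>t. G t * G t * \<gamma> t + E t * g t * \<gamma> t - (t - m) / \<sigma>\<^sup>2 * E t * G t * \<gamma> t)
      = (\<lambda>t. (G t)\<^sup>2 * \<gamma> t - E t * R t * \<gamma> t)"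
      by (rule ext) (simp add: R_def power2_eq_square algebra_simps)
    then show ?thesis using abs_cont_deriv_mult_normal[OF E G] by simp
  qed
  have iER: "integrable lborel (\<lambda>t. E t * R t * \<gamma> t)"
  proof -
    have "(\<lambda>t. E t * R t * \<gamma> t) = (\<lambda>t. E t * ((t - m) * G t) * \<gamma> t / \<sigma>\<^sup>2 - E t * g t * \<gamma> t)"
      by (rule ext) (simp add: R_def algebra_simps)
    then show ?thesis using i1 i2 by simp
  qed
  have id1: "?G = ?ER"
    using abs_cont_deriv_integral_zero[OF acEG i3] iG iER by simp
  \<comment> \<open>Integrating the derivative of (t - m) G^2 \<gamma> to zero evaluates the mixed
    term \<open>?Y\<close>, which makes the norm of \<open>R\<close> explicit. Integrability of a
    function and of its derivative replaces any limit at infinity.\<close>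
  have acGG: "abs_cont_deriv (\<lambda>t. ((t - m) * G t) * G t * \<gamma> t)
      (\<lambda>t. (G t)\<^sup>2 * \<gamma> t + 2 * ((t - m) * G t * g t * \<gamma> t) - ((t - m) * G t)\<^sup>2 * \<gamma> t / \<sigma>\<^sup>2)"
  proof -
    have "(\<lambda>t. (1 * G t + (t - m) * g t) * G t * \<gamma> t + ((t - m) * G t) * g t * \<gamma> t
      - (t - m) / \<sigma>\<^sup>2 * ((t - m) * G t) * G t * \<gamma> t) = (\<lambda>t. (G t)\<^sup>2 * \<gamma> t + 2 * ((t - m) * G t * g t * \<gamma> t) - ((t - m) * G t)\<^sup>2 * \<gamma> t / \<sigma>\<^sup>2)"
      by (rule ext) (simp add: power2_eq_square algebra_simps add_divide_distrib diff_divide_distrib)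
    then show ?thesis
      using abs_cont_deriv_mult_normal[OF abs_cont_deriv_mult[OF id_abs_cont_deriv G] G] by simp
  qed
  have id2: "?G + 2 * ?Y
      - ?X / \<sigma>\<^sup>2 = 0"
    using abs_cont_deriv_integral_zero[OF acGG i5] iG i4 by simp
  have Req: "(\<lambda>t. (R t)\<^sup>2 * \<gamma> t) = (\<lambda>t. ((t - m) * G t)\<^sup>2 * \<gamma> t / \<sigma>\<^sup>2 / \<sigma>\<^sup>2
      - 2 * ((t - m) * G t * g t * \<gamma> t) / \<sigma>\<^sup>2 + (g t)\<^sup>2 * \<gamma> t)"
    by (rule ext) (simp add: R_def power2_diff power_divide algebra_simps power2_eq_square)
  have iR: "integrable lborel (\<lambda>t. (R t)\<^sup>2 * \<gamma> t)"
    unfolding Req using iG ig i4 by auto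
  have "?R = ?X / \<sigma>\<^sup>2 / \<sigma>\<^sup>2
      - 2 * ?Y / \<sigma>\<^sup>2 + ?g"
    unfolding Req using iG ig i4 by simp
  also have "\<dots> = ?G / \<sigma>\<^sup>2 + ?g"
  proof -
    have "?X / \<sigma>\<^sup>2
      = ?G + 2 * ?Y"
      using id2 by linarith
    then show ?thesis by (simp add: add_divide_distrib)
  qed
  finally have "?R = ?G / \<sigma>\<^sup>2 + ?g" .
  moreover have "?ER\<^sup>2
      \<le> (\<integral>t. (E t)\<^sup>2 * \<gamma> t \<partial>lborel) * ?R"
    by (rule Cauchy_Schwarz_weighted_integral) (use iE iR in auto)
  ultimately show ?thesis using id1 by simp
qed

end

section \<open>From log-convexity to a family of linear bounds\<close>

lemma falling_product_ge:
  assumes "real n \<le> r" "n \<ge> 1"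
  shows "(r / real n) ^ n \<le> (\<Prod>j<n. r - real j)"
proof -
  have "(\<Prod>j<n. r / real n) \<le> (\<Prod>j<n. r - real j)"
  proof (rule prod_mono)
    \<comment> \<open>The smallest factor is the one with j = n - 1, and r - (n - 1) \<ge> r / n
      amounts to (n - 1) r \<ge> (n - 1) n.\<close>
    fix j assume "j \<in> {..<n}"
    then have j: "real j \<le> real n - 1" by auto
    have "(real n - 1) * real n \<le> (real n - 1) * r"
      using assms by (intro mult_left_mono) auto
    moreover have "real j * real n \<le> (real n - 1) * real n"
      using j by (intro mult_right_mono) auto
    ultimately have "r \<le> (r - real j) * real n" by (simp add: algebra_simps)
    then show "0 \<le> r / real n \<and> r / real n \<le> r - real j"
      using assms by (simp add: field_simps)
  qed
  then show ?thesis by simp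
qed

text \<open>With \<open>r = b 1 / b 0\<close> the hypothesis gives \<open>b (n + 1) \<ge> (r - n) b n\<close>, hence
  \<open>(r / N)^N b 0 \<le> b 0 + b N\<close>; Bernoulli's inequality turns this into a family of linear bounds,
  which can be integrated and summed.\<close>

lemma log_convex_interpolation:
  fixes b :: "nat \<Rightarrow> real"
  assumes nonneg: "\<And>n. 0 \<le> b n" and "N \<ge> 1" and "\<kappa> > 0"
    and step: "\<And>n. Suc n < N \<Longrightarrow> (b (Suc n))\<^sup>2 \<le> b n * (b (Suc n) + b (Suc (Suc n)))"
  shows "b 1 \<le> \<kappa> ^ (N - 1) * (b 0 + b N) + (real N - 1) / \<kappa> * b 0"
proof (cases "b 0 = 0")
  \<comment> \<open>There is no ratio \<open>r\<close> here. If N > 1, the recursion at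
    \<open>n = 0\<close> forces \<open>b 1 = 0\<close>; if N = 1, the right side already contains
    \<open>b 1\<close> with coefficient 1.\<close>
  case True
  show ?thesis
  proof (cases "N = 1")
    case False
    then have "(b 1)\<^sup>2 \<le> 0" using step[of 0] True assms by simp
    then have "b 1 = 0" by simp
    then show ?thesis using assms True by simp
  qed (use True in simp)
next
  case False
  then have b0: "b 0 > 0" using nonneg[of 0] by simp
  define r where "r = b 1 / b 0"
  have r0: "0 \<le> r" using nonneg b0 by (simp add: r_def)
  have X: "(r / real N) ^ N * b 0 \<le> b 0 + b N"
  proof (cases "r \<le> real N")
    case True
    then have "(r / real N) ^ N \<le> 1"
      using r0 assms by (intro power_le_one) auto
    then have "(r / real N) ^ N * b 0 \<le> b 0" using b0 by simp
    then show ?thesis using nonneg[of N] by linarith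
  next
    case False
    \<comment> \<open>Positivity is carried along because each step divides the recursion by
      \<open>b n\<close>. It persists because r > N keeps r - n positive for all n < N.\<close>
    have key: "0 < b n \<and> (r - real n) * b n \<le> b (Suc n)" if "n < N" for n
      using that
    proof (induction n)
      case 0
      then show ?case using b0 by (simp add: r_def)
    next
      case (Suc n)
      then have IH: "0 < b n" "(r - real n) * b n \<le> b (Suc n)" by auto
      have "0 < (r - real n) * b n" using IH Suc.prems False by simp
      then have pos: "0 < b (Suc n)" using IH by linarith
      have "b (Suc n) * ((r - real n) * b n) \<le> (b (Suc n))\<^sup>2"
        using IH pos by (simp add: power2_eq_square)
      also have "\<dots> \<le> b n * (b (Suc n) + b (Suc (Suc n)))" using step Suc.prems by simp
      finally have "b n * (b (Suc n) * (r - real n)) \<le> b n * (b (Suc n) + b (Suc (Suc n)))"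
        by (simp add: ac_simps)
      then have "b (Suc n) * (r - real n) \<le> b (Suc n) + b (Suc (Suc n))"
        using IH(1) by (simp only: mult_le_cancel_left_pos)
      then show ?case using pos by (simp add: algebra_simps)
    qed
    have "(\<Prod>j<n. r - real j) * b 0 \<le> b n" if "n \<le> N" for n
      using that
    proof (induction n)
      case (Suc n)
      have "(\<Prod>j<Suc n. r - real j) * b 0 = (r - real n) * ((\<Prod>j<n. r - real j) * b 0)" by simp
      also have "\<dots> \<le> (r - real n) * b n"
        using Suc False by (intro mult_left_mono) auto
      also have "\<dots> \<le> b (Suc n)" using key Suc.prems by simp
      finally show ?case .
    qed simp
    then have "(\<Prod>j<N. r - real j) * b 0 \<le> b N" by simp
    moreover have "(r / real N) ^ N * b 0 \<le> (\<Prod>j<N. r - real j) * b 0"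
      using falling_product_ge[of N r] False assms b0 by (intro mult_right_mono) auto
    ultimately show ?thesis using b0 by linarith
  qed
  \<comment> \<open>Bernoulli's inequality is the tangent to s^N at s = 1, with slope N and
    intercept - (N - 1). In this scaling N s = \<kappa> r, and dividing by \<kappa> leaves the power
    \<open>\<kappa> ^ (N - 1)\<close> and the constant \<open>(N - 1) / \<kappa>\<close>.\<close>
  define s where "s = \<kappa> * r / real N"
  have "0 \<le> s" using r0 assms by (simp add: s_def)
  then have "1 + real N * (s - 1) \<le> s ^ N"
    using Bernoulli_inequality[of "s - 1" N] by simp
  then have "real N * s \<le> s ^ N + (real N - 1)" by (simp add: algebra_simps)
  moreover have "s ^ N = \<kappa> * (\<kappa> ^ (N - 1) * (r / real N) ^ N)"
  proof -
    have "\<kappa> ^ N = \<kappa> * \<kappa> ^ (N - 1)" using assms by (metis One_nat_def Suc_pred less_eq_Suc_le power_Suc)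
    then show ?thesis by (simp add: s_def power_mult_distrib power_divide)
  qed
  ultimately have "\<kappa> * r \<le> \<kappa> * (\<kappa> ^ (N - 1) * (r / real N) ^ N) + (real N - 1)"
    using assms by (simp add: s_def)
  then have "r \<le> \<kappa> ^ (N - 1) * (r / real N) ^ N + (real N - 1) / \<kappa>"
    using assms by (simp add: field_simps)
  then have "r * b 0 \<le> (\<kappa> ^ (N - 1) * (r / real N) ^ N + (real N - 1) / \<kappa>) * b 0"
    using b0 by (intro mult_right_mono) auto
  also have "\<dots> = \<kappa> ^ (N - 1) * ((r / real N) ^ N * b 0) + (real N - 1) / \<kappa> * b 0"
    by (simp add: algebra_simps)
  also have "\<dots> \<le> \<kappa> ^ (N - 1) * (b 0 + b N) + (real N - 1) / \<kappa> * b 0"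
    using X assms by (intro add_right_mono mult_left_mono) auto
  finally show ?thesis using b0 by (simp add: r_def)
qed

text \<open>The factors \<sigma>^(2 n) in \<open>b n\<close> are the rescaling to unit variance and
  absorb the 1 / \<sigma>^2 of \<open>normal_log_convexity\<close>. Stated in [0, \<infinity>], the
  bound can be integrated over lines and means without knowing which of them give finite values: if
  the norm of the top derivative is infinite, so is the right side.\<close>

lemma normal_interpolation:
  fixes w :: "nat \<Rightarrow> real \<Rightarrow> real"
  assumes \<sigma>: "\<sigma> > 0" and \<kappa>: "\<kappa> > 0" and N: "N \<ge> 1"
    and w: "\<And>n. n < N \<Longrightarrow> abs_cont_deriv (w n) (w (Suc n))"
  shows "ennreal (\<sigma>\<^sup>2) * (\<integral>\<^sup>+t. ennreal ((w 1 t)\<^sup>2 * normal_density m \<sigma> t) \<partial>lborel)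
    \<le> ennreal (\<kappa> ^ (N - 1)) * ((\<integral>\<^sup>+t. ennreal ((w 0 t)\<^sup>2 * normal_density m \<sigma> t) \<partial>lborel)
        + ennreal (\<sigma> ^ (2 * N)) * (\<integral>\<^sup>+t. ennreal ((w N t)\<^sup>2 * normal_density m \<sigma> t) \<partial>lborel))
      + ennreal ((real N - 1) / \<kappa>) * (\<integral>\<^sup>+t. ennreal ((w 0 t)\<^sup>2 * normal_density m \<sigma> t) \<partial>lborel)"
proof (cases "(\<integral>\<^sup>+t. ennreal ((w N t)\<^sup>2 * normal_density m \<sigma> t) \<partial>lborel) = \<infinity>")
  case True
  then show ?thesis using \<sigma> \<kappa> by (simp add: ennreal_mult_top)
next
  case False
  define M where "M n = (\<integral>t. (w n t)\<^sup>2 * normal_density m \<sigma> t \<partial>lborel)" for n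
  have wm: "w n \<in> borel_measurable borel" if "n \<le> N" for n
  proof (cases n)
    case 0
    then show ?thesis
      using abs_cont_deriv_continuous[OF w[of 0]] N by (simp add: borel_measurable_continuous_onI)
  next
    case (Suc k)
    then show ?thesis using abs_cont_deriv_measurable[OF w[of k]] that by simp
  qed
  \<comment> \<open>Finiteness is known only at the top and descends from \<open>n + 1\<close> to
    \<open>n\<close> through \<open>normal_square_integrable_antiderivative\<close>.\<close>
  have int: "integrable lborel (\<lambda>t. (w n t)\<^sup>2 * normal_density m \<sigma> t)" if "n \<le> N" for n
    using that
  proof (induction rule: inc_induct)
    case base
    show ?case using False wm[of N] by (intro integrableI_nonneg) (auto simp: top.not_eq_extremum)
  next
    case (step n)
    then show ?case using normal_square_integrable_antiderivative(2)[OF \<sigma> w] by blast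
  qed
  have nn: "(\<integral>\<^sup>+t. ennreal ((w n t)\<^sup>2 * normal_density m \<sigma> t) \<partial>lborel) = ennreal (M n)" if "n \<le> N" for n
    unfolding M_def using int[OF that] by (intro nn_integral_eq_integral) auto
  define b where "b n = \<sigma> ^ (2 * n) * M n" for n
  have M0: "0 \<le> M n" for n unfolding M_def by (intro Bochner_Integration.integral_nonneg) simp
  have "b 1 \<le> \<kappa> ^ (N - 1) * (b 0 + b N) + (real N - 1) / \<kappa> * b 0"
  proof (rule log_convex_interpolation[OF _ N \<kappa>])
    show "0 \<le> b n" for n using M0 \<sigma> by (simp add: b_def)
    fix n assume n: "Suc n < N"
    have "(M (Suc n))\<^sup>2 \<le> M n * (M (Suc n) / \<sigma>\<^sup>2 + M (Suc (Suc n)))"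
      unfolding M_def using n by (intro normal_log_convexity[OF \<sigma>] w int) auto
    then have "\<sigma> ^ (4 * Suc n) * (M (Suc n))\<^sup>2 \<le> \<sigma> ^ (4 * Suc n) * (M n * (M (Suc n) / \<sigma>\<^sup>2 + M (Suc (Suc n))))"
      using \<sigma> by (intro mult_left_mono) auto
    also have "\<dots> = b n * (b (Suc n) + b (Suc (Suc n)))"
    proof -
      have p: "\<sigma> ^ (4 * Suc n) = \<sigma> ^ (2 * n) * \<sigma> ^ (2 * n) * (\<sigma>\<^sup>2 * \<sigma>\<^sup>2)"
        "\<sigma> ^ (2 * Suc n) = \<sigma> ^ (2 * n) * \<sigma>\<^sup>2" "\<sigma> ^ (2 * Suc (Suc n)) = \<sigma> ^ (2 * n) * (\<sigma>\<^sup>2 * \<sigma>\<^sup>2)"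
        by (simp_all add: power_add power2_eq_square power4_eq_xxxx power_mult mult_ac)
      have alg: "c * c * (s * s) * (x * (y / s + z)) = c * x * (c * s * y + c * (s * s) * z)"
        if "s \<noteq> 0" for c s x y z :: real
        using that by (simp add: field_simps)
      show ?thesis unfolding b_def p by (rule alg) (use \<sigma> in simp)
    qed
    also have "\<sigma> ^ (4 * Suc n) * (M (Suc n))\<^sup>2 = (b (Suc n))\<^sup>2"
    proof -
      have "4 * Suc n = 2 * Suc n * 2" by simp
      then show ?thesis by (simp only: b_def power_mult_distrib power_mult)
    qed
    finally show "(b (Suc n))\<^sup>2 \<le> b n * (b (Suc n) + b (Suc (Suc n)))" .
  qed
  then have "ennreal (\<sigma>\<^sup>2 * M 1) \<le> ennreal (\<kappa> ^ (N - 1) * (M 0 + \<sigma> ^ (2 * N) * M N) + (real N - 1) / \<kappa> * M 0)"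
    by (intro ennreal_leI) (simp add: b_def)
  moreover have "0 \<le> (real N - 1) / \<kappa>" using N \<kappa> by simp
  ultimately have "ennreal (\<sigma>\<^sup>2) * ennreal (M 1) \<le> ennreal (\<kappa> ^ (N - 1)) * (ennreal (M 0) + ennreal (\<sigma> ^ (2 * N)) * ennreal (M N))
      + ennreal ((real N - 1) / \<kappa>) * ennreal (M 0)"
    using M0 \<sigma> \<kappa>
    by (simp only: ennreal_mult[symmetric] ennreal_plus[symmetric] mult_nonneg_nonneg add_nonneg_nonneg
        zero_le_power less_imp_le)
  then show ?thesis
    unfolding nn[OF N] nn[OF le0] nn[OF order_refl] .
qed

section \<open>Smooth bumps and weak derivatives on the line\<close>

text \<open>A test function on the line is represented by the sequence of all its derivatives.\<close>

definition test_derivs :: "(nat \<Rightarrow> real \<Rightarrow> real) \<Rightarrow> bool" where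
  "test_derivs \<Psi> \<longleftrightarrow> (\<forall>n t. (\<Psi> n has_real_derivative \<Psi> (Suc n) t) (at t)) \<and>
     (\<exists>R. \<forall>n t. R < \<bar>t\<bar> \<longrightarrow> \<Psi> n t = 0)"

text \<open>The polynomial parameter makes the family closed under differentiation: differentiating
  P(1/x) exp(-1/x) replaces P by (P - P') X^2. One lemma on first derivatives therefore yields
  smoothness, also at 0.\<close>

definition flat_exp :: "real poly \<Rightarrow> real \<Rightarrow> real" where
  "flat_exp P x = (if 0 < x then poly P (1 / x) * exp (- (1 / x)) else 0)"

lemma poly_times_exp_minus_tendsto_0:
  fixes P :: "real poly"
  shows "((\<lambda>y. y ^ k * poly P y / exp y) \<longlongrightarrow> 0) at_top"
proof (induction P arbitrary: k)
  case (pCons a P)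
  have "((\<lambda>y. a * (y ^ k / exp y) + y ^ Suc k * poly P y / exp y) \<longlongrightarrow> a * 0 + 0) at_top"
    by (intro tendsto_intros tendsto_power_div_exp_0 pCons.IH)
  then show ?case by (simp add: algebra_simps add_divide_distrib)
qed simp

lemma flat_exp_has_derivative:
  "(flat_exp P has_real_derivative flat_exp ((P - pderiv P) * [:0, 0, 1:]) x) (at x)"
proof -
  consider "x > 0" | "x < 0" | "x = 0" by linarith
  then show ?thesis
  proof cases
    case 1
    have "((\<lambda>x. poly P (1 / x) * exp (- (1 / x))) has_real_derivative flat_exp ((P - pderiv P) * [:0, 0, 1:]) x) (at x)"
      using 1 by (auto intro!: derivative_eq_intros DERIV_chain2[OF poly_DERIV] simp: flat_exp_def field_simps power2_eq_square)
    then show ?thesis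
      by (rule has_field_derivative_transform_within_open[where S = "{0<..}"]) (use 1 in \<open>auto simp: flat_exp_def\<close>)
  next
    case 2
    have "((\<lambda>x. 0) has_real_derivative 0) (at x)" by simp
    then have "(flat_exp P has_real_derivative 0) (at x)"
      by (rule has_field_derivative_transform_within_open[where S = "{..<0}"]) (use 2 in \<open>auto simp: flat_exp_def\<close>)
    then show ?thesis using 2 by (simp add: flat_exp_def)
  next
    case 3
    \<comment> \<open>The extra factor y becomes 1 / h after the substitution y = 1 / h; it is the
      denominator of the difference quotient at 0.\<close>
    have "((\<lambda>y. y ^ 1 * poly P y / exp y) \<longlongrightarrow> 0) at_top" by (rule poly_times_exp_minus_tendsto_0)
    then have "((\<lambda>h. inverse h ^ 1 * poly P (inverse h) / exp (inverse h)) \<longlongrightarrow> 0) (at_right 0)"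
      by (rule filterlim_compose[OF _ filterlim_inverse_at_top_right])
    moreover have "\<forall>\<^sub>F h in at_right 0. inverse h ^ 1 * poly P (inverse h) / exp (inverse h) = flat_exp P h / h"
      by (rule eventually_mono[OF eventually_at_right_less[of 0]])
        (simp add: flat_exp_def exp_minus divide_inverse mult_ac)
    ultimately have "((\<lambda>h. flat_exp P h / h) \<longlongrightarrow> 0) (at_right 0)"
      by (rule Lim_transform_eventually)
    moreover have "((\<lambda>h. flat_exp P h / h) \<longlongrightarrow> 0) (at_left 0)"
      by (rule tendsto_eventually, rule eventually_at_leftI[of "-1"]) (auto simp: flat_exp_def)
    ultimately have "((\<lambda>h. flat_exp P h / h) \<longlongrightarrow> 0) (at 0)"
      by (simp add: filterlim_split_at)
    then show ?thesis
      using 3 by (simp add: DERIV_def flat_exp_def)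
  qed
qed

lemma leibniz_has_derivative:
  fixes F G :: "nat \<Rightarrow> real \<Rightarrow> real"
  assumes F: "\<And>n. (F n has_real_derivative F (Suc n) t) (at t)"
    and G: "\<And>n. (G n has_real_derivative G (Suc n) t) (at t)"
  shows "((\<lambda>t. \<Sum>i\<le>n. real (n choose i) * (F i t * G (n - i) t)) has_real_derivative
    (\<Sum>i\<le>Suc n. real (Suc n choose i) * (F i t * G (Suc n - i) t))) (at t)"
proof -
  have "((\<lambda>t. \<Sum>i\<le>n. real (n choose i) * (F i t * G (n - i) t)) has_real_derivative
    (\<Sum>i\<le>n. real (n choose i) * (F (Suc i) t * G (n - i) t + G (Suc (n - i)) t * F i t))) (at t)"
    by (intro DERIV_sum DERIV_cmult DERIV_mult F G)
  also have "(\<Sum>i\<le>n. real (n choose i) * (F (Suc i) t * G (n - i) t + G (Suc (n - i)) t * F i t))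
     = (\<Sum>i\<le>n. real (n choose i) * (F (Suc i) t * G (n - i) t))
       + (\<Sum>i\<le>n. real (n choose i) * (F i t * G (Suc n - i) t))"
    unfolding sum.distrib[symmetric]
    by (rule sum.cong) (auto simp: distrib_left Suc_diff_le mult.commute)
  also have "(\<Sum>i\<le>n. real (n choose i) * (F i t * G (Suc n - i) t))
     = (\<Sum>i\<le>Suc n. real (n choose i) * (F i t * G (Suc n - i) t))" by simp
  also have "\<dots> = F 0 t * G (Suc n) t + (\<Sum>i\<le>n. real (n choose Suc i) * (F (Suc i) t * G (n - i) t))"
    by (subst sum.atMost_Suc_shift) simp
  also have "(\<Sum>i\<le>n. real (n choose i) * (F (Suc i) t * G (n - i) t))
       + (F 0 t * G (Suc n) t + (\<Sum>i\<le>n. real (n choose Suc i) * (F (Suc i) t * G (n - i) t)))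
     = (\<Sum>i\<le>Suc n. real (Suc n choose i) * (F i t * G (Suc n - i) t))"
    by (subst sum.atMost_Suc_shift) (simp add: sum.distrib[symmetric] distrib_right[symmetric])
  finally show ?thesis .
qed

text \<open>\<open>flat_exp (flat_poly n)\<close> is the \<open>n\<close>-th derivative of
  \<open>flat_exp 1\<close>.\<close>

primrec flat_poly :: "nat \<Rightarrow> real poly" where
  "flat_poly 0 = 1"
| "flat_poly (Suc n) = (flat_poly n - pderiv (flat_poly n)) * [:0, 0, 1:]"

text \<open>The \<open>n\<close>-th derivative, by Leibniz' rule, of \<open>e (k (t - a)) e (k (b - t))\<close> where
  \<open>e x = exp (- 1 / x)\<close> for \<open>x > 0\<close> and \<open>e x = 0\<close> otherwise.\<close>

definition bump :: "real \<Rightarrow> real \<Rightarrow> nat \<Rightarrow> nat \<Rightarrow> real \<Rightarrow> real" where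
  "bump a b k n t = (\<Sum>i\<le>n. real (n choose i) *
     ((real k ^ i * flat_exp (flat_poly i) (real k * t - real k * a)) *
      ((- real k) ^ (n - i) * flat_exp (flat_poly (n - i)) (- real k * t + real k * b))))"

lemma flat_exp_affine_has_derivative:
  "((\<lambda>t. c ^ n * flat_exp (flat_poly n) (c * t + d)) has_real_derivative
     c ^ Suc n * flat_exp (flat_poly (Suc n)) (c * t + d)) (at t)"
proof -
  have "((\<lambda>t. c * t + d) has_real_derivative c) (at t)"
    by (auto intro!: derivative_eq_intros)
  from DERIV_cmult[OF DERIV_chain2[OF flat_exp_has_derivative this], of "c ^ n"]
  show ?thesis by (simp add: mult_ac)
qed

lemma bump_has_derivative: "(bump a b k n has_real_derivative bump a b k (Suc n) t) (at t)"
  unfolding bump_def[abs_def] diff_conv_add_uminus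
  by (rule leibniz_has_derivative) (rule flat_exp_affine_has_derivative)+

lemma bump_outside: "t \<notin> {a<..<b} \<Longrightarrow> bump a b k n t = 0"
proof -
  assume "t \<notin> {a<..<b}"
  then have "t \<le> a \<or> b \<le> t" by auto
  then have "real k * t - real k * a \<le> 0 \<or> - real k * t + real k * b \<le> 0"
    by (auto simp: mult_left_mono)
  then show ?thesis unfolding bump_def by (intro sum.neutral) (auto simp: flat_exp_def)
qed

lemma test_derivs_bump: "test_derivs (bump a b k)"
  unfolding test_derivs_def
proof (intro conjI allI exI impI)
  show "(bump a b k n has_real_derivative bump a b k (Suc n) t) (at t)" for n t
    by (rule bump_has_derivative)
  show "bump a b k n t = 0" if "\<bar>a\<bar> + \<bar>b\<bar> < \<bar>t\<bar>" for n t
    using that by (intro bump_outside) auto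
qed

lemma bump_0: "bump a b k 0 t = flat_exp 1 (real k * (t - a)) * flat_exp 1 (real k * (b - t))"
  by (simp add: bump_def algebra_simps)

lemma flat_exp_1: "0 \<le> flat_exp 1 x" "flat_exp 1 x \<le> 1"
  by (auto simp: flat_exp_def)

lemma bump_nonneg: "0 \<le> bump a b k 0 t"
  by (simp add: bump_0 flat_exp_1)

lemma bump_le_indicator: "bump a b k 0 t \<le> indicator {a<..<b} t"
  using bump_outside[of t a b k 0] flat_exp_1 by (auto simp: indicator_def bump_0 intro!: mult_le_one)

text \<open>This is the purpose of the scale \<open>k\<close>: exp(- 1 / (k c)) tends to 1 for c > 0
  while the support does not move. By dominated convergence, tests against bumps become integrals
  over intervals.\<close>

lemma bump_tendsto: "(\<lambda>k. bump a b k 0 t) \<longlonglongrightarrow> indicator {a<..<b} t"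
proof (cases "t \<in> {a<..<b}")
  case True
  have *: "(\<lambda>k. flat_exp 1 (real k * c)) \<longlonglongrightarrow> 1" if "c > 0" for c
  proof -
    have "(\<lambda>k. exp (- (1 / c) * inverse (real k))) \<longlonglongrightarrow> exp (- (1 / c) * 0)"
      by (rule tendsto_exp[OF tendsto_mult[OF tendsto_const lim_inverse_n]])
    moreover have "\<forall>\<^sub>F k in sequentially. exp (- (1 / c) * inverse (real k)) = flat_exp 1 (real k * c)"
      by (rule eventually_sequentiallyI[of 1]) (use that in \<open>auto simp: flat_exp_def field_simps\<close>)
    ultimately show ?thesis by (simp add: tendsto_cong)
  qed
  show ?thesis
    using tendsto_mult[OF *[of "t - a"] *[of "b - t"]] True by (simp add: bump_0)
next
  case False
  then show ?thesis using bump_outside[OF False] by simp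
qed

lemma test_derivs_continuous: "test_derivs \<Psi> \<Longrightarrow> continuous_on UNIV (\<Psi> n)"
  unfolding test_derivs_def by (meson DERIV_isCont continuous_at_imp_continuous_on)

lemma test_derivs_abs_cont: "test_derivs \<Psi> \<Longrightarrow> abs_cont_deriv (\<Psi> n) (\<Psi> (Suc n))"
  by (rule abs_cont_derivI_has_derivative) (auto simp: test_derivs_def test_derivs_continuous)

lemma integrable_mult_test:
  assumes g: "\<And>a b. set_integrable lborel {a..b} g" and T: "test_derivs \<Psi>"
  shows "integrable lborel (\<lambda>x. g x * \<Psi> n x)"
proof -
  obtain R where R: "\<And>t. R < \<bar>t\<bar> \<Longrightarrow> \<Psi> n t = 0" using T unfolding test_derivs_def by blast
  have "set_integrable lborel {-R..R} (\<lambda>x. g x * \<Psi> n x)"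
    by (rule abs_cont_deriv_set_integrable_mult[OF g test_derivs_continuous[OF T]])
  moreover have "(\<lambda>x. indicator {-R..R} x *\<^sub>R (g x * \<Psi> n x)) = (\<lambda>x. g x * \<Psi> n x)"
  proof (rule ext)
    fix x show "indicator {-R..R} x *\<^sub>R (g x * \<Psi> n x) = g x * \<Psi> n x"
      using R[of x] by (cases "R < \<bar>x\<bar>") (auto simp: indicator_def)
  qed
  ultimately show ?thesis by (simp only: set_integrable_def)
qed

lemma integrable_test: "test_derivs \<Psi> \<Longrightarrow> integrable lborel (\<Psi> n)"
  using integrable_mult_test[of "\<lambda>_. 1" \<Psi> n] borel_integrable_atLeastAtMost'[of _ _ "\<lambda>_::real. 1::real"] by simp

lemma integral_by_parts_test:
  assumes W: "abs_cont_deriv W V" and T: "test_derivs \<Psi>"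
  shows "(\<integral>x. V x * \<Psi> n x \<partial>lborel) = - (\<integral>x. W x * \<Psi> (Suc n) x \<partial>lborel)"
proof -
  have siW: "set_integrable lborel {a..b} W" for a b
    by (rule borel_integrable_atLeastAtMost') (use abs_cont_deriv_continuous[OF W] continuous_on_subset in blast)
  note i = integrable_mult_test[OF abs_cont_derivD(1)[OF W] T, of n] integrable_mult_test[OF siW T]
  have "(\<integral>x. V x * \<Psi> n x + W x * \<Psi> (Suc n) x \<partial>lborel) = 0"
    by (rule abs_cont_deriv_integral_zero[OF abs_cont_deriv_mult[OF W test_derivs_abs_cont[OF T]]])
      (use i in auto)
  then show ?thesis using i by simp
qed

section \<open>Recovering a function from its weak derivative\<close>

lemma abs_cont_deriv_exists:
  assumes g: "\<And>a b. set_integrable lborel {a..b} g"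
  shows "\<exists>G. abs_cont_deriv G g"
proof -
  have int: "interval_lebesgue_integrable lborel (ereal a) (ereal b) g" for a b
    using g[of a b] g[of b a]
    by (auto simp: interval_lebesgue_integrable_def intro: set_integrable_subset)
  have "(LBINT s=0..b. g s) - (LBINT s=0..a. g s) = (LINT s:{a..b}|lborel. g s)" if "a \<le> b" for a b
  proof -
    have "(LBINT s=ereal 0..ereal a. g s) + (LBINT s=ereal a..ereal b. g s) = (LBINT s=ereal 0..ereal b. g s)"
    proof (rule interval_integral_sum)
      show "interval_lebesgue_integrable lborel (min (ereal 0) (min (ereal a) (ereal b))) (max (ereal 0) (max (ereal a) (ereal b))) g"
        using int[of "min 0 (min a b)" "max 0 (max a b)"] by (simp add: ereal_min ereal_max)
    qed
    then show ?thesis using that by (simp add: interval_integral_Icc zero_ereal_def)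
  qed
  then show ?thesis using g unfolding abs_cont_deriv_def
    by (intro exI[of _ "\<lambda>t::real. LBINT s=0..ereal t. g s"] conjI allI impI) auto
qed

lemma bump_integral_pos: "0 < (\<integral>t. bump 0 1 1 0 t \<partial>lborel)"
proof -
  have int: "integrable lborel (bump 0 1 1 0)" by (rule integrable_test[OF test_derivs_bump])
  have "(\<integral>t. bump 0 1 1 0 t \<partial>lborel) \<noteq> 0"
  proof
    assume "(\<integral>t. bump 0 1 1 0 t \<partial>lborel) = 0"
    then have "AE t in lborel. bump 0 1 1 0 t = 0"
      using integral_nonneg_eq_0_iff_AE[OF int] bump_nonneg by simp
    moreover have "bump 0 1 1 0 t \<noteq> 0" if "t \<in> {0<..<1}" for t
      using that by (simp add: bump_0 flat_exp_def)
    ultimately have "AE t in lborel. t \<notin> {0<..<1::real}" by auto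
    then have "emeasure lborel {0<..<1::real} = 0"
      by (subst (asm) AE_iff_measurable[of "{0<..<1::real}"]) auto
    then show False by simp
  qed
  moreover have "0 \<le> (\<integral>t. bump 0 1 1 0 t \<partial>lborel)" using bump_nonneg by simp
  ultimately show ?thesis by simp
qed

definition unit_bump :: "nat \<Rightarrow> real \<Rightarrow> real" where
  "unit_bump n t = bump 0 1 1 n t / (\<integral>t. bump 0 1 1 0 t \<partial>lborel)"

lemma test_derivs_unit_bump: "test_derivs unit_bump"
proof -
  have "(unit_bump n has_real_derivative unit_bump (Suc n) t) (at t)" for n t
    unfolding unit_bump_def[abs_def] by (rule DERIV_cdivide[OF bump_has_derivative])
  moreover have "unit_bump n t = 0" if "1 < \<bar>t\<bar>" for n t
  proof -
    have "t \<notin> {0<..<1}" using that by auto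
    then show ?thesis by (simp add: unit_bump_def bump_outside)
  qed
  ultimately show ?thesis unfolding test_derivs_def by blast
qed

lemma integral_unit_bump: "(\<integral>t. unit_bump 0 t \<partial>lborel) = 1"
  using bump_integral_pos by (simp add: unit_bump_def)

text \<open>An antiderivative of a test function has compact support only if the integral of the
  function vanishes. Subtracting the right multiple of a bump of integral 1 arranges this. Since
  test functions are stored with all derivatives, entry \<open>Suc n\<close> of the antiderivative
  is entry \<open>n\<close> of the corrected function.\<close>

definition bump_antideriv :: "(nat \<Rightarrow> real \<Rightarrow> real) \<Rightarrow> nat \<Rightarrow> real \<Rightarrow> real" where
  "bump_antideriv \<Psi> n = (let r = (\<lambda>n t. \<Psi> n t - (\<integral>t. \<Psi> 0 t \<partial>lborel) * unit_bump n t) in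
     case n of 0 \<Rightarrow> (\<lambda>t. LINT s:{..t}|lborel. r 0 s) | Suc n \<Rightarrow> r n)"

lemma bump_antideriv_Suc:
  "bump_antideriv \<Psi> (Suc n) t = \<Psi> n t - (\<integral>t. \<Psi> 0 t \<partial>lborel) * unit_bump n t"
  by (simp add: bump_antideriv_def)

lemma test_derivs_bump_antideriv:
  assumes T: "test_derivs \<Psi>"
  shows "test_derivs (bump_antideriv \<Psi>)"
proof -
  define c where "c = (\<integral>t. \<Psi> 0 t \<partial>lborel)"
  define r where "r n t = \<Psi> n t - c * unit_bump n t" for n t
  obtain R1 where R1: "\<And>n t. R1 < \<bar>t\<bar> \<Longrightarrow> \<Psi> n t = 0" using T by (auto simp: test_derivs_def)
  obtain R2 where R2: "\<And>n t. R2 < \<bar>t\<bar> \<Longrightarrow> unit_bump n t = 0"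
    using test_derivs_unit_bump by (auto simp: test_derivs_def)
  have dr: "(r n has_real_derivative r (Suc n) t) (at t)" for n t
    unfolding r_def[abs_def] using T test_derivs_unit_bump
    by (intro DERIV_diff DERIV_cmult) (auto simp: test_derivs_def)
  have Tr: "test_derivs r"
    unfolding test_derivs_def using dr R1 R2 by (auto simp: r_def intro!: exI[of _ "max R1 R2"])
  note ir = integrable_test[OF Tr, of 0]
  have si: "set_integrable lborel A (r 0)" if "A \<in> sets lborel" for A
    using ir that unfolding set_integrable_def by (intro integrable_mult_indicator) auto
  define I where "I t = (LINT s:{..t}|lborel. r 0 s)" for t
  have "I b - I a = (LINT s:{a..b}|lborel. r 0 s)" if "a \<le> b" for a b
  proof -
    have "I b = (LINT s:{..a} \<union> {a<..b}|lborel. r 0 s)" unfolding I_def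
      by (rule arg_cong[where f = "\<lambda>A. set_lebesgue_integral lborel A (r 0)"]) (use that in auto)
    also have "\<dots> = I a + (LINT s:{a<..b}|lborel. r 0 s)" unfolding I_def
      by (rule set_integral_Un) (use si in auto)
    also have "(LINT s:{a<..b}|lborel. r 0 s) = (LINT s:{a..b}|lborel. r 0 s)"
      using interval_integral_Icc[OF that] interval_integral_Ioc[OF that] by metis
    finally show ?thesis by simp
  qed
  then have "abs_cont_deriv I (r 0)" using si by (auto simp: abs_cont_deriv_def)
  then have dI: "(I has_real_derivative r 0 t) (at t)" for t
    by (rule abs_cont_deriv_has_derivative) (rule test_derivs_continuous[OF Tr])
  have eq: "bump_antideriv \<Psi> n = (case n of 0 \<Rightarrow> I | Suc n \<Rightarrow> r n)" for n
    by (simp add: bump_antideriv_def r_def[abs_def] I_def[abs_def] c_def split: nat.split)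
  \<comment> \<open>To the right of the support the antiderivative \<open>I\<close> equals this full
    integral; its vanishing is what gives \<open>I\<close> compact support.\<close>
  have "(\<integral>t. r 0 t \<partial>lborel) = 0"
    unfolding r_def using integrable_test[OF T, of 0] integrable_test[OF test_derivs_unit_bump, of 0]
    by (simp add: integral_unit_bump c_def)
  have I0: "I t = 0" if "max R1 R2 < \<bar>t\<bar>" for t
  proof (cases "t < 0")
    case True
    have "(\<lambda>s. indicator {..t} s *\<^sub>R r 0 s) = (\<lambda>_. 0)"
    proof (rule ext)
      fix s show "indicator {..t} s *\<^sub>R r 0 s = 0"
        using True that R1[of s 0] R2[of s 0] by (auto simp: r_def indicator_def)
    qed
    then show ?thesis by (simp only: I_def set_lebesgue_integral_def Bochner_Integration.integral_zero)
  next
    case False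
    have "(\<lambda>s. indicator {..t} s *\<^sub>R r 0 s) = r 0"
    proof (rule ext)
      fix s show "indicator {..t} s *\<^sub>R r 0 s = r 0 s"
        using False that R1[of s 0] R2[of s 0] by (auto simp: r_def indicator_def)
    qed
    then show ?thesis using \<open>(\<integral>t. r 0 t \<partial>lborel) = 0\<close> by (simp only: I_def set_lebesgue_integral_def)
  qed
  show ?thesis
    unfolding test_derivs_def
  proof (intro conjI allI exI[of _ "max R1 R2"] impI)
    show "(bump_antideriv \<Psi> n has_real_derivative bump_antideriv \<Psi> (Suc n) t) (at t)" for n t
      using dI dr by (cases n) (auto simp: eq)
    show "bump_antideriv \<Psi> n t = 0" if "max R1 R2 < \<bar>t\<bar>" for n t
      using I0[OF that] that R1 R2 by (cases n) (auto simp: eq r_def)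
  qed
qed

text \<open>Because \<open>ennreal\<close> cuts off negative values, the two densities used here are
  the positive and the negative part of \<open>q\<close>. The measures they define are finite and
  equal on boxes, an intersection-stable generator, hence equal everywhere. So the two parts agree
  almost everywhere, and as one of them is always 0, both vanish.\<close>

lemma AE_zero_if_box_integrals_zero:
  fixes q :: "'a::euclidean_space \<Rightarrow> real"
  assumes [measurable]: "q \<in> borel_measurable borel"
    and int: "\<And>a b. set_integrable lborel (box a b) q"
    and zero: "\<And>a b. (LINT x:box a b|lborel. q x) = 0"
  shows "AE x in lborel. q x = 0"
proof -
  have box: "emeasure (density lborel (\<lambda>x. ennreal (q x))) (box a b)
      = emeasure (density lborel (\<lambda>x. ennreal (- q x))) (box a b)" 
    and fin: "emeasure (density lborel (\<lambda>x. ennreal (q x))) (box a b) \<noteq> \<infinity>" for a b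
  proof -
    have i: "integrable lborel (\<lambda>x. indicator (box a b) x * q x)"
      using int[of a b] by (simp add: set_integrable_def)
    have ip: "integrable lborel (\<lambda>x. max 0 (indicator (box a b) x * q x))"
      and im: "integrable lborel (\<lambda>x. max 0 (- (indicator (box a b) x * q x)))"
      using i by auto
    have "(\<integral>x. max 0 (indicator (box a b) x * q x) - max 0 (- (indicator (box a b) x * q x)) \<partial>lborel)
       = (\<integral>x. indicator (box a b) x * q x \<partial>lborel)"
      by (rule Bochner_Integration.integral_cong) (auto simp: max_def)
    also have "\<dots> = 0" using zero[of a b] by (simp add: set_lebesgue_integral_def)
    finally have e: "(\<integral>x. max 0 (indicator (box a b) x * q x) \<partial>lborel) = (\<integral>x. max 0 (- (indicator (box a b) x * q x)) \<partial>lborel)"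
      using ip im by simp
    have p1: "emeasure (density lborel (\<lambda>x. ennreal (q x))) (box a b) = ennreal (\<integral>x. max 0 (indicator (box a b) x * q x) \<partial>lborel)"
      by (subst nn_integral_eq_integral[symmetric, OF ip])
        (auto simp: emeasure_density indicator_def intro!: nn_integral_cong)
    moreover have "emeasure (density lborel (\<lambda>x. ennreal (- q x))) (box a b) = ennreal (\<integral>x. max 0 (- (indicator (box a b) x * q x)) \<partial>lborel)"
      by (subst nn_integral_eq_integral[symmetric, OF im])
        (auto simp: emeasure_density indicator_def intro!: nn_integral_cong)
    ultimately show "emeasure (density lborel (\<lambda>x. ennreal (q x))) (box a b)
      = emeasure (density lborel (\<lambda>x. ennreal (- q x))) (box a b)"
      "emeasure (density lborel (\<lambda>x. ennreal (q x))) (box a b) \<noteq> \<infinity>" using e by auto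
  qed
  have "density lborel (\<lambda>x. ennreal (q x)) = density lborel (\<lambda>x. ennreal (- q x))"
  proof (rule measure_eqI_generator_eq)
    let ?E = "range (\<lambda>(a, b). box a b :: 'a set)"
    show "Int_stable ?E"
      by (auto simp: Int_stable_def box_Int_box)
    show "?E \<subseteq> Pow UNIV" "sets (density lborel (\<lambda>x. ennreal (q x))) = sigma_sets UNIV ?E"
      "sets (density lborel (\<lambda>x. ennreal (- q x))) = sigma_sets UNIV ?E"
      by (simp_all add: borel_eq_box)
    let ?A = "\<lambda>n::nat. box (- (real n *\<^sub>R One)) (real n *\<^sub>R One) :: 'a set"
    show "range ?A \<subseteq> ?E" "(\<Union>i. ?A i) = UNIV"
      unfolding UN_box_eq_UNIV by auto
    show "emeasure (density lborel (\<lambda>x. ennreal (q x))) (?A i) \<noteq> \<infinity>" for i by (rule fin)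
    show "emeasure (density lborel (\<lambda>x. ennreal (q x))) X = emeasure (density lborel (\<lambda>x. ennreal (- q x))) X"
      if "X \<in> ?E" for X using that box by auto
  qed
  then have "AE x in lborel. ennreal (q x) = ennreal (- q x)"
    by (subst (asm) sigma_finite_measure.density_unique_iff[OF lborel.sigma_finite_measure_axioms]) auto
  then show ?thesis
  proof eventually_elim
    case (elim x)
    then show ?case
      by (cases "q x \<ge> 0") (auto simp: ennreal_neg)
  qed
qed

text \<open>A countable family suffices, so it can be used simultaneously on almost every slice.\<close>

definition rational_bumps :: "(nat \<Rightarrow> real \<Rightarrow> real) set" where
  "rational_bumps = (\<lambda>(a, b, k). bump a b k) ` (\<rat> \<times> \<rat> \<times> UNIV)"

text \<open>Letting the scale of the bumps tend to infinity shows that \<open>q\<close> integrates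
  to zero over intervals with rational ends. An antiderivative \<open>G\<close> is thus constant on
  the rationals, and by continuity everywhere, which settles all intervals.\<close>

lemma AE_zero_if_rational_bumps:
  fixes q :: "real \<Rightarrow> real"
  assumes int: "\<And>a b. set_integrable lborel {a..b} q"
    and zero: "\<And>\<Psi>. \<Psi> \<in> rational_bumps \<Longrightarrow> (\<integral>t. q t * \<Psi> 0 t \<partial>lborel) = 0"
  shows "AE t in lborel. q t = 0"
proof -
  have [measurable]: "q \<in> borel_measurable borel" by (rule borel_measurable_if_set_integrable_Icc[OF int])
  obtain G where G: "abs_cont_deriv G q" using abs_cont_deriv_exists[OF int] by blast
  have rat: "(LINT t:{a<..<b}|lborel. q t) = 0" if "a \<in> \<rat>" "b \<in> \<rat>" for a b
  proof -
    let ?w = "\<lambda>t. \<bar>q t * indicator {a..b} t\<bar>"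
    have "(\<lambda>k. \<integral>t. q t * bump a b k 0 t \<partial>lborel) \<longlonglongrightarrow> (\<integral>t. q t * indicator {a<..<b} t \<partial>lborel)"
    proof (rule integral_dominated_convergence[where w = "\<lambda>t. ?w t"])
      show "integrable lborel (\<lambda>t. ?w t)"
        using int[of a b] by (simp add: set_integrable_def mult.commute)
      have "bump a b k 0 \<in> borel_measurable borel" for k
        by (rule borel_measurable_continuous_onI[OF test_derivs_continuous[OF test_derivs_bump]])
      then show "(\<lambda>t. q t * bump a b k 0 t) \<in> borel_measurable lborel" for k by simp
      show "AE t in lborel. (\<lambda>k. q t * bump a b k 0 t) \<longlonglongrightarrow> q t * indicator {a<..<b} t"
        by (intro AE_I2 tendsto_intros bump_tendsto)
      show "AE t in lborel. norm (q t * bump a b k 0 t) \<le> ?w t" for k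
      proof (rule AE_I2)
        fix t
        have "bump a b k 0 t \<le> indicator {a..b} t"
          using bump_le_indicator[of a b k t] by (cases "t \<in> {a<..<b}"; cases "t \<in> {a..b}") auto
        then show "norm (q t * bump a b k 0 t) \<le> ?w t"
          using bump_nonneg[of a b k t] by (simp add: abs_mult mult_left_mono)
      qed
    qed simp
    moreover have "(\<integral>t. q t * bump a b k 0 t \<partial>lborel) = 0" for k
    proof (rule zero)
      have "(a, b, k) \<in> \<rat> \<times> \<rat> \<times> UNIV" using that by simp
      then show "bump a b k \<in> rational_bumps" unfolding rational_bumps_def by (rule rev_image_eqI) simp
    qed
    ultimately have "(\<integral>t. q t * indicator {a<..<b} t \<partial>lborel) = 0"
      by (simp add: LIMSEQ_const_iff)
    then show ?thesis by (simp add: set_lebesgue_integral_def mult.commute)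
  qed
  have Ioo: "(LINT t:{a<..<b}|lborel. q t) = G b - G a" if "a \<le> b" for a b
    using interval_integral_Icc[OF that, of q] interval_integral_Ioo[of "ereal a" "ereal b" q] that
      abs_cont_derivD(2)[OF G that] by simp
  have const: "G x = G 0" for x
  proof (rule continuous_constant_on_closure[of "\<rat>" G])
    show "G x = G 0" if "x \<in> \<rat>" for x
      using Ioo[of 0 x] Ioo[of x 0] rat[of 0 x] rat[of x 0] that by (cases "0 \<le> x") auto
  qed (simp_all add: Rats_closure_real abs_cont_deriv_continuous[OF G])
  show ?thesis
  proof (rule AE_zero_if_box_integrals_zero)
    show "set_integrable lborel (box a b) q" for a b
      by (rule set_integrable_subset[OF int[of a b]]) (auto simp: box_real)
    show "(LINT t:box a b|lborel. q t) = 0" for a b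
      using Ioo[of a b] const[of a] const[of b] by (cases "a \<le> b") (auto simp: box_real set_lebesgue_integral_def)
  qed simp
qed

lemma test_derivs_bump_antiderivs: "\<Psi> \<in> (bump_antideriv ^^ n) ` rational_bumps \<Longrightarrow> test_derivs \<Psi>"
proof (induction n arbitrary: \<Psi>)
  case 0 then show ?case by (auto simp: rational_bumps_def test_derivs_bump)
next
  case (Suc n)
  then show ?case by (auto intro!: test_derivs_bump_antideriv)
qed

text \<open>A du Bois-Reymond argument by induction on \<open>N\<close>. For an antiderivative
  \<open>G\<close> of \<open>V\<close>, testing with \<open>bump_antideriv \<Psi>\<close> and
  integrating by parts lowers the order by one: up to an additive constant, \<open>G\<close> takes
  the place of \<open>V\<close> and \<open>\<Psi>\<close> that of its antiderivative. Each step
  consumes one \<open>bump_antideriv\<close>, which explains the family of \<open>N\<close>-fold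
  antiderivatives of rational bumps in the hypothesis.\<close>

lemma weak_derivative_representation:
  assumes F: "\<And>a b. set_integrable lborel {a..b} F" and V: "\<And>a b. set_integrable lborel {a..b} V"
    and weak: "\<And>\<Psi>. \<Psi> \<in> (bump_antideriv ^^ N) ` rational_bumps \<Longrightarrow>
      (\<integral>t. F t * \<Psi> N t \<partial>lborel) = (- 1) ^ N * (\<integral>t. V t * \<Psi> 0 t \<partial>lborel)"
  shows "\<exists>w. w N = V \<and> (\<forall>n<N. abs_cont_deriv (w n) (w (Suc n))) \<and> (AE t in lborel. F t = w 0 t)"
  using V weak
proof (induction N arbitrary: V)
  case 0
  have "AE t in lborel. F t - V t = 0"
  proof (rule AE_zero_if_rational_bumps)
    show "set_integrable lborel {a..b} (\<lambda>t. F t - V t)" for a b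
      by (rule set_integral_diff[OF F 0(1)])
    fix \<Psi> assume R: "\<Psi> \<in> rational_bumps"
    then have T: "test_derivs \<Psi>" by (auto simp: rational_bumps_def test_derivs_bump)
    show "(\<integral>t. (F t - V t) * \<Psi> 0 t \<partial>lborel) = 0"
      using 0(2)[of \<Psi>] R integrable_mult_test[OF F T, of 0] integrable_mult_test[OF 0(1) T, of 0]
      by (simp add: left_diff_distrib)
  qed
  then show ?case by (intro exI[of _ "\<lambda>_. V"]) auto
next
  case (Suc N)
  obtain G where G: "abs_cont_deriv G V" using abs_cont_deriv_exists[OF Suc.prems(1)] by blast
  have siG: "set_integrable lborel {a..b} G" for a b
    by (rule borel_integrable_atLeastAtMost') (use abs_cont_deriv_continuous[OF G] continuous_on_subset in blast)
  \<comment> \<open>With c the integral of \<open>\<Psi>\<close> and u = \<open>unit_bump\<close>,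
    the identity for the corrected test function leaves the error c ((-1)^N \<integral> F u^(N) -
    \<integral> G u). This is c K, that is, the integral of K times \<open>\<Psi>\<close>, so adding
    the constant \<open>K\<close> to \<open>G\<close> removes it for all \<open>\<Psi>\<close> at
    once.\<close>
  define K where "K = (- 1) ^ N * (\<integral>t. F t * unit_bump N t \<partial>lborel) - (\<integral>t. G t * unit_bump 0 t \<partial>lborel)"
  have "\<exists>w. w N = (\<lambda>t. G t + K) \<and> (\<forall>n<N. abs_cont_deriv (w n) (w (Suc n))) \<and> (AE t in lborel. F t = w 0 t)"
  proof (rule Suc.IH)
    have "set_integrable lborel {a..b} (\<lambda>_. K)" for a b :: real
      by (rule borel_integrable_atLeastAtMost') auto
    then show "set_integrable lborel {a..b} (\<lambda>t. G t + K)" for a b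
      by (intro set_integral_add siG)
    fix \<Psi> assume mem: "\<Psi> \<in> (bump_antideriv ^^ N) ` rational_bumps"
    then have T: "test_derivs \<Psi>" by (rule test_derivs_bump_antiderivs)
    define c where "c = (\<integral>t. \<Psi> 0 t \<partial>lborel)"
    let ?X = "bump_antideriv \<Psi>"
    let ?FU = "\<integral>t. F t * unit_bump N t \<partial>lborel" and ?GU = "\<integral>t. G t * unit_bump 0 t \<partial>lborel"
    let ?FP = "\<integral>t. F t * \<Psi> N t \<partial>lborel" and ?GP = "\<integral>t. G t * \<Psi> 0 t \<partial>lborel"
    let ?GX = "\<integral>t. G t * ?X (Suc 0) t \<partial>lborel" and ?FX = "\<integral>t. F t * ?X (Suc N) t \<partial>lborel"
    have memX: "?X \<in> (bump_antideriv ^^ Suc N) ` rational_bumps" using mem by auto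
    then have TX: "test_derivs ?X" by (rule test_derivs_bump_antiderivs)
    note iFP = integrable_mult_test[OF F T, of N] integrable_mult_test[OF F test_derivs_unit_bump, of N]
    note iGP = integrable_mult_test[OF siG T, of 0] integrable_mult_test[OF siG test_derivs_unit_bump, of 0]
    have "?FX = (- 1) ^ Suc N * (\<integral>t. V t * ?X 0 t \<partial>lborel)"
      by (rule Suc.prems(2)[OF memX])
    also have "\<dots> = (- 1) ^ N * ?GX"
      using integral_by_parts_test[OF G TX, of 0] by simp
    also have "?GX = ?GP - c * ?GU"
    proof -
      have "?GX = (\<integral>t. G t * \<Psi> 0 t - c * (G t * unit_bump 0 t) \<partial>lborel)"
        by (simp add: bump_antideriv_Suc c_def algebra_simps)
      then show ?thesis using iGP by simp
    qed
    also have "?FX = ?FP - c * ?FU"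
    proof -
      have "?FX = (\<integral>t. F t * \<Psi> N t - c * (F t * unit_bump N t) \<partial>lborel)"
        by (simp add: bump_antideriv_Suc c_def algebra_simps)
      then show ?thesis using iFP by simp
    qed
    finally have e: "?FP - c * ?FU
      = (- 1) ^ N * (?GP - c * ?GU)" .
    have "(\<integral>t. (G t + K) * \<Psi> 0 t \<partial>lborel) = ?GP + K * c"
      using iGP integrable_test[OF T, of 0] by (simp add: distrib_right c_def)
    moreover have "(- 1) ^ N * (- 1) ^ N = (1::real)" by (simp add: power_mult_distrib[symmetric])
    then have "(- 1) ^ N * (K * c) = c * ?FU
       - (- 1) ^ N * (c * ?GU)"
      unfolding K_def by (simp add: algebra_simps)
    ultimately show "?FP = (- 1) ^ N * (\<integral>t. (G t + K) * \<Psi> 0 t \<partial>lborel)"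
      using e by (simp add: algebra_simps)
  qed
  then obtain w where w: "w N = (\<lambda>t. G t + K)" "\<And>n. n < N \<Longrightarrow> abs_cont_deriv (w n) (w (Suc n))"
    "AE t in lborel. F t = w 0 t" by blast
  have "abs_cont_deriv (\<lambda>t. G t + K) V" using G by (simp add: abs_cont_deriv_def)
  then have "\<forall>n<Suc N. abs_cont_deriv ((w(Suc N := V)) n) ((w(Suc N := V)) (Suc n))"
    using w by (auto simp: less_Suc_eq)
  moreover have "AE t in lborel. F t = (w(Suc N := V)) 0 t" using w by simp
  ultimately show ?case by (intro exI[of _ "w(Suc N := V)"]) auto
qed

section \<open>Slices parallel to a coordinate axis\<close>

lemma integrable_pair_mult:
  fixes f :: "'a::euclidean_space \<Rightarrow> real" and g :: "'b::euclidean_space \<Rightarrow> real"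
  assumes f: "integrable lborel f" and g: "integrable lborel g"
  shows "integrable (lborel \<Otimes>\<^sub>M lborel) (\<lambda>z. f (fst z) * g (snd z))"
    "(\<integral>z. f (fst z) * g (snd z) \<partial>(lborel \<Otimes>\<^sub>M lborel)) = (\<integral>x. f x \<partial>lborel) * (\<integral>y. g y \<partial>lborel)"
proof -
  have [measurable]: "f \<in> borel_measurable borel" "g \<in> borel_measurable borel"
    using f g by (auto dest: borel_measurable_integrable)
  have "integrable (lborel \<Otimes>\<^sub>M lborel) (\<lambda>(x, y). f x * g y)"
    by (rule lborel_pair.Fubini_integrable) (use f g in \<open>auto simp: abs_mult\<close>)
  note i = this
  then show "integrable (lborel \<Otimes>\<^sub>M lborel) (\<lambda>z. f (fst z) * g (snd z))"
    by (simp add: case_prod_beta')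
  show "(\<integral>z. f (fst z) * g (snd z) \<partial>(lborel \<Otimes>\<^sub>M lborel)) = (\<integral>x. f x \<partial>lborel) * (\<integral>y. g y \<partial>lborel)"
    using lborel_pair.integral_fst[OF i] by (simp add: case_prod_beta')
qed

text \<open>Lines in direction \<open>j\<close> are indexed by full points \<open>x\<close>, whose
  own coordinate \<open>x $ j\<close> is redundant. No space of one dimension less is needed; the
  redundant coordinate is integrated out against a probability density.\<close>

definition upd :: "'n::finite \<Rightarrow> real ^ 'n \<Rightarrow> real \<Rightarrow> real ^ 'n" where
  "upd j x t = x + (t - x $ j) *\<^sub>R axis j 1"

lemma upd_nth: "upd j x t $ i = (if i = j then t else x $ i)"
  by (simp add: upd_def axis_def)

lemma upd_upd [simp]: "upd j (upd j x t) s = upd j x s"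
  by (simp add: vec_eq_iff upd_nth)

lemma upd_self [simp]: "upd j x (x $ j) = x"
  by (simp add: vec_eq_iff upd_nth)

lemma upd_add: "upd j x t + s *\<^sub>R axis j 1 = upd j x (t + s)"
  by (simp add: vec_eq_iff upd_nth axis_def)

lemma continuous_upd: "continuous_on UNIV (\<lambda>z. upd j (fst z) (snd z))"
  unfolding upd_def by (intro continuous_intros)

lemma continuous_upd_snd: "continuous_on UNIV (upd j x)"
  unfolding upd_def[abs_def] by (intro continuous_intros)

lemma measurable_upd [measurable]:
  "(\<lambda>z. upd j (fst z) (snd z)) \<in> borel_measurable (lborel \<Otimes>\<^sub>M lborel)"
  using borel_measurable_continuous_onI[OF continuous_upd] by (simp add: borel_prod[symmetric] cong: measurable_cong_sets)

lemma measurable_upd_snd [measurable]: "upd j x \<in> borel_measurable borel"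
  by (rule borel_measurable_continuous_onI[OF continuous_upd_snd])

text \<open>Adjoining a real variable and exchanging it with coordinate \<open>j\<close> turns
  integration along lines into integration over a genuine product measure, where Fubini
  applies.\<close>

definition coord_swap :: "'n::finite \<Rightarrow> (real ^ 'n) \<times> real \<Rightarrow> (real ^ 'n) \<times> real" where
  "coord_swap j z = (upd j (fst z) (snd z), fst z $ j)"

lemma coord_swap_involution [simp]: "coord_swap j (coord_swap j z) = z"
  by (simp add: coord_swap_def upd_nth)

lemma measurable_coord_swap [measurable]:
  "coord_swap j \<in> (lborel \<Otimes>\<^sub>M lborel) \<rightarrow>\<^sub>M (lborel \<Otimes>\<^sub>M lborel)"
proof -
  have [measurable]: "(\<lambda>x. x $ j) \<in> borel_measurable borel"
    by (intro borel_measurable_continuous_onI continuous_intros)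
  then show ?thesis unfolding coord_swap_def[abs_def] by measurable
qed

lemma coord_swap_diff: "coord_swap j u - coord_swap j l = coord_swap j (u - l)"
  by (simp add: coord_swap_def vec_eq_iff upd_nth prod_eq_iff)

lemma coord_swap_inner: "coord_swap j u \<bullet> b = u \<bullet> coord_swap j b"
  by (simp add: coord_swap_def inner_prod_def upd_def inner_add_left inner_add_right inner_axis inner_axis' algebra_simps)

lemma coord_swap_Basis:
  assumes "b \<in> Basis"
  shows "coord_swap j b \<in> Basis"
proof -
  consider i where "b = (axis i 1, 0)" | "b = (0, 1)"
    using assms by (auto simp: Basis_prod_def Basis_vec_def)
  then show ?thesis
  proof cases
    case 1
    then have "coord_swap j b = (if i = j then (0, 1) else b)"
      by (simp add: coord_swap_def vec_eq_iff upd_nth axis_def)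
    then show ?thesis using assms by (simp add: Basis_prod_def)
  next
    case 2
    then have "coord_swap j b = (axis j 1, 0)"
      by (simp add: coord_swap_def vec_eq_iff upd_nth axis_def)
    then show ?thesis by (auto simp: Basis_prod_def Basis_vec_def)
  qed
qed

text \<open>The map is a self-adjoint linear involution that permutes the basis. The preimage of a
  box is the box with permuted sides, and its volume is the same product in another order.\<close>

lemma distr_coord_swap:
  fixes j :: "'n::finite"
  shows "distr (lborel \<Otimes>\<^sub>M lborel) (lborel \<Otimes>\<^sub>M lborel) (coord_swap j) = (lborel \<Otimes>\<^sub>M lborel)"
proof -
  let ?S = "distr (lborel \<Otimes>\<^sub>M lborel) (lborel \<Otimes>\<^sub>M lborel) (coord_swap j)"
  have "lborel = ?S"
  proof (rule lborel_eqI)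
    fix l u :: "(real ^ 'n) \<times> real"
    assume le: "\<And>b. b \<in> Basis \<Longrightarrow> l \<bullet> b \<le> u \<bullet> b"
    let ?box = "box (coord_swap j l) (coord_swap j u)"
    have "coord_swap j -` box l u = ?box"
    proof (rule set_eqI)
      fix z
      have "(\<forall>b\<in>Basis. l \<bullet> b < coord_swap j z \<bullet> b \<and> coord_swap j z \<bullet> b < u \<bullet> b) \<longleftrightarrow>
        (\<forall>b\<in>Basis. coord_swap j l \<bullet> b < z \<bullet> b \<and> z \<bullet> b < coord_swap j u \<bullet> b)" (is "?L \<longleftrightarrow> ?R")
      proof
        assume L: ?L
        show ?R
        proof
          fix b :: "(real ^ 'n) \<times> real" assume "b \<in> Basis"
          then show "coord_swap j l \<bullet> b < z \<bullet> b \<and> z \<bullet> b < coord_swap j u \<bullet> b"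
            using bspec[OF L coord_swap_Basis[of b j]] by (simp add: coord_swap_inner)
        qed
      next
        assume R: ?R
        show ?L
        proof
          fix b :: "(real ^ 'n) \<times> real" assume "b \<in> Basis"
          then show "l \<bullet> b < coord_swap j z \<bullet> b \<and> coord_swap j z \<bullet> b < u \<bullet> b"
            using bspec[OF R coord_swap_Basis[of b j]] by (simp add: coord_swap_inner)
        qed
      qed
      then show "z \<in> coord_swap j -` box l u \<longleftrightarrow> z \<in> ?box"
        by (simp add: mem_box)
    qed
    then have "emeasure (?S) (box l u)
      = emeasure lborel (?box)"
    proof (subst emeasure_distr[OF measurable_coord_swap])
      show "box l u \<in> sets (lborel \<Otimes>\<^sub>M lborel)" unfolding lborel_prod by simp
    qed (simp add: lborel_prod)
    also have "\<dots> = (\<Prod>b\<in>Basis. (coord_swap j u - coord_swap j l) \<bullet> b)"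
      using le by (subst emeasure_lborel_box) (auto simp: coord_swap_inner coord_swap_Basis)
    also have "(\<Prod>b\<in>Basis. (coord_swap j u - coord_swap j l) \<bullet> b) = (\<Prod>b\<in>Basis. (u - l) \<bullet> b)"
      by (rule prod.reindex_bij_witness[of _ "coord_swap j" "coord_swap j"])
        (auto simp: coord_swap_Basis coord_swap_inner coord_swap_diff)
    finally show "emeasure (?S) (box l u)
      = (\<Prod>b\<in>Basis. (u - l) \<bullet> b)" .
  qed (simp add: lborel_prod)
  then show ?thesis by (simp add: lborel_prod)
qed

lemma nn_integral_coord_swap:
  assumes [measurable]: "H \<in> borel_measurable (lborel \<Otimes>\<^sub>M lborel)"
  shows "(\<integral>\<^sup>+x. (\<integral>\<^sup>+t. H (upd j x t, x $ j) \<partial>lborel) \<partial>lborel) = (\<integral>\<^sup>+x. (\<integral>\<^sup>+t. H (x, t) \<partial>lborel) \<partial>lborel)"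
proof -
  have "(\<integral>\<^sup>+z. H z \<partial>(lborel \<Otimes>\<^sub>M lborel)) = (\<integral>\<^sup>+z. H (coord_swap j z) \<partial>(lborel \<Otimes>\<^sub>M lborel))"
    by (subst distr_coord_swap[of j, symmetric]) (rule nn_integral_distr; measurable)
  moreover have "(\<integral>\<^sup>+x. (\<integral>\<^sup>+t. H (coord_swap j (x, t)) \<partial>lborel) \<partial>lborel) = (\<integral>\<^sup>+z. H (coord_swap j z) \<partial>(lborel \<Otimes>\<^sub>M lborel))"
    by (rule lborel.nn_integral_fst) measurable
  moreover have "(\<integral>\<^sup>+x. (\<integral>\<^sup>+t. H (x, t) \<partial>lborel) \<partial>lborel) = (\<integral>\<^sup>+z. H z \<partial>(lborel \<Otimes>\<^sub>M lborel))"
    by (rule lborel.nn_integral_fst) measurable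
  ultimately show ?thesis by (simp add: coord_swap_def)
qed

lemma integral_coord_swap:
  fixes H :: "(real ^ 'n::finite) \<times> real \<Rightarrow> real"
  assumes "integrable (lborel \<Otimes>\<^sub>M lborel) H"
  shows "integrable (lborel \<Otimes>\<^sub>M lborel) (\<lambda>z. H (coord_swap j z))"
    "(\<integral>z. H (coord_swap j z) \<partial>(lborel \<Otimes>\<^sub>M lborel)) = (\<integral>z. H z \<partial>(lborel \<Otimes>\<^sub>M lborel))"
proof -
  have [measurable]: "H \<in> borel_measurable (lborel \<Otimes>\<^sub>M lborel)" using assms by auto
  have "integrable (distr (lborel \<Otimes>\<^sub>M lborel) (lborel \<Otimes>\<^sub>M lborel) (coord_swap j)) H"
    using assms by (simp add: distr_coord_swap)
  then show "integrable (lborel \<Otimes>\<^sub>M lborel) (\<lambda>z. H (coord_swap j z))"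
    by (subst (asm) integrable_distr_eq) measurable
  have "(\<integral>z. H z \<partial>(distr (lborel \<Otimes>\<^sub>M lborel) (lborel \<Otimes>\<^sub>M lborel) (coord_swap j)))
      = (\<integral>z. H (coord_swap j z) \<partial>(lborel \<Otimes>\<^sub>M lborel))"
    by (rule integral_distr) measurable
  then show "(\<integral>z. H (coord_swap j z) \<partial>(lborel \<Otimes>\<^sub>M lborel)) = (\<integral>z. H z \<partial>(lborel \<Otimes>\<^sub>M lborel))"
    by (simp add: distr_coord_swap)
qed

text \<open>After the exchange of coordinates, the weight \<open>\<rho>\<close> depends on the
  adjoined variable alone and contributes its mass 1.\<close>

lemma nn_integral_slices:
  fixes F :: "real ^ 'n::finite \<Rightarrow> ennreal"
  assumes [measurable]: "F \<in> borel_measurable borel" "\<rho> \<in> borel_measurable borel"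
    and "(\<integral>\<^sup>+s. \<rho> s \<partial>lborel) = 1"
  shows "(\<integral>\<^sup>+x. (\<integral>\<^sup>+t. F (upd j x t) \<partial>lborel) * \<rho> (x $ j) \<partial>lborel) = (\<integral>\<^sup>+x. F x \<partial>lborel)"
proof -
  have "(\<integral>\<^sup>+x. (\<integral>\<^sup>+t. F (upd j x t) \<partial>lborel) * \<rho> (x $ j) \<partial>lborel)
      = (\<integral>\<^sup>+x. (\<integral>\<^sup>+t. F (upd j x t) * \<rho> (x $ j) \<partial>lborel) \<partial>lborel)"
    by (intro nn_integral_cong nn_integral_multc[symmetric]) measurable
  also have "\<dots> = (\<integral>\<^sup>+x. (\<integral>\<^sup>+t. F x * \<rho> t \<partial>lborel) \<partial>lborel)"
    using nn_integral_coord_swap[of "\<lambda>z. F (fst z) * \<rho> (snd z)" j] by simp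
  also have "\<dots> = (\<integral>\<^sup>+x. F x \<partial>lborel)"
    using assms by (simp add: nn_integral_cmult)
  finally show ?thesis .
qed

lemma integral_slices:
  fixes F :: "real ^ 'n::finite \<Rightarrow> real"
  assumes F: "integrable lborel F"
  shows "AE x in lborel. integrable lborel (\<lambda>t. F (upd j x t))"
    "(\<integral>x. (\<integral>t. F (upd j x t) \<partial>lborel) * std_normal_density (x $ j) \<partial>lborel) = (\<integral>x. F x \<partial>lborel)"
proof -
  define H where "H z = F (fst z) * std_normal_density (snd z)" for z :: "(real ^ 'n) \<times> real"
  have int: "integrable (lborel \<Otimes>\<^sub>M lborel) H" "(\<integral>z. H z \<partial>(lborel \<Otimes>\<^sub>M lborel)) = (\<integral>x. F x \<partial>lborel)"
    unfolding H_def using integrable_pair_mult[OF F, of std_normal_density] by simp_all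
  note sw = integral_coord_swap[OF int(1), of j]
  have sw': "(\<lambda>z. H (coord_swap j z)) = (\<lambda>(x, t). F (upd j x t) * std_normal_density (x $ j))"
    by (auto simp: H_def coord_swap_def)
  have i: "integrable (lborel \<Otimes>\<^sub>M lborel) (\<lambda>(x, t). F (upd j x t) * std_normal_density (x $ j))"
    using sw(1) unfolding sw' .
  have "AE x in lborel. integrable lborel (\<lambda>t. F (upd j x t) * std_normal_density (x $ j))"
    using lborel_pair.AE_integrable_fst[OF i] .
  then show "AE x in lborel. integrable lborel (\<lambda>t. F (upd j x t))"
  proof eventually_elim
    case (elim x)
    then have "integrable lborel (\<lambda>t. F (upd j x t) * std_normal_density (x $ j) / std_normal_density (x $ j))"
      by (rule integrable_divide)
    \<comment> \<open>Any probability density serves for the integrals; strict positivity is needed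
      to divide the weight out again and retain integrability along the line.\<close>
    moreover have "std_normal_density (x $ j) \<noteq> 0"
      using normal_density_pos[of 1 0 "x $ j"] by simp
    ultimately show ?case by simp
  qed
  show "(\<integral>x. (\<integral>t. F (upd j x t) \<partial>lborel) * std_normal_density (x $ j) \<partial>lborel) = (\<integral>x. F x \<partial>lborel)"
    using lborel_pair.integral_fst[OF i] sw(2) int(2) unfolding sw' by simp
qed

section \<open>Products of one-variable test functions\<close>

definition tensor :: "('n::finite \<Rightarrow> nat \<Rightarrow> real \<Rightarrow> real) \<Rightarrow> ('n \<Rightarrow> nat) \<Rightarrow> real ^ 'n \<Rightarrow> real" where
  "tensor \<Psi> k x = (\<Prod>i\<in>UNIV. \<Psi> i (k i) (x $ i))"

lemma continuous_tensor:
  assumes "\<And>i. test_derivs (\<Psi> i)"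
  shows "continuous_on UNIV (tensor \<Psi> k)"
  unfolding tensor_def
  by (intro continuous_on_prod continuous_on_compose2[OF test_derivs_continuous[OF assms]] continuous_intros) auto

lemma tensor_support:
  fixes \<Psi> :: "'n::finite \<Rightarrow> nat \<Rightarrow> real \<Rightarrow> real"
  assumes "\<And>i. test_derivs (\<Psi> i)"
  shows "\<exists>R. \<forall>k x. x \<notin> cbox (\<chi> i. - R) (\<chi> i. R) \<longrightarrow> tensor \<Psi> k x = 0"
proof -
  have "\<forall>i. \<exists>R. \<forall>n t. R < \<bar>t\<bar> \<longrightarrow> \<Psi> i n t = 0" using assms by (simp add: test_derivs_def)
  then obtain R where R: "\<And>i n t. R i < \<bar>t\<bar> \<Longrightarrow> \<Psi> i n t = 0" by metis
  define M where "M = Max (range R)"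
  have "tensor \<Psi> k x = 0" if "x \<notin> cbox (\<chi> i. - M) (\<chi> i. M)" for k x
  proof -
    have "\<not> (\<forall>i. - M \<le> x $ i \<and> x $ i \<le> M)"
      using that by (simp add: mem_box_cart)
    then obtain i where i: "\<not> (- M \<le> x $ i \<and> x $ i \<le> M)" by blast
    have "R i \<le> M" by (simp add: M_def)
    then have "\<Psi> i (k i) (x $ i) = 0" using i by (intro R) auto
    then show ?thesis unfolding tensor_def by (intro prod_zero) auto
  qed
  then show ?thesis by blast
qed

lemma test_function_tensor:
  fixes \<Psi> :: "'n::finite \<Rightarrow> nat \<Rightarrow> real \<Rightarrow> real"
  assumes T: "\<And>i. test_derivs (\<Psi> i)"
  shows "test_function (tensor \<Psi> (\<lambda>_. 0)) (tensor \<Psi>)"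
  unfolding test_function_def cont_partials_def
proof (intro conjI allI impI ballI)
  obtain R where R: "\<And>k x. x \<notin> cbox (\<chi> i. - R) (\<chi> i. R) \<Longrightarrow> tensor \<Psi> k x = 0"
    using tensor_support[of \<Psi>] T by blast
  then have "{x. tensor \<Psi> (\<lambda>_. 0) x \<noteq> 0} \<subseteq> cbox (\<chi> i. - R) (\<chi> i. R)" by blast
  then have "bounded {x. tensor \<Psi> (\<lambda>_. 0) x \<noteq> 0}" using bounded_cbox bounded_subset by blast
  then show "compact (closure {x. tensor \<Psi> (\<lambda>_. 0) x \<noteq> 0})" by (simp add: compact_closure)
  show "continuous_on UNIV (tensor \<Psi> k)" for k by (rule continuous_tensor[OF T])
  fix k :: "'n \<Rightarrow> nat" and i :: 'n and x :: "real ^ 'n"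
  define C where "C = (\<Prod>l\<in>UNIV - {i}. \<Psi> l (k l) (x $ l))"
  have eq1: "tensor \<Psi> k (x + t *\<^sub>R axis i 1) = \<Psi> i (k i) (x $ i + t) * C" for t
    unfolding tensor_def C_def by (subst prod.remove[of _ i]) (auto intro!: prod.cong simp: axis_def)
  have eq2: "tensor \<Psi> (k(i := Suc (k i))) x = \<Psi> i (Suc (k i)) (x $ i) * C"
    unfolding tensor_def C_def by (subst prod.remove[of _ i]) (auto intro!: prod.cong)
  have "((\<lambda>t. \<Psi> i (k i) (x $ i + t)) has_real_derivative \<Psi> i (Suc (k i)) (x $ i)) (at 0)"
    using T[of i] DERIV_shift[of "\<Psi> i (k i)" "\<Psi> i (Suc (k i)) (x $ i)" 0 "x $ i"]
    by (simp add: test_derivs_def add.commute)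
  then show "((\<lambda>t. tensor \<Psi> k (x + t *\<^sub>R axis i 1)) has_real_derivative tensor \<Psi> (k(i := Suc (k i))) x)
     (at 0 within {t. x + t *\<^sub>R axis i 1 \<in> UNIV})"
    unfolding eq1 eq2 by (simp add: DERIV_cmult_right)
qed simp

lemma indicator_box_cart:
  fixes a b x :: "real ^ 'n::finite"
  shows "indicator (box a b) x = (\<Prod>i\<in>UNIV. indicator {a $ i<..<b $ i} (x $ i) :: real)"
proof (cases "x \<in> box a b")
  case True
  then show ?thesis by (auto simp: mem_box_cart intro!: prod.neutral[symmetric])
next
  case False
  then obtain i where "x $ i \<notin> {a $ i<..<b $ i}" by (auto simp: mem_box_cart)
  then have "(\<Prod>i\<in>UNIV. indicator {a $ i<..<b $ i} (x $ i) :: real) = 0"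
    by (intro prod_zero bexI[of _ i]) auto
  then show ?thesis using False by simp
qed

text \<open>Products of bumps are dominated by and converge to the indicator of a box, so the
  integrals of \<open>q\<close> over boxes vanish.\<close>

lemma AE_zero_if_tensor_bumps:
  fixes q :: "real ^ 'n::finite \<Rightarrow> real"
  assumes [measurable]: "q \<in> borel_measurable borel"
    and int: "\<And>a b. set_integrable lborel (box a b) q"
    and zero: "\<And>a b k. (\<integral>x. q x * tensor (\<lambda>i. bump (a $ i) (b $ i) k) (\<lambda>_. 0) x \<partial>lborel) = 0"
  shows "AE x in lborel. q x = 0"
proof (rule AE_zero_if_box_integrals_zero)
  fix a b :: "real ^ 'n"
  let ?T = "\<lambda>k. tensor (\<lambda>i. bump (a $ i) (b $ i) k) (\<lambda>_. 0)"
  note ind = indicator_box_cart[of a b]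
  have "(\<lambda>k. \<integral>x. q x * ?T k x \<partial>lborel) \<longlonglongrightarrow> (\<integral>x. q x * indicator (box a b) x \<partial>lborel)"
  proof (rule integral_dominated_convergence[where w = "\<lambda>x. \<bar>q x * indicator (box a b) x\<bar>"])
    show "integrable lborel (\<lambda>x. \<bar>q x * indicator (box a b) x\<bar>)"
      using int[of a b] by (simp add: set_integrable_def mult.commute)
    have "?T k \<in> borel_measurable borel" for k
      by (rule borel_measurable_continuous_onI[OF continuous_tensor[OF test_derivs_bump]])
    then show "(\<lambda>x. q x * ?T k x) \<in> borel_measurable lborel" for k by simp
    show "AE x in lborel. (\<lambda>k. q x * ?T k x) \<longlonglongrightarrow> q x * indicator (box a b) x"
      unfolding ind tensor_def by (intro AE_I2 tendsto_mult tendsto_const tendsto_prod bump_tendsto)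
    show "AE x in lborel. norm (q x * ?T k x) \<le> \<bar>q x * indicator (box a b) x\<bar>" for k
    proof (rule AE_I2)
      fix x
      have "0 \<le> ?T k x" "?T k x \<le> indicator (box a b) x"
        unfolding ind tensor_def by (auto intro!: prod_nonneg prod_mono bump_nonneg bump_le_indicator)
      then show "norm (q x * ?T k x) \<le> \<bar>q x * indicator (box a b) x\<bar>"
        by (simp add: abs_mult mult_left_mono)
    qed
  qed simp
  then have "(\<integral>x. q x * indicator (box a b) x \<partial>lborel) = 0"
    by (simp add: LIMSEQ_const_iff zero)
  then show "(LINT x:box a b|lborel. q x) = 0" by (simp add: set_lebesgue_integral_def mult.commute)
qed (use int in auto)

section \<open>Weak derivatives on slices\<close>

lemma measurable_vec_nth [measurable]: "(\<lambda>x :: real ^ 'n::finite. x $ j) \<in> borel_measurable borel"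
  by (intro borel_measurable_continuous_onI continuous_intros)

lemma integrable_mult_tensor:
  fixes f :: "real ^ 'n::finite \<Rightarrow> real"
  assumes f: "\<And>a b. set_integrable lborel (cbox a b) f" and T: "\<And>i. test_derivs (\<Psi> i)"
  shows "integrable lborel (\<lambda>x. f x * tensor \<Psi> k x)"
proof -
  obtain R where "\<And>k x. x \<notin> cbox (\<chi> i. - R) (\<chi> i. R) \<Longrightarrow> tensor \<Psi> k x = 0"
    using tensor_support[of \<Psi>] T by blast
  then show ?thesis
    by (intro integrable_mult_compact_support[OF f continuous_tensor[OF T]])
qed

text \<open>The exceptional set of lines must not depend on the interval. It is collected over a
  countable exhaustion by cubes; on a given line, every bounded interval lies in one of
  them.\<close>

lemma AE_slices_set_integrable:
  fixes f :: "real ^ 'n::finite \<Rightarrow> real"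
  assumes f: "\<And>a b. set_integrable lborel (cbox a b) f"
  shows "AE x in lborel. \<forall>a b. set_integrable lborel {a..b} (\<lambda>t. f (upd j x t))"
proof -
  define C :: "nat \<Rightarrow> (real ^ 'n) set" where "C n = cbox (\<chi> i. - real n) (\<chi> i. real n)" for n
  have "AE x in lborel. \<forall>n. integrable lborel (\<lambda>t. indicator (C n) (upd j x t) * f (upd j x t))"
    unfolding AE_all_countable
  proof
    fix n
    have "integrable lborel (\<lambda>x. indicator (C n) x * f x)"
      using f by (simp add: C_def set_integrable_def)
    from integral_slices(1)[OF this, of j]
    show "AE x in lborel. integrable lborel (\<lambda>t. indicator (C n) (upd j x t) * f (upd j x t))" .
  qed
  then show ?thesis
  proof (rule eventually_mono, intro allI)
    fix x a b
    assume *: "\<forall>n. integrable lborel (\<lambda>t. indicator (C n) (upd j x t) * f (upd j x t))"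
    obtain n where n: "max (norm x) (max \<bar>a\<bar> \<bar>b\<bar>) \<le> real n" using real_arch_simple by blast
    have mem: "upd j x t \<in> C n" if "t \<in> {a..b}" for t
    proof -
      have "\<bar>upd j x t $ i\<bar> \<le> real n" for i
        using component_le_norm_cart[of x i] n that by (auto simp: upd_nth)
      then show ?thesis by (simp add: C_def mem_box_cart abs_le_iff minus_le_iff)
    qed
    have "integrable lborel (\<lambda>t. indicator {a..b} t *\<^sub>R (indicator (C n) (upd j x t) * f (upd j x t)))"
      using * by (intro integrable_mult_indicator) auto
    moreover have "(\<lambda>t. indicator {a..b} t *\<^sub>R (indicator (C n) (upd j x t) * f (upd j x t)))
        = (\<lambda>t. indicator {a..b} t *\<^sub>R f (upd j x t))"
      using mem by (auto simp: indicator_def)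
    ultimately show "set_integrable lborel {a..b} (\<lambda>t. f (upd j x t))"
      by (simp only: set_integrable_def)
  qed
qed

lemma test_derivs_bounded:
  assumes "test_derivs \<Psi>"
  obtains B R where "\<And>t. \<bar>\<Psi> n t\<bar> \<le> B" "\<And>t. t \<notin> {- R..R} \<Longrightarrow> \<Psi> n t = 0" "B \<ge> 0"
proof -
  obtain R where R: "\<And>n t. R < \<bar>t\<bar> \<Longrightarrow> \<Psi> n t = 0" using assms unfolding test_derivs_def by blast
  have "bounded (\<Psi> n ` {- R..R})"
    by (intro compact_imp_bounded compact_continuous_image continuous_on_subset[OF test_derivs_continuous[OF assms]] compact_Icc) auto
  then obtain B where B: "\<And>t. t \<in> {- R..R} \<Longrightarrow> \<bar>\<Psi> n t\<bar> \<le> B"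
    unfolding bounded_iff by (metis image_eqI real_norm_def)
  have out: "\<Psi> n t = 0" if "t \<notin> {- R..R}" for t
    using that by (intro R) auto
  have "\<bar>\<Psi> n t\<bar> \<le> max 0 B" for t
    using B[of t] out[of t] by (cases "t \<in> {- R..R}") auto
  then show ?thesis using out by (intro that[of "max 0 B" R]) auto
qed

text \<open>The form in which weak differentiability is used on lines: Borel representatives, so
  that Fubini applies, a pure derivative in direction \<open>j\<close>, and test functions with
  separated variables.\<close>

definition tensor_weak_deriv :: "'n::finite \<Rightarrow> nat \<Rightarrow> (real ^ 'n \<Rightarrow> real) \<Rightarrow> (real ^ 'n \<Rightarrow> real) \<Rightarrow> bool" where
  "tensor_weak_deriv j N f v \<longleftrightarrow> f \<in> borel_measurable borel \<and> v \<in> borel_measurable borel \<and>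
     (\<forall>a b. set_integrable lborel (cbox a b) f) \<and> (\<forall>a b. set_integrable lborel (cbox a b) v) \<and>
     (\<forall>\<Psi>. (\<forall>i. test_derivs (\<Psi> i)) \<longrightarrow>
      (\<integral>x. f x * tensor \<Psi> ((\<lambda>_. 0)(j := N)) x \<partial>lborel) = (- 1) ^ N * (\<integral>x. v x * tensor \<Psi> (\<lambda>_. 0) x \<partial>lborel))"

lemma tensor_weak_derivD:
  assumes "tensor_weak_deriv j N f v"
  shows "f \<in> borel_measurable borel" "v \<in> borel_measurable borel"
    and "set_integrable lborel (cbox a b) f" "set_integrable lborel (cbox a b) v"
    and "(\<And>i. test_derivs (\<Psi> i)) \<Longrightarrow>
      (\<integral>x. f x * tensor \<Psi> ((\<lambda>_. 0)(j := N)) x \<partial>lborel) = (- 1) ^ N * (\<integral>x. v x * tensor \<Psi> (\<lambda>_. 0) x \<partial>lborel)"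
  using assms by (auto simp: tensor_weak_deriv_def)

text \<open>The defect \<open>G x\<close> of the one-dimensional identity is an integral along the
  line through \<open>x\<close>. To see that it vanishes almost everywhere, it is tested against
  products of bumps. The factor in coordinate \<open>j\<close> splits off by the exchange of
  coordinates, and what remains is the weak identity in the whole space, tested with
  \<open>\<psi>\<close> in coordinate \<open>j\<close> and bumps in the others.\<close>

lemma AE_slices_weak:
  fixes f v :: "real ^ 'n::finite \<Rightarrow> real"
  assumes W: "tensor_weak_deriv j N f v"
    and \<psi>: "test_derivs \<psi>"
  shows "AE x in lborel. (\<integral>t. f (upd j x t) * \<psi> N t \<partial>lborel) = (- 1) ^ N * (\<integral>t. v (upd j x t) * \<psi> 0 t \<partial>lborel)"
proof -
  note [measurable] = tensor_weak_derivD(1,2)[OF W]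
  note f = tensor_weak_derivD(3)[OF W] and v = tensor_weak_derivD(4)[OF W] and weak = tensor_weak_derivD(5)[OF W]
  have [measurable]: "\<psi> n \<in> borel_measurable borel" for n
    by (rule borel_measurable_continuous_onI[OF test_derivs_continuous[OF \<psi>]])
  define q where "q y = f y * \<psi> N (y $ j) - (- 1) ^ N * (v y * \<psi> 0 (y $ j))" for y
  define G where "G x = (\<integral>t. q (upd j x t) \<partial>lborel)" for x
  have [measurable]: "q \<in> borel_measurable borel" unfolding q_def[abs_def] by measurable
  have Gm: "G \<in> borel_measurable borel"
    unfolding G_def[abs_def] by measurable
  let ?P = "\<lambda>c y. \<Prod>i\<in>UNIV - {j}. c i (y $ i)" and ?Q = "\<lambda>c y. \<Prod>i\<in>UNIV. c i (y $ i)"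
  have prod: "integrable lborel (\<lambda>y. g y * (\<psi> n (y $ j) * ?P c y))"
    if g: "\<And>a b. set_integrable lborel (cbox a b) g"
      and c [measurable]: "\<And>i. c i \<in> borel_measurable borel"
      and c01: "\<And>i t. 0 \<le> c i t \<and> c i t \<le> indicator {a $ i<..<b $ i} t" for g n a b and c :: "'n \<Rightarrow> real \<Rightarrow> real"
  proof -
    obtain B R where B: "\<And>t. \<bar>\<psi> n t\<bar> \<le> B" and R: "\<And>t. t \<notin> {- R..R} \<Longrightarrow> \<psi> n t = 0" and "B \<ge> 0"
      using test_derivs_bounded[OF \<psi>, of n] by blast
    have P01: "0 \<le> ?P c y" "?P c y \<le> 1" for y
    proof -
      have "c i t \<le> 1" for i t using c01[of i t] indicator_le_1 order_trans by blast
      then show "0 \<le> ?P c y" "?P c y \<le> 1" using c01 by (auto intro!: prod_nonneg prod_le_1)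
    qed
    show ?thesis
    proof (rule integrable_mult_bounded_support[OF g[of "upd j a (- R)" "upd j b R"], where B = B])
      show "(\<lambda>y. \<psi> n (y $ j) * ?P c y) \<in> borel_measurable borel" by measurable
      fix y
      show "\<psi> n (y $ j) * ?P c y = 0" if "y \<notin> cbox (upd j a (- R)) (upd j b R)"
      proof -
        have "\<not> (\<forall>i. upd j a (- R) $ i \<le> y $ i \<and> y $ i \<le> upd j b R $ i)"
          using that by (simp add: mem_box_cart)
        then obtain i where i: "\<not> (upd j a (- R) $ i \<le> y $ i \<and> y $ i \<le> upd j b R $ i)" by blast
        show ?thesis
        proof (cases "i = j")
          case True
          then show ?thesis using R[of "y $ j"] i by (auto simp: upd_nth)
        next
          case False
          then have "c i (y $ i) = 0" using c01[of i "y $ i"] i by (auto simp: upd_nth indicator_def split: if_splits)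
          then have "?P c y = 0" using False by (intro prod_zero bexI[of _ i]) auto
          then show ?thesis by simp
        qed
      qed
      have "\<bar>\<psi> n (y $ j)\<bar> * ?P c y \<le> B * 1"
        using B P01 \<open>B \<ge> 0\<close> by (intro mult_mono) auto
      then show "\<bar>\<psi> n (y $ j) * ?P c y\<bar> \<le> B" using P01[of y] by (simp add: abs_mult)
    qed
  qed
  \<comment> \<open>The factors are kept general because two choices are needed: indicators, to get
    integrability of \<open>G\<close> on boxes, and bumps, to get its vanishing.\<close>
  have main: "integrable lborel (\<lambda>x. G x * ?Q c x)"
    "(\<integral>x. G x * ?Q c x \<partial>lborel) = (\<integral>y. q y * ?P c y \<partial>lborel) * (\<integral>t. c j t \<partial>lborel)"
    if c [measurable]: "\<And>i. c i \<in> borel_measurable borel"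
      and c01: "\<And>i t. 0 \<le> c i t \<and> c i t \<le> indicator {a $ i<..<b $ i} t" for a b and c :: "'n \<Rightarrow> real \<Rightarrow> real"
  proof -
    have "integrable lborel (\<lambda>y. f y * (\<psi> N (y $ j) * ?P c y) - (- 1) ^ N * (v y * (\<psi> 0 (y $ j) * ?P c y)))"
      by (intro Bochner_Integration.integrable_diff integrable_mult_right prod[OF _ c c01] f v)
    then have iq: "integrable lborel (\<lambda>y. q y * ?P c y)"
      by (simp add: q_def algebra_simps)
    have ic: "integrable lborel (c j)"
    proof (rule Bochner_Integration.integrable_bound)
      show "integrable lborel (indicator {a $ j<..<b $ j} :: real \<Rightarrow> real)"
        by (cases "a $ j \<le> b $ j") auto
      show "AE t in lborel. norm (c j t) \<le> norm (indicator {a $ j<..<b $ j} t :: real)"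
        using c01[of j] by (intro AE_I2) auto
    qed simp
    note pm = integrable_pair_mult[OF iq ic]
    note sw = integral_coord_swap[OF pm(1), of j]
    have eq: "(\<lambda>z. q (fst (coord_swap j z)) * ?P c (fst (coord_swap j z)) * c j (snd (coord_swap j z)))
      = (\<lambda>(x, t). q (upd j x t) * ?Q c x)"
    proof (rule ext)
      fix z :: "(real ^ 'n) \<times> real"
      have "(\<Prod>i\<in>UNIV - {j}. c i (upd j (fst z) (snd z) $ i)) = (\<Prod>i\<in>UNIV - {j}. c i (fst z $ i))"
        by (intro prod.cong) (auto simp: upd_nth)
      moreover have "(\<Prod>i\<in>UNIV. c i (fst z $ i)) = c j (fst z $ j) * (\<Prod>i\<in>UNIV - {j}. c i (fst z $ i))"
        by (rule prod.remove) auto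
      ultimately show "q (fst (coord_swap j z)) * ?P c (fst (coord_swap j z)) * c j (snd (coord_swap j z))
        = (case z of (x, t) \<Rightarrow> q (upd j x t) * ?Q c x)"
        by (simp add: coord_swap_def case_prod_beta' mult_ac)
    qed
    have Geq: "(\<integral>t. q (upd j x t) * ?Q c x \<partial>lborel) = G x * ?Q c x" for x
      by (simp add: G_def)
    note i = sw(1)[unfolded eq]
    show "integrable lborel (\<lambda>x. G x * ?Q c x)"
      using lborel_pair.integrable_fst[OF i] by (simp only: Geq)
    show "(\<integral>x. G x * ?Q c x \<partial>lborel) = (\<integral>y. q y * ?P c y \<partial>lborel) * (\<integral>t. c j t \<partial>lborel)"
      using lborel_pair.integral_fst[OF i] sw(2) pm(2) by (simp only: Geq eq)
  qed
  have "AE x in lborel. G x = 0"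
  proof (rule AE_zero_if_tensor_bumps[OF Gm])
    fix a b :: "real ^ 'n"
    have "indicator (box a b) x = (\<Prod>i\<in>UNIV. indicator {a $ i<..<b $ i} (x $ i) :: real)" for x
      by (rule indicator_box_cart)
    moreover have "integrable lborel (\<lambda>x. G x * (\<Prod>i\<in>UNIV. indicator {a $ i<..<b $ i} (x $ i)))"
      by (rule main(1)[of _ a b]) auto
    ultimately show "set_integrable lborel (box a b) G"
      by (simp add: set_integrable_def mult.commute)
    fix k
    define \<Psi> where "\<Psi> i = (if i = j then \<psi> else bump (a $ i) (b $ i) k)" for i
    have T: "test_derivs (\<Psi> i)" for i using \<psi> test_derivs_bump by (simp add: \<Psi>_def)
    have bm: "bump \<alpha> \<beta> k 0 \<in> borel_measurable borel" for \<alpha> \<beta>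
      by (rule borel_measurable_continuous_onI[OF test_derivs_continuous[OF test_derivs_bump]])
    let ?c = "\<lambda>i. bump (a $ i) (b $ i) k 0"
    have tens: "tensor \<Psi> ((\<lambda>_. 0)(j := n)) y = \<psi> n (y $ j) * ?P ?c y" for n y
      unfolding tensor_def by (subst prod.remove[of _ j]) (auto simp: \<Psi>_def intro!: prod.cong)
    have tens0: "tensor \<Psi> (\<lambda>_. 0) y = \<psi> 0 (y $ j) * ?P ?c y" for y
      using tens[of 0 y] by (simp add: fun_upd_idem)
    have "(\<integral>y. q y * ?P ?c y \<partial>lborel)
       = (\<integral>y. f y * tensor \<Psi> ((\<lambda>_. 0)(j := N)) y - (- 1) ^ N * (v y * tensor \<Psi> (\<lambda>_. 0) y) \<partial>lborel)"
      by (rule Bochner_Integration.integral_cong) (auto simp: tens tens0 q_def algebra_simps)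
    also have "\<dots> = 0"
      using integrable_mult_tensor[OF f T] integrable_mult_tensor[OF v T] weak[OF T] by simp
    finally have "(\<integral>y. q y * ?P ?c y \<partial>lborel) = 0" .
    then show "(\<integral>x. G x * tensor (\<lambda>i. bump (a $ i) (b $ i) k) (\<lambda>_. 0) x \<partial>lborel) = 0"
      unfolding tensor_def using main(2)[of ?c a b, OF bm] bump_nonneg bump_le_indicator by simp
  qed
  then show ?thesis
    using AE_slices_set_integrable[OF f, of j] AE_slices_set_integrable[OF v, of j]
  proof eventually_elim
    case (elim x)
    have "integrable lborel (\<lambda>t. f (upd j x t) * \<psi> N t)" "integrable lborel (\<lambda>t. v (upd j x t) * \<psi> 0 t)"
      using elim by (auto intro!: integrable_mult_test \<psi>)
    then show ?case using elim(1) by (simp add: G_def q_def upd_nth)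
  qed
qed

section \<open>A jointly measurable derivative in one direction\<close>

text \<open>Averages over shrinking segments recover the continuous representative on each line by a formula
  that is measurable in all variables.\<close>

definition cont_rep :: "'n::finite \<Rightarrow> (real ^ 'n \<Rightarrow> real) \<Rightarrow> real ^ 'n \<Rightarrow> real" where
  "cont_rep j f y = lim (\<lambda>n. real (Suc n) * (\<integral>s. indicator {0..1 / real (Suc n)} s * f (y + s *\<^sub>R axis j 1) \<partial>lborel))"

text \<open>Forward difference quotients of the continuous representative along a countable sequence
  of steps, so Borel measurability in all variables is inherited from \<open>f\<close>. On lines
  without a smooth enough representative the value of \<open>lim\<close> is arbitrary; such lines
  form a null set.\<close>

definition dir_deriv :: "'n::finite \<Rightarrow> (real ^ 'n \<Rightarrow> real) \<Rightarrow> real ^ 'n \<Rightarrow> real" where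
  "dir_deriv j f y = lim (\<lambda>n. real (Suc n) * (cont_rep j f (y + (1 / real (Suc n)) *\<^sub>R axis j 1) - cont_rep j f y))"

lemma borel_measurable_dir_deriv [measurable]:
  assumes [measurable]: "f \<in> borel_measurable borel"
  shows "dir_deriv j f \<in> borel_measurable borel"
proof -
  have [measurable]: "cont_rep j f \<in> borel_measurable borel"
    unfolding cont_rep_def[abs_def] by measurable
  show ?thesis unfolding dir_deriv_def[abs_def] by measurable
qed

lemma LIMSEQ_difference_quotient:
  assumes "(G has_real_derivative g) (at t)"
  shows "(\<lambda>n. real (Suc n) * (G (t + 1 / real (Suc n)) - G t)) \<longlonglongrightarrow> g"
proof -
  have lim: "(\<lambda>h. (G (t + h) - G t) / h) \<midarrow>0\<rightarrow> g" using assms by (simp add: DERIV_def)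
  have "filterlim (\<lambda>n. 1 / real (Suc n)) (at 0) sequentially"
    unfolding filterlim_at using LIMSEQ_inverse_real_of_nat by (auto simp: inverse_eq_divide)
  from filterlim_compose[OF lim this] show ?thesis by (simp add: mult.commute)
qed

lemma dir_deriv_slice:
  assumes w: "abs_cont_deriv w0 w1" and cw: "continuous_on UNIV w1"
    and f: "AE t in lborel. f (upd j x t) = w0 t"
    and [measurable]: "f \<in> borel_measurable borel"
  shows "dir_deriv j f (upd j x t) = w1 t"
proof -
  note c0 = abs_cont_deriv_continuous[OF w]
  have [measurable]: "w0 \<in> borel_measurable borel" by (rule borel_measurable_continuous_onI[OF c0])
  \<comment> \<open>The averages in \<open>cont_rep\<close> are difference quotients of an
    antiderivative \<open>W\<close> of \<open>w0\<close>, and \<open>W\<close> is differentiable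
    everywhere because \<open>w0\<close> is continuous. Only the integrals of \<open>f\<close>
    enter, so its values on null sets do not matter.\<close>
  obtain W where W: "abs_cont_deriv W w0"
    using abs_cont_deriv_exists[of w0] borel_integrable_atLeastAtMost'[of _ _ w0] continuous_on_subset[OF c0] by blast
  have rep: "cont_rep j f (upd j x t) = w0 t" for t
  proof -
    have "(\<integral>s. indicator {0..1 / real (Suc n)} s * f (upd j x t + s *\<^sub>R axis j 1) \<partial>lborel)
      = W (t + 1 / real (Suc n)) - W t" for n
    proof -
      have "(\<integral>s. indicator {0..1 / real (Suc n)} s * f (upd j x t + s *\<^sub>R axis j 1) \<partial>lborel)
        = (\<integral>s. indicator {t..t + 1 / real (Suc n)} (t + 1 * s) * f (upd j x (t + 1 * s)) \<partial>lborel)"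
        by (rule Bochner_Integration.integral_cong) (auto simp: upd_add indicator_def)
      also have "\<dots> = (\<integral>s. indicator {t..t + 1 / real (Suc n)} s * f (upd j x s) \<partial>lborel)"
        using lborel_integral_real_affine[of 1 "\<lambda>s. indicator {t..t + 1 / real (Suc n)} s * f (upd j x s)" t] by simp
      also have "\<dots> = (LINT s:{t..t + 1 / real (Suc n)}|lborel. w0 s)"
        unfolding set_lebesgue_integral_def
        by (rule integral_cong_AE) (use f in \<open>auto elim!: eventually_mono\<close>)
      also have "\<dots> = W (t + 1 / real (Suc n)) - W t"
        by (rule abs_cont_derivD(2)[OF W, symmetric]) simp
      finally show ?thesis .
    qed
    then show ?thesis
      unfolding cont_rep_def
      using LIMSEQ_difference_quotient[OF abs_cont_deriv_has_derivative[OF W c0, of t]] by (simp add: limI)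
  qed
  show ?thesis
    unfolding dir_deriv_def upd_add rep
    by (rule limI, rule LIMSEQ_difference_quotient[OF abs_cont_deriv_has_derivative[OF w cw]])
qed

lemma countable_bump_antiderivs: "countable ((bump_antideriv ^^ N) ` rational_bumps)"
  unfolding rational_bumps_def by (intro countable_image countable_SIGMA countable_rat) auto

text \<open>Countability of the test family yields one null set of lines for all tests. Since N
  \<ge> 2, the function \<open>w 1\<close> has an absolutely continuous version built in: it is
  itself an antiderivative of \<open>w 2\<close>, hence continuous, and \<open>dir_deriv\<close>
  equals it at every point of the line.\<close>

lemma AE_slices_representation:
  fixes f v :: "real ^ 'n::finite \<Rightarrow> real"
  assumes W: "tensor_weak_deriv j N f v"
    and N: "N \<ge> 2"
  shows "AE x in lborel. \<exists>w. w N = (\<lambda>t. v (upd j x t)) \<and> w 1 = (\<lambda>t. dir_deriv j f (upd j x t)) \<and>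
     (\<forall>n<N. abs_cont_deriv (w n) (w (Suc n))) \<and> (AE t in lborel. f (upd j x t) = w 0 t)"
proof -
  note [measurable] = tensor_weak_derivD(1,2)[OF W]
  note f = tensor_weak_derivD(3)[OF W] and v = tensor_weak_derivD(4)[OF W] and weak = tensor_weak_derivD(5)[OF W]
  have "AE x in lborel. \<forall>\<psi>\<in>(bump_antideriv ^^ N) ` rational_bumps.
      (\<integral>t. f (upd j x t) * \<psi> N t \<partial>lborel) = (- 1) ^ N * (\<integral>t. v (upd j x t) * \<psi> 0 t \<partial>lborel)"
    unfolding AE_ball_countable[OF countable_bump_antiderivs]
  proof
    fix \<psi> assume "\<psi> \<in> (bump_antideriv ^^ N) ` rational_bumps"
    then have "test_derivs \<psi>" by (rule test_derivs_bump_antiderivs)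
    then show "AE x in lborel. (\<integral>t. f (upd j x t) * \<psi> N t \<partial>lborel) = (- 1) ^ N * (\<integral>t. v (upd j x t) * \<psi> 0 t \<partial>lborel)"
      by (rule AE_slices_weak[OF W])
  qed
  then show ?thesis
    using AE_slices_set_integrable[OF f, of j] AE_slices_set_integrable[OF v, of j]
  proof eventually_elim
    case (elim x)
    have "\<exists>w. w N = (\<lambda>t. v (upd j x t)) \<and> (\<forall>n<N. abs_cont_deriv (w n) (w (Suc n))) \<and> (AE t in lborel. f (upd j x t) = w 0 t)"
      by (rule weak_derivative_representation) (use elim in auto)
    then obtain w where w: "w N = (\<lambda>t. v (upd j x t))" "\<And>n. n < N \<Longrightarrow> abs_cont_deriv (w n) (w (Suc n))"
      "AE t in lborel. f (upd j x t) = w 0 t" by blast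
    have "continuous_on UNIV (w (Suc 0))"
      by (rule abs_cont_deriv_continuous[OF w(2)]) (use N in simp)
    then have "dir_deriv j f (upd j x t) = w (Suc 0) t" for t
      using w(2)[of 0] N w(3) by (intro dir_deriv_slice) auto
    then show ?case using w by (intro exI[of _ w]) auto
  qed
qed

section \<open>Gaussian mixtures\<close>

definition gauss :: "real ^ 'n::finite \<Rightarrow> real \<Rightarrow> real ^ 'n \<Rightarrow> real" where
  "gauss m \<sigma> y = (\<Prod>i\<in>UNIV. normal_density (m $ i) \<sigma> (y $ i))"

lemma gauss_nonneg [simp]: "0 \<le> gauss m \<sigma> y"
  by (simp add: gauss_def prod_nonneg)

lemma measurable_gauss [measurable]:
  assumes [measurable]: "f \<in> borel_measurable M" "g \<in> borel_measurable M"
  shows "(\<lambda>x. gauss (f x) \<sigma> (g x)) \<in> borel_measurable M"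
proof -
  have [measurable]: "(\<lambda>x. f x $ i) \<in> borel_measurable M" "(\<lambda>x. g x $ i) \<in> borel_measurable M" for i
    using measurable_compose[OF assms(1) measurable_vec_nth] measurable_compose[OF assms(2) measurable_vec_nth] by auto
  show ?thesis unfolding gauss_def normal_density_def by measurable
qed

lemma gauss_affine:
  fixes m z :: "real ^ 'n::finite"
  assumes "\<sigma> > 0"
  shows "gauss m \<sigma> (m + \<sigma> *\<^sub>R z) * \<sigma> ^ CARD('n) = (\<Prod>i\<in>UNIV. std_normal_density (z $ i))"
proof -
  have "normal_density (m $ i) \<sigma> ((m + \<sigma> *\<^sub>R z) $ i) * \<sigma> = std_normal_density (z $ i)" for i
    using assms by (simp add: normal_density_def real_sqrt_mult power_mult_distrib)
  then have "(\<Prod>i\<in>UNIV. normal_density (m $ i) \<sigma> ((m + \<sigma> *\<^sub>R z) $ i) * \<sigma>) = (\<Prod>i\<in>UNIV. std_normal_density (z $ i))"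
    by (rule prod.cong[OF refl])
  then show ?thesis by (simp add: gauss_def prod.distrib)
qed

lemma nn_integral_gauss_affine:
  fixes m :: "real ^ 'n::finite"
  assumes \<sigma>: "\<sigma> > 0" and [measurable]: "F \<in> borel_measurable borel"
  shows "(\<integral>\<^sup>+z. F (m + \<sigma> *\<^sub>R z) * ennreal (\<Prod>i\<in>UNIV. std_normal_density (z $ i)) \<partial>lborel)
    = (\<integral>\<^sup>+y. F y * ennreal (gauss m \<sigma> y) \<partial>lborel)"
proof -
  have "lborel = density (distr lborel borel (\<lambda>z. m + \<sigma> *\<^sub>R z)) (\<lambda>_. \<bar>\<sigma>\<bar> ^ CARD('n))"
    using lborel_affine[of \<sigma> m] \<sigma> by simp
  then have "(\<integral>\<^sup>+y. F y * ennreal (gauss m \<sigma> y) \<partial>lborel)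
      = (\<integral>\<^sup>+y. F y * ennreal (gauss m \<sigma> y) \<partial>density (distr lborel borel (\<lambda>z. m + \<sigma> *\<^sub>R z)) (\<lambda>_. \<bar>\<sigma>\<bar> ^ CARD('n)))"
    by metis
  also have "\<dots> = (\<integral>\<^sup>+z. ennreal (\<sigma> ^ CARD('n)) * (F (m + \<sigma> *\<^sub>R z) * ennreal (gauss m \<sigma> (m + \<sigma> *\<^sub>R z))) \<partial>lborel)"
    using \<sigma> by (simp add: nn_integral_density nn_integral_distr ennreal_power)
  also have "\<dots> = (\<integral>\<^sup>+z. F (m + \<sigma> *\<^sub>R z) * ennreal (\<Prod>i\<in>UNIV. std_normal_density (z $ i)) \<partial>lborel)"
  proof (rule nn_integral_cong)
    fix z :: "real ^ 'n"
    show "ennreal (\<sigma> ^ CARD('n)) * (F (m + \<sigma> *\<^sub>R z) * ennreal (gauss m \<sigma> (m + \<sigma> *\<^sub>R z)))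
      = F (m + \<sigma> *\<^sub>R z) * ennreal (\<Prod>i\<in>UNIV. std_normal_density (z $ i))"
      unfolding gauss_affine[OF \<sigma>, of m z, symmetric] using \<sigma> by (simp add: ennreal_mult mult_ac)
  qed
  finally show ?thesis by simp
qed

lemma unit_cube_measure: "emeasure lborel (cbox 0 1 :: (real ^ 'd::finite) set) = 1"
proof -
  have "(1 :: real ^ 'd) \<bullet> b = 1" if "b \<in> Basis" for b
    using that by (auto simp: Basis_vec_def inner_axis)
  then show ?thesis by (simp add: emeasure_lborel_cbox_eq)
qed

lemma gaussian_mixture:
  fixes g :: "real ^ 'd::finite \<Rightarrow> real ^ 'D::finite" and p :: "real ^ 'D \<Rightarrow> ennreal"
  assumes "prob_space M" and \<sigma>: "\<sigma> > 0"
    and U: "distributed M lborel U (\<lambda>u. indicator (cbox 0 1) u / emeasure lborel (cbox 0 1 :: (real ^ 'd) set))"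
    and \<xi>: "distributed M lborel \<xi> (\<lambda>z. ennreal (\<Prod>i\<in>UNIV. std_normal_density (z $ i)))"
    and indep: "indep_rvs M U \<xi>"
    and Y: "distributed M lborel (\<lambda>\<omega>. g (U \<omega>) + \<sigma> *\<^sub>R \<xi> \<omega>) p"
    and g: "continuous_on (cbox 0 1) g"
    and F [measurable]: "F \<in> borel_measurable borel"
  shows "(\<integral>\<^sup>+y. F y * p y \<partial>lborel)
    = (\<integral>\<^sup>+u. indicator (cbox 0 1) u *
        (\<integral>\<^sup>+y. F y * ennreal (gauss (indicator (cbox 0 1) u *\<^sub>R g u) \<sigma> y) \<partial>lborel) \<partial>lborel)"
proof -
  interpret prob_space M by fact
  let ?U = "distr M lborel U" and ?X = "distr M lborel \<xi>"
  let ?UX = "distr M (lborel \<Otimes>\<^sub>M lborel) (\<lambda>\<omega>. (U \<omega>, \<xi> \<omega>))"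
  \<comment> \<open>\<open>g\<close> is controlled only on the cube. Cutting the mean off to 0
    outside makes it Borel on the whole space and changes nothing almost surely, since
    \<open>U\<close> lies in the cube.\<close>
  define g' where "g' u = indicator (cbox 0 1) u *\<^sub>R g u" for u
  have g'm [measurable]: "g' \<in> borel_measurable borel"
    unfolding g'_def[abs_def] using g by (intro borel_measurable_continuous_on_indicator) auto
  have U': "distributed M lborel U (\<lambda>u. indicator (cbox 0 1) u)"
    using U by (simp add: unit_cube_measure divide_ennreal_def)
  note dU = distributed_distr_eq_density[OF U'] and d\<xi> = distributed_distr_eq_density[OF \<xi>]
  have UX [measurable]: "U \<in> M \<rightarrow>\<^sub>M lborel" "\<xi> \<in> M \<rightarrow>\<^sub>M lborel"
    using distributed_measurable[OF U] distributed_measurable[OF \<xi>] by auto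
  then have Um: "U \<in> borel_measurable M" by simp
  have [measurable]: "(\<lambda>z :: real ^ 'D. ennreal (\<Prod>i\<in>UNIV. std_normal_density (z $ i))) \<in> borel_measurable lborel"
    using distributed_borel_measurable[OF \<xi>] .
  have Ucube: "AE \<omega> in M. U \<omega> \<in> cbox 0 1"
  proof -
    have "AE u in density lborel (\<lambda>u. indicator (cbox 0 1) u). u \<in> (cbox 0 1 :: (real ^ 'd) set)"
      by (subst AE_density) (auto simp: indicator_def)
    then have "AE u in ?U. u \<in> cbox 0 1" unfolding dU .
    then show ?thesis by (subst (asm) AE_distr_iff) (use Um in auto)
  qed
  have joint: "?U \<Otimes>\<^sub>M ?X = ?UX"
  proof (rule pair_measure_eqI)
    show "sigma_finite_measure (?U)" "sigma_finite_measure (?X)"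
      by (intro prob_space_imp_sigma_finite prob_space_distr; measurable)+
    show "sets (?U \<Otimes>\<^sub>M ?X) = sets (?UX)"
      by simp
    fix A B assume AB: "A \<in> sets (?U)" "B \<in> sets (?X)"
    then have [measurable]: "A \<in> sets borel" "B \<in> sets borel" by auto
    have "prob ((U -` A \<inter> space M) \<inter> (\<xi> -` B \<inter> space M)) = prob (U -` A \<inter> space M) * prob (\<xi> -` B \<inter> space M)"
      by (rule indep_setD[OF indep[unfolded indep_rvs_def]]) (use AB in auto)
    moreover have "(\<lambda>\<omega>. (U \<omega>, \<xi> \<omega>)) -` (A \<times> B) \<inter> space M = (U -` A \<inter> space M) \<inter> (\<xi> -` B \<inter> space M)" by auto
    ultimately show "emeasure (?U) A * emeasure (?X) B
      = emeasure (?UX) (A \<times> B)"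
      using AB by (simp add: emeasure_distr[OF UX(1)] emeasure_distr[OF UX(2)] emeasure_distr[OF measurable_Pair[OF UX]]
          emeasure_eq_measure ennreal_mult)
  qed
  interpret \<xi>: prob_space "?X" by (rule prob_space_distr) measurable
  have [measurable]: "(\<lambda>z. F (g' (fst z) + \<sigma> *\<^sub>R snd z)) \<in> borel_measurable (lborel \<Otimes>\<^sub>M lborel)"
    by measurable
  have "(\<integral>\<^sup>+y. F y * p y \<partial>lborel) = (\<integral>\<^sup>+y. p y * F y \<partial>lborel)" by (simp add: mult.commute)
  also have "\<dots> = (\<integral>\<^sup>+\<omega>. F (g (U \<omega>) + \<sigma> *\<^sub>R \<xi> \<omega>) \<partial>M)"
    by (rule distributed_nn_integral[OF Y]) simp
  also have "\<dots> = (\<integral>\<^sup>+\<omega>. F (g' (U \<omega>) + \<sigma> *\<^sub>R \<xi> \<omega>) \<partial>M)"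
    by (rule nn_integral_cong_AE) (use Ucube in \<open>auto elim!: eventually_mono simp: g'_def\<close>)
  also have "\<dots> = (\<integral>\<^sup>+z. F (g' (fst z) + \<sigma> *\<^sub>R snd z) \<partial>?UX)"
    by (subst nn_integral_distr) auto
  also have "\<dots> = (\<integral>\<^sup>+u. (\<integral>\<^sup>+z. F (g' u + \<sigma> *\<^sub>R z) \<partial>?X) \<partial>?U)"
  proof -
    have "(\<lambda>z. F (g' (fst z) + \<sigma> *\<^sub>R snd z)) \<in> borel_measurable (?U \<Otimes>\<^sub>M ?X)"
      by (subst measurable_cong_sets[OF sets_pair_measure_cong[OF sets_distr sets_distr] refl]) measurable
    from \<xi>.nn_integral_fst[OF this] show ?thesis by (simp add: joint)
  qed
  also have "\<dots> = (\<integral>\<^sup>+u. (\<integral>\<^sup>+z. ennreal (\<Prod>i\<in>UNIV. std_normal_density (z $ i)) * F (g' u + \<sigma> *\<^sub>R z) \<partial>lborel) \<partial>?U)"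
    unfolding d\<xi> by (intro nn_integral_cong nn_integral_density) measurable
  also have "\<dots> = (\<integral>\<^sup>+u. (\<integral>\<^sup>+y. F y * ennreal (gauss (g' u) \<sigma> y) \<partial>lborel) \<partial>?U)"
    unfolding nn_integral_gauss_affine[OF \<sigma> F, symmetric] by (simp only: mult.commute)
  also have "\<dots> = (\<integral>\<^sup>+u. indicator (cbox 0 1) u * (\<integral>\<^sup>+y. F y * ennreal (gauss (g' u) \<sigma> y) \<partial>lborel) \<partial>lborel)"
    unfolding dU by (rule nn_integral_density) measurable
  finally show ?thesis by (simp only: g'_def)
qed

lemma gauss_upd:
  "gauss m \<sigma> (upd j x t) = normal_density (m $ j) \<sigma> t * (\<Prod>i\<in>UNIV - {j}. normal_density (m $ i) \<sigma> (x $ i))"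
  unfolding gauss_def by (subst prod.remove[of _ j]) (auto simp: upd_nth intro!: prod.cong)

text \<open>Along a line in direction \<open>j\<close> the Gaussian is a one-dimensional normal
  density times a factor that is constant on the line. The bound on the line is multiplied by this
  factor and integrated over all lines.\<close>

lemma gauss_interpolation:
  fixes f v :: "real ^ 'n::finite \<Rightarrow> real"
  assumes W: "tensor_weak_deriv j N f v"
    and N: "N \<ge> 2" and \<sigma>: "\<sigma> > 0" and \<kappa>: "\<kappa> > 0"
  shows "ennreal (\<sigma>\<^sup>2) * (\<integral>\<^sup>+y. ennreal ((dir_deriv j f y)\<^sup>2) * ennreal (gauss m \<sigma> y) \<partial>lborel)
    \<le> ennreal (\<kappa> ^ (N - 1)) * ((\<integral>\<^sup>+y. ennreal ((f y)\<^sup>2) * ennreal (gauss m \<sigma> y) \<partial>lborel)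
        + ennreal (\<sigma> ^ (2 * N)) * (\<integral>\<^sup>+y. ennreal ((v y)\<^sup>2) * ennreal (gauss m \<sigma> y) \<partial>lborel))
      + ennreal ((real N - 1) / \<kappa>) * (\<integral>\<^sup>+y. ennreal ((f y)\<^sup>2) * ennreal (gauss m \<sigma> y) \<partial>lborel)"
proof -
  let ?a = "ennreal (\<kappa> ^ (N - 1))" and ?b = "ennreal ((real N - 1) / \<kappa>)" and ?s = "ennreal (\<sigma> ^ (2 * N))"
  note [measurable] = tensor_weak_derivD(1,2)[OF W]
  \<comment> \<open>The weight of a line: the Gaussian factors of the other coordinates, and a
    probability density that integrates out the redundant coordinate \<open>x $ j\<close>.\<close>
  define W where "W x = ennreal (\<Prod>i\<in>UNIV - {j}. normal_density (m $ i) \<sigma> (x $ i)) * ennreal (std_normal_density (x $ j))" for x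
  define I where "I g x = (\<integral>\<^sup>+t. ennreal ((g (upd j x t))\<^sup>2 * normal_density (m $ j) \<sigma> t) \<partial>lborel)" for g :: "real ^ 'n \<Rightarrow> real" and x
  have Wm [measurable]: "W \<in> borel_measurable borel" unfolding W_def[abs_def] by measurable
  have Im [measurable]: "I g \<in> borel_measurable borel" if [measurable]: "g \<in> borel_measurable borel" for g
    unfolding I_def[abs_def] by measurable
  have slice: "(\<integral>\<^sup>+y. ennreal ((g y)\<^sup>2) * ennreal (gauss m \<sigma> y) \<partial>lborel) = (\<integral>\<^sup>+x. I g x * W x \<partial>lborel)"
    if [measurable]: "g \<in> borel_measurable borel" for g
  proof -
    have one: "(\<integral>\<^sup>+s. ennreal (std_normal_density s) \<partial>lborel) = 1"
      by (subst nn_integral_eq_integral) auto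
    have "(\<integral>\<^sup>+y. ennreal ((g y)\<^sup>2) * ennreal (gauss m \<sigma> y) \<partial>lborel)
      = (\<integral>\<^sup>+x. (\<integral>\<^sup>+t. ennreal ((g (upd j x t))\<^sup>2) * ennreal (gauss m \<sigma> (upd j x t)) \<partial>lborel) * ennreal (std_normal_density (x $ j)) \<partial>lborel)"
      by (rule nn_integral_slices[symmetric, OF _ _ one]) measurable
    also have "\<dots> = (\<integral>\<^sup>+x. I g x * W x \<partial>lborel)"
    proof (rule nn_integral_cong)
      fix x
      let ?P = "\<Prod>i\<in>UNIV - {j}. normal_density (m $ i) \<sigma> (x $ i)"
      have "(\<integral>\<^sup>+t. ennreal ((g (upd j x t))\<^sup>2) * ennreal (gauss m \<sigma> (upd j x t)) \<partial>lborel)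
        = (\<integral>\<^sup>+t. ennreal ((g (upd j x t))\<^sup>2 * normal_density (m $ j) \<sigma> t) * ennreal ?P \<partial>lborel)"
        by (simp add: gauss_upd ennreal_mult prod_nonneg mult.assoc)
      also have "\<dots> = I g x * ennreal ?P"
        unfolding I_def by (rule nn_integral_multc) measurable
      finally show "(\<integral>\<^sup>+t. ennreal ((g (upd j x t))\<^sup>2) * ennreal (gauss m \<sigma> (upd j x t)) \<partial>lborel) * ennreal (std_normal_density (x $ j)) = I g x * W x"
        by (simp add: W_def mult.assoc)
    qed
    finally show ?thesis .
  qed
  from AE_slices_representation[OF W N]
  have "AE x in lborel. ennreal (\<sigma>\<^sup>2) * I (dir_deriv j f) x
    \<le> ?a * (I f x + ?s * I v x) + ?b * I f x"
  proof eventually_elim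
    case (elim x)
    then obtain w where w: "w N = (\<lambda>t. v (upd j x t))" "w 1 = (\<lambda>t. dir_deriv j f (upd j x t))"
      "\<And>n. n < N \<Longrightarrow> abs_cont_deriv (w n) (w (Suc n))" "AE t in lborel. f (upd j x t) = w 0 t" by blast
    have w0: "I f x = (\<integral>\<^sup>+t. ennreal ((w 0 t)\<^sup>2 * normal_density (m $ j) \<sigma> t) \<partial>lborel)"
      unfolding I_def by (rule nn_integral_cong_AE) (use w(4) in \<open>auto elim!: eventually_mono\<close>)
    show ?case
      using normal_interpolation[of \<sigma> \<kappa> N w "m $ j"] \<sigma> \<kappa> w(3) N
      unfolding w0 unfolding I_def w(1) w(2) by simp
  qed
  note slicewise = this
  let ?If = "\<integral>\<^sup>+x. I f x * W x \<partial>lborel" and ?Iv = "\<integral>\<^sup>+x. I v x * W x \<partial>lborel"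
  from slicewise have "(\<integral>\<^sup>+x. (ennreal (\<sigma>\<^sup>2) * I (dir_deriv j f) x) * W x \<partial>lborel)
    \<le> (\<integral>\<^sup>+x. (?a * (I f x + ?s * I v x) + ?b * I f x) * W x \<partial>lborel)"
    by (intro nn_integral_mono_AE) (auto elim!: eventually_mono intro!: mult_right_mono)
  also have "\<dots> = (\<integral>\<^sup>+x. ?a * (I f x * W x + ?s * (I v x * W x)) + ?b * (I f x * W x) \<partial>lborel)"
    by (intro nn_integral_cong) (simp add: distrib_left distrib_right mult.assoc)
  also have "\<dots> = ?a * (?If + ?s * ?Iv)
     + ?b * ?If"
    by (simp add: nn_integral_add nn_integral_cmult)
  also have "(\<integral>\<^sup>+x. (ennreal (\<sigma>\<^sup>2) * I (dir_deriv j f) x) * W x \<partial>lborel) = ennreal (\<sigma>\<^sup>2) * (\<integral>\<^sup>+x. I (dir_deriv j f) x * W x \<partial>lborel)"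
    by (simp add: nn_integral_cmult mult.assoc)
  finally show ?thesis by (simp add: slice)
qed

section \<open>Existence and uniqueness of first-order weak derivatives\<close>

text \<open>Weak derivatives are only Lebesgue measurable, and restricting such functions to lines
  need not give measurable functions. Passing to Borel representatives makes the Fubini arguments
  available.\<close>

lemma locally_integrable_borel_rep:
  fixes f :: "real ^ 'n::finite \<Rightarrow> real"
  assumes f: "locally_integrable f"
  shows "f \<in> borel_measurable lebesgue"
    and "\<exists>f'. f' \<in> borel_measurable borel \<and> (AE x in lborel. f x = f' x) \<and> (\<forall>a b. set_integrable lborel (cbox a b) f')"
proof -
  have int: "integrable lebesgue (\<lambda>x. indicator (cbox a b) x *\<^sub>R f x)" for a b
    using f by (simp add: locally_integrable_def set_integrable_def compact_cbox)
  show fm: "f \<in> borel_measurable lebesgue"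
  proof (rule borel_measurable_LIMSEQ_real)
    let ?C = "\<lambda>n::nat. cbox (\<chi> i. - real n) (\<chi> i. real n) :: (real ^ 'n) set"
    show "(\<lambda>x. indicator (?C n) x *\<^sub>R f x) \<in> borel_measurable lebesgue" for n
      using int by (rule borel_measurable_integrable)
    show "(\<lambda>n. indicator (?C n) x *\<^sub>R f x) \<longlonglongrightarrow> f x" for x
    proof (rule tendsto_eventually)
      obtain N where N: "norm x \<le> real N" using real_arch_simple by blast
      show "\<forall>\<^sub>F n in sequentially. indicator (?C n) x *\<^sub>R f x = f x"
      proof (rule eventually_sequentiallyI[of N])
        fix n assume "N \<le> n"
        then have "\<bar>x $ i\<bar> \<le> real n" for i using component_le_norm_cart[of x i] N by linarith
        then have "x \<in> ?C n" by (simp add: mem_box_cart abs_le_iff minus_le_iff)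
        then show "indicator (?C n) x *\<^sub>R f x = f x" by simp
      qed
    qed
  qed
  from fm obtain f' where f': "f' \<in> borel_measurable lborel" "AE x in lborel. f x = f' x"
    using completion_ex_borel_measurable_real by blast
  then have f'b [measurable]: "f' \<in> borel_measurable borel" by simp
  have "set_integrable lborel (cbox a b) f'" for a b
  proof -
    have "integrable lebesgue (\<lambda>x. indicator (cbox a b) x *\<^sub>R f' x)"
      using AE_completion[OF f'(2)] f'(1)
      by (intro integrable_cong_AE_imp[OF int[of a b]]) (auto intro!: measurable_completion elim!: eventually_mono)
    then show ?thesis by (simp add: set_integrable_def integrable_completion)
  qed
  then show "\<exists>f'. f' \<in> borel_measurable borel \<and> (AE x in lborel. f x = f' x) \<and> (\<forall>a b. set_integrable lborel (cbox a b) f')"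
    using f' by (intro exI[of _ f']) simp
qed

lemma locally_integrable_if_borel:
  fixes v :: "real ^ 'n::finite \<Rightarrow> real"
  assumes [measurable]: "v \<in> borel_measurable borel" and v: "\<And>a b. set_integrable lborel (cbox a b) v"
  shows "locally_integrable v"
  unfolding locally_integrable_def
proof (intro allI impI)
  fix K :: "(real ^ 'n) set" assume "compact K"
  then obtain a where a: "K \<subseteq> cbox (- a) a"
    using bounded_subset_cbox_symmetric compact_imp_bounded by blast
  have "set_integrable lebesgue (cbox (- a) a) v"
    using v[of "- a" a] by (simp add: set_integrable_def integrable_completion)
  then show "set_integrable lebesgue K v"
    by (rule set_integrable_subset) (use a \<open>compact K\<close> in \<open>auto simp: borel_compact\<close>)
qed

lemma test_function_continuous:
  assumes "test_function \<phi> \<Phi>"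
  shows "continuous_on UNIV (\<Phi> k)" "\<phi> = \<Phi> (\<lambda>_. 0)"
  using assms unfolding test_function_def cont_partials_def by (blast, auto)

lemma integral_lebesgue_cong_borel:
  fixes f f' \<phi> :: "real ^ 'n::finite \<Rightarrow> real"
  assumes [measurable]: "f' \<in> borel_measurable borel" and fm: "f \<in> borel_measurable lebesgue"
    and ae: "AE x in lborel. f x = f' x" and \<phi>: "continuous_on UNIV \<phi>"
  shows "(LINT x|lebesgue. f x * \<phi> x) = (\<integral>x. f' x * \<phi> x \<partial>lborel)"
proof -
  have [measurable]: "\<phi> \<in> borel_measurable borel" by (rule borel_measurable_continuous_onI[OF \<phi>])
  have "\<phi> \<in> borel_measurable lebesgue" "f' \<in> borel_measurable lebesgue"
    by (auto intro: measurable_completion)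
  then have "(LINT x|lebesgue. f x * \<phi> x) = (LINT x|lebesgue. f' x * \<phi> x)"
    using AE_completion[OF ae] fm by (intro integral_cong_AE) (auto elim!: eventually_mono)
  also have "\<dots> = (\<integral>x. f' x * \<phi> x \<partial>lborel)"
    by (rule integral_completion) measurable
  finally show ?thesis .
qed

lemma has_weak_deriv_borel:
  fixes f v f' v' :: "real ^ 'n::finite \<Rightarrow> real"
  assumes "has_weak_deriv f k v" "test_function \<phi> \<Phi>"
    and "f' \<in> borel_measurable borel" "f \<in> borel_measurable lebesgue" "AE x in lborel. f x = f' x"
    and "v' \<in> borel_measurable borel" "v \<in> borel_measurable lebesgue" "AE x in lborel. v x = v' x"
  shows "(\<integral>x. f' x * \<Phi> k x \<partial>lborel) = (- 1) ^ mi_order k * (\<integral>x. v' x * \<phi> x \<partial>lborel)"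
  using assms(1,2) test_function_continuous[OF assms(2)]
    integral_lebesgue_cong_borel[OF assms(3,4,5), of "\<Phi> k"] integral_lebesgue_cong_borel[OF assms(6,7,8), of \<phi>]
  by (auto simp: has_weak_deriv_def)

lemma mi_order_axis: "mi_order ((\<lambda>_. 0)(j := n)) = n"
  by (simp add: mi_order_def sum.delta' fun_upd_def)

text \<open>\<open>weak_deriv\<close> is an unspecified choice; uniqueness transfers the bounds
  obtained for \<open>dir_deriv\<close> to it.\<close>

lemma has_weak_deriv_unique:
  fixes f v1 v2 :: "real ^ 'n::finite \<Rightarrow> real"
  assumes 1: "has_weak_deriv f k v1" and 2: "has_weak_deriv f k v2"
  shows "AE x in lborel. v1 x = v2 x"
proof -
  have li: "locally_integrable f" "locally_integrable v1" "locally_integrable v2"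
    using 1 2 by (auto simp: has_weak_deriv_def)
  obtain f' where f: "f' \<in> borel_measurable borel" "f \<in> borel_measurable lebesgue" "AE x in lborel. f x = f' x"
    using locally_integrable_borel_rep[OF li(1)] by blast
  obtain u1 where u1: "u1 \<in> borel_measurable borel" "v1 \<in> borel_measurable lebesgue" "AE x in lborel. v1 x = u1 x"
    and i1: "\<And>a b. set_integrable lborel (cbox a b) u1"
    using locally_integrable_borel_rep[OF li(2)] by blast
  obtain u2 where u2: "u2 \<in> borel_measurable borel" "v2 \<in> borel_measurable lebesgue" "AE x in lborel. v2 x = u2 x"
    and i2: "\<And>a b. set_integrable lborel (cbox a b) u2"
    using locally_integrable_borel_rep[OF li(3)] by blast
  note [measurable] = u1(1) u2(1)
  have "AE x in lborel. u1 x - u2 x = 0"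
  proof (rule AE_zero_if_tensor_bumps)
    show "set_integrable lborel (box a b) (\<lambda>x. u1 x - u2 x)" for a b
    proof (rule set_integrable_subset)
      show "set_integrable lborel (cbox a b) (\<lambda>x. u1 x - u2 x)" by (rule set_integral_diff[OF i1 i2])
    qed (auto simp: box_subset_cbox)
    fix a b :: "real ^ 'n" and n
    let ?T = "tensor (\<lambda>i. bump (a $ i) (b $ i) n)"
    have t: "test_function (?T (\<lambda>_. 0)) ?T" by (rule test_function_tensor[OF test_derivs_bump])
    have "(- 1) ^ mi_order k * (\<integral>x. u1 x * ?T (\<lambda>_. 0) x \<partial>lborel) = (- 1) ^ mi_order k * (\<integral>x. u2 x * ?T (\<lambda>_. 0) x \<partial>lborel)"
      using has_weak_deriv_borel[OF 1 t f u1] has_weak_deriv_borel[OF 2 t f u2] by simp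
    then show "(\<integral>x. (u1 x - u2 x) * ?T (\<lambda>_. 0) x \<partial>lborel) = 0"
      using integrable_mult_tensor[OF i1 test_derivs_bump] integrable_mult_tensor[OF i2 test_derivs_bump]
      by (simp add: left_diff_distrib)
  qed simp
  then show ?thesis using u1(3) u2(3) by eventually_elim simp
qed

lemma test_function_slice:
  fixes \<phi> :: "real ^ 'n::finite \<Rightarrow> real"
  assumes T: "test_function \<phi> \<Phi>"
  shows "abs_cont_deriv (\<lambda>t. \<phi> (upd j x t)) (\<lambda>t. \<Phi> (mi_unit j) (upd j x t))"
    "\<exists>a b. \<forall>x. x \<notin> cbox a b \<longrightarrow> \<phi> x = 0 \<and> \<Phi> (mi_unit j) x = 0"
proof -
  have unit: "mi_unit j = (\<lambda>_. 0)(j := Suc 0)" by (simp add: mi_unit_def)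
  have cp: "cont_partials UNIV 1 \<phi> \<Phi>" using T by (simp add: test_function_def)
  have "mi_order (\<lambda>_::'n. 0) < 1" by (simp add: mi_order_def)
  then have d: "((\<lambda>t. \<phi> (x + t *\<^sub>R axis j 1)) has_real_derivative \<Phi> (mi_unit j) x) (at 0)" for x
    using cp unfolding cont_partials_def unit test_function_continuous(2)[OF T] by fastforce
  show "abs_cont_deriv (\<lambda>t. \<phi> (upd j x t)) (\<lambda>t. \<Phi> (mi_unit j) (upd j x t))"
  proof (rule abs_cont_derivI_has_derivative)
    fix t
    have "((\<lambda>s. \<phi> (upd j x (t + s))) has_real_derivative \<Phi> (mi_unit j) (upd j x t)) (at 0)"
      using d[of "upd j x t"] by (simp add: upd_add)
    then show "((\<lambda>t. \<phi> (upd j x t)) has_real_derivative \<Phi> (mi_unit j) (upd j x t)) (at t)"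
      using DERIV_shift[of "\<lambda>t. \<phi> (upd j x t)" "\<Phi> (mi_unit j) (upd j x t)" 0 t] by (simp add: add.commute)
    show "continuous_on UNIV (\<lambda>t. \<Phi> (mi_unit j) (upd j x t))"
      by (rule continuous_on_compose2[OF test_function_continuous(1)[OF T] continuous_upd_snd]) simp
  qed
  have "bounded {x. \<phi> x \<noteq> 0}"
    using T compact_imp_bounded bounded_closure bounded_subset[OF _ closure_subset] unfolding test_function_def by blast
  then obtain a where a: "{x. \<phi> x \<noteq> 0} \<subseteq> cbox (- a) a" using bounded_subset_cbox_symmetric by blast
  \<comment> \<open>The complement of the cube is open, so \<open>\<phi>\<close> vanishes along the
    axis direction near such a point, and so does its derivative there.\<close>
  have "\<Phi> (mi_unit j) x = 0" if "x \<notin> cbox (- a) a" for x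
  proof -
    have "((\<lambda>t. x + t *\<^sub>R axis j 1) \<longlongrightarrow> x + 0 *\<^sub>R axis j 1) (nhds 0)"
      by (intro tendsto_add tendsto_scaleR tendsto_const filterlim_ident)
    then have lim: "((\<lambda>t. x + t *\<^sub>R axis j 1) \<longlongrightarrow> x) (nhds 0)" by simp
    have "\<forall>\<^sub>F y in nhds x. y \<in> - cbox (- a) a"
      by (rule eventually_nhds_in_open) (use that in \<open>auto simp: open_Compl closed_cbox\<close>)
    from eventually_compose_filterlim[OF this lim]
    have "\<forall>\<^sub>F t in nhds 0. x + t *\<^sub>R axis j 1 \<in> - cbox (- a) a" .
    then have "\<forall>\<^sub>F t in nhds 0. \<phi> (x + t *\<^sub>R axis j 1) = 0"
      by (rule eventually_mono) (use a in auto)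
    then have "((\<lambda>t. \<phi> (x + t *\<^sub>R axis j 1)) has_real_derivative 0) (at 0)"
      using DERIV_cong_ev[of 0 0 "\<lambda>t. \<phi> (x + t *\<^sub>R axis j 1)" "\<lambda>_. 0" 0 0] by simp
    then show ?thesis using d DERIV_unique by blast
  qed
  then show "\<exists>a b. \<forall>x. x \<notin> cbox a b \<longrightarrow> \<phi> x = 0 \<and> \<Phi> (mi_unit j) x = 0"
    using a by (intro exI[of _ "- a"] exI[of _ a]) auto
qed

text \<open>On almost every line \<open>f\<close> agrees almost everywhere with an absolutely
  continuous function whose derivative is \<open>dir_deriv j f\<close>. Multiplied by the slice of
  \<open>\<phi>\<close>, it has a derivative of integral zero, and integrating this over the lines
  gives the identity.\<close>

lemma dir_deriv_integral_by_parts: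
  fixes f v :: "real ^ 'n::finite \<Rightarrow> real"
  assumes W: "tensor_weak_deriv j N f v"
    and N: "N \<ge> 2" and D: "\<And>a b. set_integrable lborel (cbox a b) (dir_deriv j f)"
    and T: "test_function \<phi> \<Phi>"
  shows "(\<integral>x. f x * \<Phi> (mi_unit j) x \<partial>lborel) = - (\<integral>x. dir_deriv j f x * \<phi> x \<partial>lborel)"
proof -
  note [measurable] = tensor_weak_derivD(1,2)[OF W]
  note f = tensor_weak_derivD(3)[OF W]
  let ?\<Phi> = "\<Phi> (mi_unit j)"
  obtain a b where z: "\<And>x. x \<notin> cbox a b \<Longrightarrow> \<phi> x = 0" "\<And>x. x \<notin> cbox a b \<Longrightarrow> ?\<Phi> x = 0"
    using test_function_slice(2)[OF T] by metis
  have c\<phi>: "continuous_on UNIV \<phi>" using test_function_continuous[OF T] by metis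
  note c\<Phi> = test_function_continuous(1)[OF T, of "mi_unit j"]
  have i1: "integrable lborel (\<lambda>x. f x * ?\<Phi> x)" by (rule integrable_mult_compact_support[OF f c\<Phi> z(2)])
  have i2: "integrable lborel (\<lambda>x. dir_deriv j f x * \<phi> x)" by (rule integrable_mult_compact_support[OF D c\<phi> z(1)])
  have i3: "integrable lborel (\<lambda>x. f x * \<phi> x)" by (rule integrable_mult_compact_support[OF f c\<phi> z(1)])
  define F where "F x = dir_deriv j f x * \<phi> x + f x * ?\<Phi> x" for x
  have iF: "integrable lborel F" unfolding F_def[abs_def] using i1 i2 by simp
  from AE_slices_representation[OF W N]
  have "AE x in lborel. (\<integral>t. F (upd j x t) \<partial>lborel) = 0"
    using integral_slices(1)[OF iF, of j] integral_slices(1)[OF i3, of j]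
  proof eventually_elim
    case (elim x)
    then obtain w where w1: "w 1 = (\<lambda>t. dir_deriv j f (upd j x t))"
      and ww: "\<forall>n<N. abs_cont_deriv (w n) (w (Suc n))" and w0: "AE t in lborel. f (upd j x t) = w 0 t" by blast
    have w: "abs_cont_deriv (w 0) (w 1)" using ww N by simp
    have c0: "continuous_on UNIV (w 0)" by (rule abs_cont_deriv_continuous[OF w])
    note ac = abs_cont_deriv_mult[OF w test_function_slice(1)[OF T, of j x]]
    have [measurable]: "w 0 \<in> borel_measurable borel" "(\<lambda>t. \<phi> (upd j x t)) \<in> borel_measurable borel"
      "(\<lambda>t. ?\<Phi> (upd j x t)) \<in> borel_measurable borel"
      using c0 continuous_on_compose2[OF c\<phi> continuous_upd_snd] continuous_on_compose2[OF c\<Phi> continuous_upd_snd]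
      by (auto intro!: borel_measurable_continuous_onI)
    have [measurable]: "w (Suc 0) \<in> borel_measurable borel"
      using abs_cont_deriv_measurable[OF w] by simp
    have Feq: "AE t in lborel. F (upd j x t) = w 1 t * \<phi> (upd j x t) + w 0 t * ?\<Phi> (upd j x t)"
      using w0 by eventually_elim (simp only: F_def w1)
    have "(\<integral>t. w 1 t * \<phi> (upd j x t) + w 0 t * ?\<Phi> (upd j x t) \<partial>lborel) = 0"
    proof (rule abs_cont_deriv_integral_zero[OF ac])
      show "integrable lborel (\<lambda>t. w 0 t * \<phi> (upd j x t))"
        by (rule integrable_cong_AE_imp[OF elim(3)]) (use w0 in \<open>auto elim!: eventually_mono\<close>)
      show "integrable lborel (\<lambda>t. w 1 t * \<phi> (upd j x t) + w 0 t * ?\<Phi> (upd j x t))"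
        by (rule integrable_cong_AE_imp[OF elim(2)]) (use Feq in \<open>auto elim!: eventually_mono\<close>)
    qed
    moreover have "(\<integral>t. F (upd j x t) \<partial>lborel) = (\<integral>t. w 1 t * \<phi> (upd j x t) + w 0 t * ?\<Phi> (upd j x t) \<partial>lborel)"
      by (rule integral_cong_AE) (use Feq borel_measurable_integrable[OF elim(2)] in auto)
    ultimately show ?case by simp
  qed
  then have "(\<integral>x. (\<integral>t. F (upd j x t) \<partial>lborel) * std_normal_density (x $ j) \<partial>lborel) = 0"
    by (intro integral_eq_zero_AE) (auto elim!: eventually_mono)
  then have "(\<integral>x. F x \<partial>lborel) = 0" using integral_slices(2)[OF iF, of j] by simp
  then show ?thesis using i1 i2 by (simp add: F_def[abs_def])
qed

section \<open>Interpolation and first-order weak derivatives for the mixture weight\<close>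

locale gaussian_mixture_weight =
  fixes p :: "real ^ 'n::finite \<Rightarrow> ennreal" and m :: "real ^ 'd::finite \<Rightarrow> real ^ 'n" and \<sigma> :: real
  assumes \<sigma>: "\<sigma> > 0"
    and m_measurable [measurable]: "m \<in> borel_measurable borel" and m_le_1: "\<And>u. norm (m u) \<le> 1"
    and p_measurable [measurable]: "p \<in> borel_measurable borel"
    and mixture: "\<And>F. F \<in> borel_measurable borel \<Longrightarrow> (\<integral>\<^sup>+y. F y * p y \<partial>lborel)
      = (\<integral>\<^sup>+u. indicator (cbox 0 1) u * (\<integral>\<^sup>+y. F y * ennreal (gauss (m u) \<sigma> y) \<partial>lborel) \<partial>lborel)"
begin

lemma mixture_interpolation:
  fixes f v :: "real ^ 'n \<Rightarrow> real"
  assumes W: "tensor_weak_deriv j N f v"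
    and N: "N \<ge> 2" and \<kappa>: "\<kappa> > 0"
  shows "ennreal (\<sigma>\<^sup>2) * (\<integral>\<^sup>+y. ennreal ((dir_deriv j f y)\<^sup>2) * p y \<partial>lborel)
    \<le> ennreal (\<kappa> ^ (N - 1)) * ((\<integral>\<^sup>+y. ennreal ((f y)\<^sup>2) * p y \<partial>lborel)
        + ennreal (\<sigma> ^ (2 * N)) * (\<integral>\<^sup>+y. ennreal ((v y)\<^sup>2) * p y \<partial>lborel))
      + ennreal ((real N - 1) / \<kappa>) * (\<integral>\<^sup>+y. ennreal ((f y)\<^sup>2) * p y \<partial>lborel)"
proof -
  let ?a = "ennreal (\<kappa> ^ (N - 1))" and ?b = "ennreal ((real N - 1) / \<kappa>)" and ?s = "ennreal (\<sigma> ^ (2 * N))"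
  note [measurable] = tensor_weak_derivD(1,2)[OF W]
  define I where "I g u = indicator (cbox 0 1) u * (\<integral>\<^sup>+y. ennreal ((g y)\<^sup>2) * ennreal (gauss (m u) \<sigma> y) \<partial>lborel)"
    for g :: "real ^ 'n \<Rightarrow> real" and u :: "real ^ 'd"
  have [measurable]: "I g \<in> borel_measurable borel" if [measurable]: "g \<in> borel_measurable borel" for g
    unfolding I_def[abs_def] by measurable
  have mix: "(\<integral>\<^sup>+y. ennreal ((g y)\<^sup>2) * p y \<partial>lborel) = (\<integral>\<^sup>+u. I g u \<partial>lborel)" if [measurable]: "g \<in> borel_measurable borel" for g
    unfolding I_def by (rule mixture) measurable
  have "ennreal (\<sigma>\<^sup>2) * (\<integral>\<^sup>+u. I (dir_deriv j f) u \<partial>lborel) = (\<integral>\<^sup>+u. ennreal (\<sigma>\<^sup>2) * I (dir_deriv j f) u \<partial>lborel)"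
    by (rule nn_integral_cmult[symmetric]) measurable
  also have "\<dots> \<le> (\<integral>\<^sup>+u. ?a * (I f u + ?s * I v u)
      + ?b * I f u \<partial>lborel)"
  proof (rule nn_integral_mono)
    fix u
    show "ennreal (\<sigma>\<^sup>2) * I (dir_deriv j f) u \<le> ?a * (I f u + ?s * I v u)
      + ?b * I f u"
    proof (cases "u \<in> cbox 0 1")
      case True
      then show ?thesis
        using gauss_interpolation[OF W N \<sigma> \<kappa>, of "m u"] by (simp add: I_def)
    qed (simp add: I_def)
  qed
  also have "\<dots> = ?a * ((\<integral>\<^sup>+u. I f u \<partial>lborel) + ?s * (\<integral>\<^sup>+u. I v u \<partial>lborel))
      + ?b * (\<integral>\<^sup>+u. I f u \<partial>lborel)"
    by (simp add: nn_integral_add nn_integral_cmult)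
  finally show ?thesis by (simp add: mix)
qed

text \<open>On a fixed box, Gaussians with means in the unit ball are bounded below uniformly in the
  mean. Finite weighted norms therefore control unweighted integrals over boxes, which is what weak
  derivatives require.\<close>

lemma mixture_lower_bound:
  "\<exists>c>0. \<forall>F\<in>borel_measurable borel. ennreal c * (\<integral>\<^sup>+y. F y * indicator (cbox a b) y \<partial>lborel) \<le> (\<integral>\<^sup>+y. F y * p y \<partial>lborel)"
proof -
  obtain R where R: "\<And>y. y \<in> cbox a b \<Longrightarrow> norm y \<le> R"
    using bounded_cbox[of a b] unfolding bounded_iff by blast
  \<comment> \<open>The value of the one-dimensional density at distance R + 1 from its mean;
    coordinates of points in the box and of the means differ by no more than that.\<close>
  define d where "d = 1 / sqrt (2 * pi * \<sigma>\<^sup>2) * exp (- (R + 1)\<^sup>2 / (2 * \<sigma>\<^sup>2))"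
  have d: "d > 0" using \<sigma> by (simp add: d_def)
  have low: "d ^ CARD('n) \<le> gauss (m u) \<sigma> y" if y: "y \<in> cbox a b" for u y
  proof -
    have "d \<le> normal_density (m u $ i) \<sigma> (y $ i)" for i
    proof -
      have "\<bar>y $ i - m u $ i\<bar> \<le> R + 1"
        using component_le_norm_cart[of y i] component_le_norm_cart[of "m u" i] R[OF y] m_le_1[of u] by linarith
      then have "(y $ i - m u $ i)\<^sup>2 \<le> (R + 1)\<^sup>2"
        by (metis abs_ge_zero power2_abs power_mono)
      then show ?thesis
        unfolding d_def normal_density_def using \<sigma> by (intro mult_left_mono) (auto intro!: divide_right_mono)
    qed
    then have "(\<Prod>i\<in>(UNIV :: 'n set). d) \<le> gauss (m u) \<sigma> y"
      unfolding gauss_def using d by (intro prod_mono) auto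
    then show ?thesis by simp
  qed
  have "ennreal (d ^ CARD('n)) * (\<integral>\<^sup>+y. F y * indicator (cbox a b) y \<partial>lborel) \<le> (\<integral>\<^sup>+y. F y * p y \<partial>lborel)"
    if [measurable]: "F \<in> borel_measurable borel" for F
  proof -
    let ?F = "\<integral>\<^sup>+y. F y * indicator (cbox a b) y \<partial>lborel" and ?c = "ennreal (d ^ CARD('n))"
    have "?c * ?F
       = (\<integral>\<^sup>+u. indicator (cbox 0 1 :: (real ^ 'd) set) u * (?c * ?F) \<partial>lborel)"
      by (simp add: nn_integral_multc unit_cube_measure)
    also have "\<dots> \<le> (\<integral>\<^sup>+u. indicator (cbox 0 1) u * (\<integral>\<^sup>+y. F y * ennreal (gauss (m u) \<sigma> y) \<partial>lborel) \<partial>lborel)"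
    proof (intro nn_integral_mono mult_left_mono)
      fix u
      have "?c * ?F
         = (\<integral>\<^sup>+y. ?c * (F y * indicator (cbox a b) y) \<partial>lborel)"
        by (rule nn_integral_cmult[symmetric]) measurable
      also have "\<dots> \<le> (\<integral>\<^sup>+y. F y * ennreal (gauss (m u) \<sigma> y) \<partial>lborel)"
      proof (rule nn_integral_mono)
        fix y
        show "?c * (F y * indicator (cbox a b) y) \<le> F y * ennreal (gauss (m u) \<sigma> y)"
          using low[of y u] by (cases "y \<in> cbox a b") (auto simp: mult.commute[of _ "F y"] intro!: mult_left_mono ennreal_leI)
      qed
      finally show "?c * ?F
        \<le> (\<integral>\<^sup>+y. F y * ennreal (gauss (m u) \<sigma> y) \<partial>lborel)" .
    qed simp
    also have "\<dots> = (\<integral>\<^sup>+y. F y * p y \<partial>lborel)" by (rule mixture[symmetric]) measurable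
    finally show ?thesis .
  qed
  then show ?thesis using d by (intro exI[of _ "d ^ CARD('n)"]) auto
qed

lemma set_integrable_if_L2:
  assumes [measurable]: "g \<in> borel_measurable borel"
    and fin: "(\<integral>\<^sup>+y. ennreal ((g y)\<^sup>2) * p y \<partial>lborel) < \<infinity>"
  shows "set_integrable lborel (cbox a b) g"
proof -
  obtain c where c: "c > 0" "\<forall>F\<in>borel_measurable borel. ennreal c * (\<integral>\<^sup>+y. F y * indicator (cbox a b) y \<partial>lborel) \<le> (\<integral>\<^sup>+y. F y * p y \<partial>lborel)"
    using mixture_lower_bound by blast
  have "ennreal c * (\<integral>\<^sup>+y. ennreal ((g y)\<^sup>2) * indicator (cbox a b) y \<partial>lborel) < \<infinity>"
    using c(2)[rule_format, of "\<lambda>y. ennreal ((g y)\<^sup>2)"] fin by (auto intro: le_less_trans)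
  then have 2: "(\<integral>\<^sup>+y. ennreal ((g y)\<^sup>2) * indicator (cbox a b) y \<partial>lborel) < \<infinity>"
    using c(1) by (auto simp: ennreal_mult_less_top)
  have "(\<integral>\<^sup>+y. ennreal (norm (indicator (cbox a b) y *\<^sub>R g y)) \<partial>lborel)
    \<le> (\<integral>\<^sup>+y. indicator (cbox a b) y + ennreal ((g y)\<^sup>2) * indicator (cbox a b) y \<partial>lborel)"
  proof (rule nn_integral_mono)
    fix y
    have "\<bar>g y\<bar> \<le> 1 + (g y)\<^sup>2"
      using sum_squares_bound[of 1 "\<bar>g y\<bar>"] by (simp add: power2_eq_square)
    then have "ennreal \<bar>g y\<bar> \<le> 1 + ennreal ((g y)\<^sup>2)"
      by (metis ennreal_1 ennreal_leI ennreal_plus zero_le_one zero_le_power2)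
    then show "ennreal (norm (indicator (cbox a b) y *\<^sub>R g y)) \<le> indicator (cbox a b) y + ennreal ((g y)\<^sup>2) * indicator (cbox a b) y"
      by (auto simp: indicator_def)
  qed
  also have "\<dots> = emeasure lborel (cbox a b) + (\<integral>\<^sup>+y. ennreal ((g y)\<^sup>2) * indicator (cbox a b) y \<partial>lborel)"
    by (simp add: nn_integral_add)
  also have "\<dots> < \<infinity>" using 2 emeasure_lborel_cbox_finite[of a b] by simp
  finally show ?thesis unfolding set_integrable_def by (intro integrableI_bounded) auto
qed

text \<open>The bound with \<open>\<kappa> = 1\<close> shows that \<open>dir_deriv\<close> of a
  Borel representative has finite weighted norm, hence is locally integrable. This allows the
  integration by parts that identifies it as the weak derivative of first order; only then do the
  bounds say something about \<open>weak_deriv\<close>.\<close>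

lemma weak_deriv_interpolation:
  fixes f :: "real ^ 'n \<Rightarrow> real" and j :: 'n and N :: nat
  defines "A \<equiv> (\<integral>\<^sup>+y. ennreal ((f y)\<^sup>2) * p y \<partial>lborel)"
    and "B \<equiv> (\<integral>\<^sup>+y. ennreal ((weak_deriv ((\<lambda>_. 0)(j := N)) f y)\<^sup>2) * p y \<partial>lborel)"
  assumes wd: "weakly_diff f ((\<lambda>_. 0)(j := N))" and N: "N \<ge> 2" and fin: "A < \<infinity>" "B < \<infinity>"
  shows "weakly_diff f (mi_unit j)"
    and "\<kappa> > 0 \<Longrightarrow> ennreal (\<sigma>\<^sup>2) * (\<integral>\<^sup>+y. ennreal ((weak_deriv (mi_unit j) f y)\<^sup>2) * p y \<partial>lborel)
      \<le> ennreal (\<kappa> ^ (N - 1)) * (A + ennreal (\<sigma> ^ (2 * N)) * B) + ennreal ((real N - 1) / \<kappa>) * A"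
proof -
  let ?k = "(\<lambda>_. 0)(j := N) :: 'n \<Rightarrow> nat"
  define v where "v = weak_deriv ?k f"
  have hv: "has_weak_deriv f ?k v"
    using wd unfolding weakly_diff_def v_def weak_deriv_def by (rule someI_ex)
  then have lf: "locally_integrable f" and lv: "locally_integrable v" by (auto simp: has_weak_deriv_def)
  obtain f' where f': "f' \<in> borel_measurable borel" "f \<in> borel_measurable lebesgue" "AE x in lborel. f x = f' x"
    and fi: "\<And>a b. set_integrable lborel (cbox a b) f'"
    using locally_integrable_borel_rep[OF lf] by blast
  obtain v' where v': "v' \<in> borel_measurable borel" "v \<in> borel_measurable lebesgue" "AE x in lborel. v x = v' x"
    and vi: "\<And>a b. set_integrable lborel (cbox a b) v'"
    using locally_integrable_borel_rep[OF lv] by blast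
  note [measurable] = f'(1) v'(1)
  have W: "tensor_weak_deriv j N f' v'"
    unfolding tensor_weak_deriv_def
    using f'(1) v'(1) fi vi has_weak_deriv_borel[OF hv test_function_tensor f' v']
    by (simp add: mi_order_axis)
  have A: "A = (\<integral>\<^sup>+y. ennreal ((f' y)\<^sup>2) * p y \<partial>lborel)"
    unfolding A_def by (rule nn_integral_cong_AE) (use f'(3) in \<open>auto elim!: eventually_mono\<close>)
  have B: "B = (\<integral>\<^sup>+y. ennreal ((v' y)\<^sup>2) * p y \<partial>lborel)"
    unfolding B_def v_def[symmetric] by (rule nn_integral_cong_AE) (use v'(3) in \<open>auto elim!: eventually_mono\<close>)
  let ?D = "dir_deriv j f'"
  have bound: "ennreal (\<sigma>\<^sup>2) * (\<integral>\<^sup>+y. ennreal ((?D y)\<^sup>2) * p y \<partial>lborel)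
      \<le> ennreal (\<kappa> ^ (N - 1)) * (A + ennreal (\<sigma> ^ (2 * N)) * B) + ennreal ((real N - 1) / \<kappa>) * A" if "\<kappa> > 0" for \<kappa>
    unfolding A B by (rule mixture_interpolation[OF W N that])
  have "ennreal (\<sigma>\<^sup>2) * (\<integral>\<^sup>+y. ennreal ((?D y)\<^sup>2) * p y \<partial>lborel) < \<infinity>"
    using fin by (intro le_less_trans[OF bound[of 1]]) (auto simp: ennreal_mult_less_top)
  then have "(\<integral>\<^sup>+y. ennreal ((?D y)\<^sup>2) * p y \<partial>lborel) < \<infinity>"
    using \<sigma> by (auto simp: ennreal_mult_less_top)
  then have Di: "set_integrable lborel (cbox a b) ?D" for a b
    by (intro set_integrable_if_L2) measurable
  have hD: "has_weak_deriv f (mi_unit j) ?D"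
    unfolding has_weak_deriv_def
  proof (intro conjI allI impI lf)
    show "locally_integrable ?D" by (rule locally_integrable_if_borel[OF _ Di]) measurable
    fix \<phi> :: "real ^ 'n \<Rightarrow> real" and \<Phi> assume T: "test_function \<phi> \<Phi>"
    have Dl: "?D \<in> borel_measurable lebesgue" by (rule measurable_completion) measurable
    have c\<phi>: "continuous_on UNIV \<phi>" using test_function_continuous[OF T] by metis
    have "(LINT x|lebesgue. f x * \<Phi> (mi_unit j) x) = (\<integral>x. f' x * \<Phi> (mi_unit j) x \<partial>lborel)"
      by (rule integral_lebesgue_cong_borel[OF f' test_function_continuous(1)[OF T]])
    also have "\<dots> = - (\<integral>x. ?D x * \<phi> x \<partial>lborel)"
      by (rule dir_deriv_integral_by_parts[OF W N Di T])
    also have "(\<integral>x. ?D x * \<phi> x \<partial>lborel) = (LINT x|lebesgue. ?D x * \<phi> x)"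
      by (rule integral_lebesgue_cong_borel[OF _ Dl _ c\<phi>, symmetric]) auto
    finally have "(LINT x|lebesgue. f x * \<Phi> (mi_unit j) x) = - (LINT x|lebesgue. ?D x * \<phi> x)" .
    moreover have "mi_order (mi_unit j) = 1"
      unfolding mi_unit_def by (rule mi_order_axis)
    ultimately show "(LINT x|lebesgue. f x * \<Phi> (mi_unit j) x) = (- 1) ^ mi_order (mi_unit j) * (LINT x|lebesgue. ?D x * \<phi> x)"
      by simp
  qed
  then show wj: "weakly_diff f (mi_unit j)" unfolding weakly_diff_def by blast
  have "has_weak_deriv f (mi_unit j) (weak_deriv (mi_unit j) f)"
    using wj unfolding weakly_diff_def weak_deriv_def by (rule someI_ex)
  from has_weak_deriv_unique[OF this hD]
  have "(\<integral>\<^sup>+y. ennreal ((weak_deriv (mi_unit j) f y)\<^sup>2) * p y \<partial>lborel) = (\<integral>\<^sup>+y. ennreal ((?D y)\<^sup>2) * p y \<partial>lborel)"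
    by (intro nn_integral_cong_AE) (auto elim!: eventually_mono)
  then show "ennreal (\<sigma>\<^sup>2) * (\<integral>\<^sup>+y. ennreal ((weak_deriv (mi_unit j) f y)\<^sup>2) * p y \<partial>lborel)
      \<le> ennreal (\<kappa> ^ (N - 1)) * (A + ennreal (\<sigma> ^ (2 * N)) * B) + ennreal ((real N - 1) / \<kappa>) * A" if "\<kappa> > 0"
    using bound[OF that] by simp
qed

end

section \<open>Optimising the scale\<close>

text \<open>The right side is minimal at \<kappa>^n = A / B, where the first term equals B^(1/n)
  A^(1 - 1/n) and the second is n - 1 times as large; together they give the factor n. For A = 0 the
  minimum is not attained and \<kappa> has to tend to 0.\<close>

lemma optimal_scale:
  fixes X A B :: real
  assumes "0 \<le> A" "A \<le> B" and n: "n \<ge> 2"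
    and bound: "\<And>\<kappa>. \<kappa> > 0 \<Longrightarrow> X \<le> \<kappa> ^ (n - 1) * B + (real n - 1) / \<kappa> * A"
  shows "X \<le> real n * B powr (1 / real n) * A powr (1 - 1 / real n)"
proof (cases "A = 0")
  case True
  have "X \<le> 0"
  proof (rule ccontr)
    assume "\<not> X \<le> 0"
    \<comment> \<open>Below 1 the power of \<kappa> is at most \<kappa> itself, because n \<ge> 2;
      the second bound makes \<kappa> B smaller than X.\<close>
    define \<kappa> where "\<kappa> = min 1 (X / (2 * (B + 1)))"
    have \<kappa>: "0 < \<kappa>" "\<kappa> \<le> 1" using \<open>\<not> X \<le> 0\<close> assms by (auto simp: \<kappa>_def)
    have "\<kappa> ^ (n - 1) \<le> \<kappa> ^ 1" using \<kappa> n by (intro power_decreasing) auto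
    then have "\<kappa> ^ (n - 1) * B \<le> \<kappa> * B" using assms by (intro mult_right_mono) auto
    moreover have "\<kappa> * B \<le> X / (2 * (B + 1)) * B" using assms by (intro mult_right_mono) (auto simp: \<kappa>_def)
    moreover have "X / (2 * (B + 1)) * B < X"
    proof -
      have "X * B < X * (2 * (B + 1))" using \<open>\<not> X \<le> 0\<close> assms by (intro mult_strict_left_mono) auto
      then show ?thesis using assms by (simp add: pos_divide_less_eq)
    qed
    ultimately show False using bound[OF \<kappa>(1)] True by simp
  qed
  then show ?thesis using True by simp
next
  case False
  then have A: "A > 0" and B: "B > 0" using assms by auto
  obtain k where k: "n = Suc k" using n by (cases n) auto
  define a where "a = A powr (1 / real n)"
  define b where "b = B powr (1 / real n)"
  have ab: "a > 0" "b > 0" using A B by (auto simp: a_def b_def)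
  have an: "a ^ n = A" and bn: "b ^ n = B"
    using A B n by (auto simp: a_def b_def powr_realpow[symmetric] powr_powr)
  have Ak: "A powr (1 - 1 / real n) = a ^ k"
  proof -
    have "A powr (1 - 1 / real n) = A / a" using A by (simp add: powr_diff a_def)
    also have "\<dots> = a ^ k" using an ab by (simp add: k field_simps)
    finally show ?thesis .
  qed
  have "X \<le> (a / b) ^ k * B + real k / (a / b) * A"
    using bound[of "a / b"] ab by (simp add: k)
  also have "(a / b) ^ k * B = a ^ k * b" using ab by (simp add: bn[symmetric] k power_divide)
  also have "real k / (a / b) * A = real k * (a ^ k * b)" using ab by (simp add: an[symmetric] k)
  finally show ?thesis unfolding Ak b_def[symmetric] by (simp add: k algebra_simps)
qed

lemma ennreal_optimal_scale:
  fixes X A s :: ennreal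
  assumes fin: "A < \<infinity>" "s < \<infinity>" and n: "n \<ge> 2" and \<sigma>: "\<sigma> > 0"
    and bound: "\<And>\<kappa>. \<kappa> > 0 \<Longrightarrow> ennreal (\<sigma>\<^sup>2) * X \<le> ennreal (\<kappa> ^ (n - 1)) * (A + s) + ennreal ((real n - 1) / \<kappa>) * A"
  shows "X \<le> ennreal (real n / \<sigma>\<^sup>2) * epowr (A + s) (1 / real n) * epowr A (1 - 1 / real n)"
proof -
  have "ennreal (\<sigma>\<^sup>2) * X < \<infinity>"
    using fin by (intro le_less_trans[OF bound[of 1]]) (auto simp: ennreal_mult_less_top)
  then have "X < \<infinity>" using \<sigma> by (auto simp: ennreal_mult_less_top)
  then obtain x a t where x: "X = ennreal x" "0 \<le> x" and a: "A = ennreal a" "0 \<le> a" and t: "s = ennreal t" "0 \<le> t"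
    using fin by (cases X; cases A; cases s) auto
  have "\<sigma>\<^sup>2 * x \<le> real n * (a + t) powr (1 / real n) * a powr (1 - 1 / real n)"
  proof (rule optimal_scale)
    fix \<kappa> :: real assume \<kappa>: "\<kappa> > 0"
    have "0 \<le> (real n - 1) / \<kappa>" using n \<kappa> by simp
    then have "ennreal (\<sigma>\<^sup>2 * x) \<le> ennreal (\<kappa> ^ (n - 1) * (a + t) + (real n - 1) / \<kappa> * a)"
      using bound[OF \<kappa>] x a t \<kappa>
      by (simp only: ennreal_mult ennreal_plus mult_nonneg_nonneg add_nonneg_nonneg zero_le_power less_imp_le zero_le_power2)
    moreover have "0 \<le> \<kappa> ^ (n - 1) * (a + t) + (real n - 1) / \<kappa> * a"
      using \<open>0 \<le> (real n - 1) / \<kappa>\<close> a(2) t(2) \<kappa> by (intro add_nonneg_nonneg mult_nonneg_nonneg) auto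
    ultimately show "\<sigma>\<^sup>2 * x \<le> \<kappa> ^ (n - 1) * (a + t) + (real n - 1) / \<kappa> * a"
      by (simp only: ennreal_le_iff)
  qed (use a t n in auto)
  then have "x \<le> real n / \<sigma>\<^sup>2 * (a + t) powr (1 / real n) * a powr (1 - 1 / real n)"
    using \<sigma> by (simp add: field_simps)
  then have "ennreal x \<le> ennreal (real n / \<sigma>\<^sup>2) * ennreal ((a + t) powr (1 / real n)) * ennreal (a powr (1 - 1 / real n))"
    by (simp add: ennreal_mult[symmetric] ennreal_leI)
  then show ?thesis
    using a t x by (simp add: epowr_def ennreal_plus[symmetric] del: ennreal_plus)
qed

lemma epowr_half_power2: "(epowr X (1 / 2))\<^sup>2 = X"
proof (cases X)
  case (real r)
  then show ?thesis by (simp add: epowr_def ennreal_power powr_half_sqrt)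
qed (simp add: epowr_def power2_eq_square)

lemma epowr_L2_norm:
  assumes "(L2_norm p f)\<^sup>2 < \<infinity>" "n \<ge> 2"
  shows "epowr (L2_norm p f) (2 - 2 / real n) = epowr ((L2_norm p f)\<^sup>2) (1 - 1 / real n)"
proof -
  obtain x where x: "L2_norm p f = ennreal x" "0 \<le> x"
    using assms by (cases "L2_norm p f") (auto simp: power2_eq_square)
  have "x powr (2 - 2 / real n) = (x\<^sup>2) powr (1 - 1 / real n)"
  proof (cases "x = 0")
    case False
    then have "x\<^sup>2 = x powr 2" using x by simp
    then show ?thesis by (simp add: powr_powr right_diff_distrib)
  qed simp
  then show ?thesis using x by (simp add: epowr_def ennreal_power)
qed

lemma epowr_mult_of_nat:
  assumes "A < \<infinity>"
  shows "epowr (of_nat d * A) r = ennreal (real d powr r) * epowr A r"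
proof -
  obtain a where "A = ennreal a" "0 \<le> a" using assms by (cases A) auto
  then show ?thesis
    by (simp add: epowr_def ennreal_of_nat_eq_real_of_nat ennreal_mult[symmetric] powr_mult)
qed

lemma holder_ball_continuous:
  assumes "g \<in> holder_ball \<beta> \<Omega> H"
  shows "continuous_on \<Omega> g"
proof -
  have "continuous_on \<Omega> (\<lambda>x. g x $ i)" for i
  proof -
    obtain F where "cont_partials \<Omega> (strict_floor \<beta>) (\<lambda>x. g x $ i) F"
      using assms unfolding holder_ball_def by blast
    moreover have "mi_order (\<lambda>_. 0) \<le> strict_floor \<beta>" by (simp add: mi_order_def)
    ultimately have "continuous_on \<Omega> (F (\<lambda>_. 0))" "\<forall>x\<in>\<Omega>. F (\<lambda>_. 0) x = g x $ i"
      unfolding cont_partials_def by blast+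
    then show ?thesis by (simp cong: continuous_on_cong)
  qed
  then have "continuous_on \<Omega> (\<lambda>x. \<chi> i. g x $ i)" by (rule continuous_on_vec_lambda)
  then show ?thesis by simp
qed

section \<open>From components and directions to divergence and gradient\<close>

context gaussian_mixture_weight
begin

text \<open>The linear bounds are summed before \<kappa> is chosen. For the divergence only the
  pairs (i, i) occur, so the squared norm of \<open>h\<close> appears once, and the factor
  \<open>CARD('n)\<close> comes from the square of the sum. For the gradient all pairs (i, j) occur
  and the squared norm appears \<open>CARD('n)\<close> times; its power outside the bracket produces
  the exponent 1 - 1 / N of the dimension.\<close>

lemma gradient_bounds:
  fixes h :: "real ^ 'n \<Rightarrow> real ^ 'n"
  assumes N: "N \<ge> 2" and sob: "sobolev_seminorm N p h < \<infinity>" and fin: "(L2_norm p h)\<^sup>2 < \<infinity>"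
  shows "(div_norm p h)\<^sup>2 \<le> ennreal (real N * real CARD('n) / \<sigma>\<^sup>2)
      * epowr ((L2_norm p h)\<^sup>2 + ennreal (\<sigma> ^ (2 * N)) * (sobolev_seminorm N p h)\<^sup>2) (1 / real N)
      * epowr (L2_norm p h) (2 - 2 / real N)" (is ?div)
    and "(grad_norm p h)\<^sup>2 \<le> ennreal (real N * real CARD('n) powr (1 - 1 / real N) / \<sigma>\<^sup>2)
      * epowr (of_nat CARD('n) * (L2_norm p h)\<^sup>2 + ennreal (\<sigma> ^ (2 * N)) * (sobolev_seminorm N p h)\<^sup>2) (1 / real N)
      * epowr (L2_norm p h) (2 - 2 / real N)" (is ?grad)
proof -
  let ?e = "\<lambda>j. (\<lambda>_. 0)(j := N) :: 'n \<Rightarrow> nat"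
  let ?a = "\<lambda>\<kappa>. ennreal (\<kappa> ^ (N - 1))" and ?b = "\<lambda>\<kappa>. ennreal ((real N - 1) / \<kappa>)" and ?s = "ennreal (\<sigma> ^ (2 * N))"
  let ?D = "\<lambda>j. weak_deriv (mi_unit j)"
  define I where "I f = (\<integral>\<^sup>+y. ennreal ((f y)\<^sup>2) * p y \<partial>lebesgue)" for f
  define c where "c i y = h y $ i" for i y
  define S where "S = (sobolev_seminorm N p h)\<^sup>2"
  define A where "A = (L2_norm p h)\<^sup>2"
  have Ssum: "S = (\<Sum>i\<in>UNIV. \<Sum>k\<in>{k. mi_order k = N}. (weak_deriv_norm p k (c i))\<^sup>2)"
    unfolding S_def sobolev_seminorm_def epowr_half_power2 c_def ..
  have Sfin: "S < \<infinity>" using sob unfolding S_def by (auto simp: power2_eq_square ennreal_mult_less_top)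
  have term_le: "(\<Sum>j\<in>UNIV. (weak_deriv_norm p (?e j) (c i))\<^sup>2) \<le> (\<Sum>k\<in>{k. mi_order k = N}. (weak_deriv_norm p k (c i))\<^sup>2)" for i
  proof -
    \<comment> \<open>Since N > 0, the multi-indices with the single entry N in place j are
      distinct, so the pure derivatives form part of the sum in the seminorm without
      repetition.\<close>
    have inj: "inj ?e"
    proof (rule injI)
      fix j l assume "?e j = ?e l"
      then have "?e j j = ?e l j" by (rule fun_cong)
      then show "j = l" using N by (auto split: if_splits)
    qed
    have "(\<Sum>j\<in>UNIV. (weak_deriv_norm p (?e j) (c i))\<^sup>2) = (\<Sum>k\<in>range ?e. (weak_deriv_norm p k (c i))\<^sup>2)"
      by (rule sum.reindex[OF inj, unfolded comp_def, symmetric])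
    also have "\<dots> \<le> (\<Sum>k\<in>{k. mi_order k = N}. (weak_deriv_norm p k (c i))\<^sup>2)"
      by (rule sum_mono2) (auto simp: finite_mi_order mi_order_axis)
    finally show ?thesis .
  qed
  have wdn_sum: "(\<Sum>i\<in>UNIV. \<Sum>j\<in>UNIV. (weak_deriv_norm p (?e j) (c i))\<^sup>2) \<le> S"
    unfolding Ssum by (intro sum_mono term_le)
  have "(weak_deriv_norm p (?e j) (c i))\<^sup>2 < \<infinity>" for i j
  proof -
    have "(weak_deriv_norm p (?e j) (c i))\<^sup>2 \<le> (\<Sum>j\<in>UNIV. (weak_deriv_norm p (?e j) (c i))\<^sup>2)"
      by (rule member_le_sum) auto
    also have "\<dots> \<le> (\<Sum>i\<in>UNIV. \<Sum>j\<in>UNIV. (weak_deriv_norm p (?e j) (c i))\<^sup>2)"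
      by (rule member_le_sum[of i UNIV "\<lambda>i. \<Sum>j\<in>UNIV. (weak_deriv_norm p (?e j) (c i))\<^sup>2"]) auto
    also have "\<dots> \<le> S" by (rule wdn_sum)
    finally show ?thesis using Sfin by simp
  qed
  note wfin = this
  have wd: "weakly_diff (c i) (?e j)" for i j
    using wfin[of j i] unfolding weak_deriv_norm_def by (auto simp: power2_eq_square split: if_splits)
  have B: "(weak_deriv_norm p (?e j) (c i))\<^sup>2 = I (weak_deriv (?e j) (c i))" for i j
    using wd[of i j] by (simp add: weak_deriv_norm_def L2_norm_power2 I_def)
  then have Bfin: "I (weak_deriv (?e j) (c i)) < \<infinity>" for i j
    using wfin by metis
  have pm: "p \<in> borel_measurable lebesgue" by (rule measurable_completion) measurable
  \<comment> \<open>Existence of a weak derivative in any one direction already makes the component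
    locally integrable, hence Lebesgue measurable.\<close>
  have wm: "c i \<in> borel_measurable lebesgue" for i
    using wd[of i undefined] locally_integrable_borel_rep(1) by (auto simp: weakly_diff_def has_weak_deriv_def)
  have "(norm (h y))\<^sup>2 = (\<Sum>i\<in>UNIV. (c i y)\<^sup>2)" for y
    unfolding power2_norm_eq_inner inner_vec_def by (simp add: c_def power2_eq_square)
  then have "A = (\<integral>\<^sup>+y. (\<Sum>i\<in>UNIV. ennreal ((c i y)\<^sup>2) * p y) \<partial>lebesgue)"
    unfolding A_def L2_norm_power2 by (simp add: sum_ennreal sum_distrib_right[symmetric])
  then have Asum: "A = (\<Sum>i\<in>UNIV. I (c i))"
    unfolding I_def using wm pm by (simp add: nn_integral_sum)
  have Afin: "A < \<infinity>" using fin by (simp add: A_def)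
  have "I (c i) < \<infinity>" for i
  proof -
    have "I (c i) \<le> A" unfolding Asum by (rule member_le_sum) auto
    then show ?thesis using Afin by simp
  qed
  then have weak: "weakly_diff (c i) (mi_unit j)"
    and bound: "\<kappa> > 0 \<Longrightarrow> ennreal (\<sigma>\<^sup>2) * I (?D j (c i))
      \<le> ?a \<kappa> * (I (c i) + ?s * I (weak_deriv (?e j) (c i))) + ?b \<kappa> * I (c i)"
    for i j \<kappa>
    using weak_deriv_interpolation[OF wd[of i j] N] Bfin[of j i] unfolding I_def nn_integral_completion by blast+
  have dm: "?D j (c i) \<in> borel_measurable lebesgue" for i j
  proof -
    have "has_weak_deriv (c i) (mi_unit j) (?D j (c i))"
      using weak[of i j] unfolding weakly_diff_def weak_deriv_def by (rule someI_ex)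
    then show ?thesis using locally_integrable_borel_rep(1) by (auto simp: has_weak_deriv_def)
  qed
  have sfin: "?s * S < \<infinity>" using Sfin by (simp add: ennreal_mult_less_top)
  show ?div
  proof -
    let ?r = "epowr (A + ?s * S) (1 / real N)" and ?t = "epowr A (1 - 1 / real N)"
    define X where "X = (\<Sum>i\<in>UNIV. I (?D i (c i)))"
    have "(div_norm p h)\<^sup>2 = (\<integral>\<^sup>+y. ennreal ((weak_div h y)\<^sup>2) * p y \<partial>lebesgue)"
      using weak by (simp add: div_norm_def L2_norm_power2 c_def[abs_def])
    also have "\<dots> \<le> (\<integral>\<^sup>+y. of_nat CARD('n) * (\<Sum>i\<in>UNIV. ennreal ((?D i (c i) y)\<^sup>2) * p y) \<partial>lebesgue)"
    proof (rule nn_integral_mono)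
      fix y
      \<comment> \<open>Cauchy-Schwarz for the trace, the source of the dimension factor in the
        divergence bound.\<close>
      have "(weak_div h y)\<^sup>2 \<le> real CARD('n) * (\<Sum>i\<in>UNIV. (?D i (c i) y)\<^sup>2)"
        unfolding weak_div_def c_def[symmetric]
        using sum_squared_le_sum_of_squares[of "\<lambda>i. ?D i (c i) y" UNIV]
        by (simp add: c_def[abs_def] mult.commute)
      then have "ennreal ((weak_div h y)\<^sup>2) \<le> of_nat CARD('n) * (\<Sum>i\<in>UNIV. ennreal ((?D i (c i) y)\<^sup>2))"
        by (simp add: ennreal_of_nat_eq_real_of_nat sum_ennreal sum_nonneg ennreal_mult[symmetric] ennreal_leI)
      then show "ennreal ((weak_div h y)\<^sup>2) * p y \<le> of_nat CARD('n) * (\<Sum>i\<in>UNIV. ennreal ((?D i (c i) y)\<^sup>2) * p y)"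
        unfolding sum_distrib_right[symmetric] mult.assoc[symmetric] by (rule mult_right_mono) simp
    qed
    also have "\<dots> = of_nat CARD('n) * X"
      unfolding X_def I_def using dm pm by (simp add: nn_integral_cmult nn_integral_sum)
    finally have div: "(div_norm p h)\<^sup>2 \<le> of_nat CARD('n) * X" .
    have "X \<le> ennreal (real N / \<sigma>\<^sup>2) * ?r * ?t"
    proof (rule ennreal_optimal_scale[OF Afin sfin N \<sigma>])
      fix \<kappa> :: real assume \<kappa>: "\<kappa> > 0"
      have "ennreal (\<sigma>\<^sup>2) * X = (\<Sum>i\<in>UNIV. ennreal (\<sigma>\<^sup>2) * I (?D i (c i)))"
        by (simp add: X_def sum_distrib_left)
      also have "\<dots> \<le> (\<Sum>i\<in>UNIV. ?a \<kappa> * (I (c i) + ?s * I (weak_deriv (?e i) (c i))) + ?b \<kappa> * I (c i))"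
        by (intro sum_mono bound \<kappa>)
      also have "\<dots> = ?a \<kappa> * (A + ?s * (\<Sum>i\<in>UNIV. I (weak_deriv (?e i) (c i)))) + ?b \<kappa> * A"
        by (simp only: Asum sum.distrib sum_distrib_left[symmetric])
      also have "\<dots> \<le> ?a \<kappa> * (A + ?s * S) + ?b \<kappa> * A"
      proof (intro add_mono mult_left_mono order_refl)
        have "(\<Sum>i\<in>UNIV. I (weak_deriv (?e i) (c i))) \<le> (\<Sum>i\<in>UNIV. \<Sum>j\<in>UNIV. I (weak_deriv (?e j) (c i)))"
          by (intro sum_mono member_le_sum[of _ UNIV "\<lambda>j. I (weak_deriv (?e j) (c _))"]) auto
        also have "\<dots> \<le> S" using wdn_sum unfolding B .
        finally show "(\<Sum>i\<in>UNIV. I (weak_deriv (?e i) (c i))) \<le> S" .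
      qed auto
      finally show "ennreal (\<sigma>\<^sup>2) * X \<le> \<dots>" .
    qed
    then have "(div_norm p h)\<^sup>2 \<le> of_nat CARD('n) * (ennreal (real N / \<sigma>\<^sup>2) * ?r * ?t)"
      using div by (meson mult_left_mono order_trans zero_le)
    also have "\<dots> = ennreal (real N * real CARD('n) / \<sigma>\<^sup>2) * ?r * ?t"
    proof -
      have "ennreal (real N * real CARD('n) / \<sigma>\<^sup>2) = ennreal (real CARD('n) * (real N / \<sigma>\<^sup>2))" by (simp add: mult.commute)
      also have "\<dots> = of_nat CARD('n) * ennreal (real N / \<sigma>\<^sup>2)"
        unfolding ennreal_of_nat_eq_real_of_nat by (rule ennreal_mult) auto
      finally show ?thesis by (simp only: mult.assoc)
    qed
    finally show ?thesis unfolding A_def S_def epowr_L2_norm[OF fin N] .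
  qed
  show ?grad
  proof -
    define X where "X = (\<Sum>i\<in>UNIV. \<Sum>j\<in>UNIV. I (?D j (c i)))"
    let ?d = "of_nat CARD('n) :: ennreal"
    have "(norm (frobenius_norm (weak_jacobian h y)))\<^sup>2 = (\<Sum>i\<in>UNIV. \<Sum>j\<in>UNIV. (?D j (c i) y)\<^sup>2)" for y
      by (simp add: frobenius_norm_def weak_jacobian_def c_def[abs_def] sum_nonneg)
    then have "(grad_norm p h)\<^sup>2 = (\<integral>\<^sup>+y. (\<Sum>i\<in>UNIV. \<Sum>j\<in>UNIV. ennreal ((?D j (c i) y)\<^sup>2) * p y) \<partial>lebesgue)"
      using weak unfolding grad_norm_def c_def[abs_def]
      by (simp add: L2_norm_power2 sum_ennreal sum_nonneg sum_distrib_right[symmetric])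
    then have grad: "(grad_norm p h)\<^sup>2 = X"
      unfolding X_def I_def using dm pm by (simp add: nn_integral_sum)
    \<comment> \<open>Each component is counted once for every direction. In
      \<open>ennreal_optimal_scale\<close> the role of \<open>A\<close> is therefore played by
      \<open>?d * A\<close>, both inside and outside the bracket.\<close>
    have dA: "(\<Sum>i\<in>UNIV. \<Sum>j\<in>(UNIV :: 'n set). I (c i)) = ?d * A"
      by (simp add: Asum sum_distrib_left)
    have "X \<le> ennreal (real N / \<sigma>\<^sup>2) * epowr (?d * A + ?s * S) (1 / real N) * epowr (?d * A) (1 - 1 / real N)"
    proof (rule ennreal_optimal_scale[OF _ sfin N \<sigma>])
      show "?d * A < \<infinity>" using Afin by (simp add: ennreal_mult_less_top ennreal_of_nat_eq_real_of_nat)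
      fix \<kappa> :: real assume \<kappa>: "\<kappa> > 0"
      have "ennreal (\<sigma>\<^sup>2) * X = (\<Sum>i\<in>UNIV. \<Sum>j\<in>UNIV. ennreal (\<sigma>\<^sup>2) * I (?D j (c i)))"
        by (simp add: X_def sum_distrib_left)
      also have "\<dots> \<le> (\<Sum>i\<in>UNIV. \<Sum>j\<in>UNIV. ?a \<kappa> * (I (c i) + ?s * I (weak_deriv (?e j) (c i))) + ?b \<kappa> * I (c i))"
        by (intro sum_mono bound \<kappa>)
      also have "\<dots> = ?a \<kappa> * (?d * A + ?s * (\<Sum>i\<in>UNIV. \<Sum>j\<in>UNIV. I (weak_deriv (?e j) (c i)))) + ?b \<kappa> * (?d * A)"
        by (simp only: dA[symmetric] sum.distrib sum_distrib_left[symmetric])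
      also have "\<dots> \<le> ?a \<kappa> * (?d * A + ?s * S) + ?b \<kappa> * (?d * A)"
        using wdn_sum unfolding B by (intro add_mono mult_left_mono order_refl) auto
      finally show "ennreal (\<sigma>\<^sup>2) * X \<le> \<dots>" .
    qed
    also have "\<dots> = ennreal (real N * real CARD('n) powr (1 - 1 / real N) / \<sigma>\<^sup>2) * epowr (?d * A + ?s * S) (1 / real N) * epowr A (1 - 1 / real N)"
    proof -
      have "ennreal (real N * real CARD('n) powr (1 - 1 / real N) / \<sigma>\<^sup>2) = ennreal (real N / \<sigma>\<^sup>2) * ennreal (real CARD('n) powr (1 - 1 / real N))"
        by (simp add: ennreal_mult[symmetric])
      then show ?thesis unfolding epowr_mult_of_nat[OF Afin] by (simp only: mult_ac)
    qed
    finally show ?thesis unfolding grad A_def S_def epowr_L2_norm[OF fin N] .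
  qed
qed

end

lemma top_bound:
  assumes "A = \<infinity>" "c > 0" "B = \<infinity>"
  shows "x \<le> ennreal c * epowr A r * epowr B s"
  using assms by (simp add: epowr_def ennreal_mult_top)

theorem lemma3p2:
  fixes M :: "'w measure"
    and U :: "'w \<Rightarrow> real ^ 'd"
    and \<xi> :: "'w \<Rightarrow> real ^ 'D"
    and g :: "real ^ 'd \<Rightarrow> real ^ 'D"
    and p :: "real ^ 'D \<Rightarrow> ennreal"
    and h :: "real ^ 'D \<Rightarrow> real ^ 'D"
    and \<beta> H \<sigma> :: real
    and \<alpha> :: nat
  assumes "\<beta> > 0" and "H > 0" and "0 < \<sigma>" and "\<sigma> < 1"
    and "g \<in> holder_ball \<beta> (cbox 0 1) H"
    and "sup_norm (cbox 0 1) g \<le> 1"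
    and "prob_space M"
    and "distributed M lborel U
           (\<lambda>u. indicator (cbox 0 1) u / emeasure lborel (cbox 0 1 :: (real ^ 'd) set))"
    and "distributed M lborel \<xi> (\<lambda>z. ennreal (\<Prod>i\<in>UNIV. std_normal_density (z $ i)))"
    and "indep_rvs M U \<xi>"
    and "distributed M lborel (\<lambda>\<omega>. g (U \<omega>) + \<sigma> *\<^sub>R \<xi> \<omega>) p"
    and "\<alpha> \<ge> 2"
    and "sobolev_seminorm \<alpha> p h < \<infinity>"
  shows "((div_norm p h)\<^sup>2
           \<le> ennreal (real \<alpha> * real CARD('D) / \<sigma>\<^sup>2)
             * epowr ((L2_norm p h)\<^sup>2 + ennreal (\<sigma> ^ (2 * \<alpha>)) * (sobolev_seminorm \<alpha> p h)\<^sup>2) (1 / real \<alpha>)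
             * epowr (L2_norm p h) (2 - 2 / real \<alpha>))
         \<and> ((grad_norm p h)\<^sup>2
           \<le> ennreal (real \<alpha> * real CARD('D) powr (1 - 1 / real \<alpha>) / \<sigma>\<^sup>2)
             * epowr (of_nat CARD('D) * (L2_norm p h)\<^sup>2
                      + ennreal (\<sigma> ^ (2 * \<alpha>)) * (sobolev_seminorm \<alpha> p h)\<^sup>2) (1 / real \<alpha>)
             * epowr (L2_norm p h) (2 - 2 / real \<alpha>))"
proof (cases "(L2_norm p h)\<^sup>2 < \<infinity>")
  case True
  let ?m = "\<lambda>u. indicator (cbox 0 1) u *\<^sub>R g u"
  have g: "continuous_on (cbox 0 1) g" by (rule holder_ball_continuous[OF assms(5)])
  have g1: "norm (g u) \<le> 1" if "u \<in> cbox 0 1" for u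
  proof -
    have "ennreal (norm (g u)) \<le> sup_norm (cbox 0 1) g" unfolding sup_norm_def using that by (rule SUP_upper)
    also have "\<dots> \<le> ennreal 1" using assms(6) by simp
    finally show ?thesis by (subst (asm) ennreal_le_iff) auto
  qed
  interpret gaussian_mixture_weight p ?m \<sigma>
  proof
    show "?m \<in> borel_measurable borel" using g by (intro borel_measurable_continuous_on_indicator) auto
    show "norm (?m u) \<le> 1" for u using g1[of u] by (simp add: indicator_def)
    show "p \<in> borel_measurable borel" using distributed_borel_measurable[OF assms(11)] by simp
    show "(\<integral>\<^sup>+y. F y * p y \<partial>lborel)
      = (\<integral>\<^sup>+u. indicator (cbox 0 1) u * (\<integral>\<^sup>+y. F y * ennreal (gauss (?m u) \<sigma> y) \<partial>lborel) \<partial>lborel)"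
      if "F \<in> borel_measurable borel" for F
      by (rule gaussian_mixture[OF assms(7,3,8,9,10,11) g that])
  qed (rule assms(3))
  show ?thesis using gradient_bounds[OF assms(12,13) True] by blast
next
  case False
  \<comment> \<open>Both powers on the right are then infinite. The constants in front must be
    positive for the product to be infinite as well, because in \<open>ennreal\<close> the product
    of 0 and \<infinity> is 0.\<close>
  then have top: "L2_norm p h = \<infinity>"
    by (cases "L2_norm p h") (auto simp: ennreal_power)
  have "(L2_norm p h)\<^sup>2 = \<infinity>" unfolding top by (simp add: power2_eq_square)
  then have "(L2_norm p h)\<^sup>2 + ennreal (\<sigma> ^ (2 * \<alpha>)) * (sobolev_seminorm \<alpha> p h)\<^sup>2 = \<infinity>"
    "of_nat CARD('D) * (L2_norm p h)\<^sup>2 + ennreal (\<sigma> ^ (2 * \<alpha>)) * (sobolev_seminorm \<alpha> p h)\<^sup>2 = \<infinity>"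
    by (simp_all add: ennreal_mult_top)
  then show ?thesis using assms(3,12) top by (intro conjI top_bound) auto
qed

end
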